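(* Let $K_0\in\mathbb{K}$ with $J(K_0)=\alpha$, and suppose $X_0\succ0$. Let $L$ be the constant defined in the context (with this $\alpha$), let $0<\eta\le\mu\sigma_{\min}(R)\sigma_{\min}(C)^2/L$, and let $(K_i)_{i\ge0}$ be generated by the Gauss-Newton policy gradient method $$K_{i+1}=K_i-\eta\nabla^{\mathrm{GN}}J(K_i),\qquad \nabla^{\mathrm{GN}}J(K):=(R+B^\top P_KB)^{-1}\nabla J(K)\mathcal{L}_K^{-1}.$$ Then: (i) $J(K_i)$ is monotonically diminishing in $i$, i.e. $J(K_{i+1})\le J(K_i)$ for all $i$ (so $K_i\in\mathbb{K}_\alpha\subseteq\mathbb{K}$ for all $i$, i.e. every $K_i$ is stabilizing). (ii) For every $\epsilon>0$, an $\epsilon$-stationary point, i.e. an iterate $K_i$ with $\|\nabla^{\mathrm{GN}}J(K_i)\|_F\le\epsilon$, is reached within $$\frac{2\alpha}{\eta\mu\sigma_{\min}(R)\sigma_{\min}(C)^2\epsilon^2}$$ iterations. (iii) If $d=n$ and $C$ has rank $n$, then for every $\epsilon_J>0$ the iterate $K_N$ satisfies $J(K_N)-J_s^\star\le\epsilon_J$ whenever $$N\ge\frac{\|\Sigma_{K^\star}\|}{2\eta\mu}\log\left(\frac{J(K_0)-J_s^\star}{\epsilon_J}\right).$$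
   Context: Setting (static output feedback, SOF). $A\in\mathbb{R}^{n\times n}$, $B\in\mathbb{R}^{n\times m}$, $C\in\mathbb{R}^{d\times n}$; $(A,B)$ is controllable, $(C,A)$ is observable, and $C$ has linearly independent rows. $Q\in\mathbb{R}^{n\times n}$ and $R\in\mathbb{R}^{m\times m}$ are symmetric positive definite. $\mathcal{D}$ is a probability distribution on $\mathbb{R}^n$ with $X_0:=\mathbb{E}_{x_0\sim\mathcal{D}}[x_0x_0^\top]\succ 0$, and $\mu:=\sigma_{\min}(X_0)>0$. For $K\in\mathbb{R}^{m\times d}$ put $\mathcal{A}_K:=A-BKC$. The set of stabilizing gains is $\mathbb{K}:=\{K\in\mathbb{R}^{m\times d}:\rho(\mathcal{A}_K)<1\}$ ($\rho$ is the spectral radius), assumed nonempty. For $K\in\mathbb{K}$, $$J(K):=\mathbb{E}_{x_0\sim\mathcal{D}}\Big[\sum_{t=0}^\infty x_t^\top(Q+C^\top K^\top RKC)x_t\Big],\quad x_{t+1}=\mathcal{A}_Kx_t,\qquad \Sigma_K:=\mathbb{E}_{x_0\sim\mathcal{D}}\sum_{t=0}^\infty x_tx_t^\top,$$ $\mathcal{L}_K:=C\Sigma_KC^\top$, and $P_K$ is the unique solution of the Lyapunov equation $P_K=Q+C^\top K^\top RKC+\mathcal{A}_K^\top P_K\mathcal{A}_K$. Equivalently $J(K)=\mathrm{Tr}(P_KX_0)=\mathrm{Tr}((Q+C^\top K^\top RKC)\Sigma_K)$, and $\Sigma_K=X_0+\mathcal{A}_K\Sigma_K\mathcal{A}_K^\top$.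 $K^\star$ is a global minimizer of $J$ over $\mathbb{K}$. $\mathbb{K}_\alpha:=\{K\in\mathbb{K}: J(K)\le\alpha\}$. $\nabla J(K)\in\mathbb{R}^{m\times d}$ is the gradient with respect to the entries of $K$. $J_s^\star$ is the globally optimal cost of the corresponding full-state-feedback LQR problem, i.e. the minimum of $\mathbb{E}_{x_0\sim\mathcal{D}}[\sum_{t\ge0}(x_t^\top Qx_t+u_t^\top Ru_t)]$ with $x_{t+1}=Ax_t+Bu_t$, $u_t=-K_sx_t$, over all $K_s\in\mathbb{R}^{m\times n}$ with $\rho(A-BK_s)<1$. Constants: $$L=\frac{2\alpha}{\sigma_{\min}(Q)}\left(\|R\|+\frac{\alpha}{\mu}\Big(1+\frac{2\zeta_1}{\|B\|\|C\|}\Big)\|B\|^2\right)\|C\|^2,$$ $$\zeta_1=\frac{1}{\sigma_{\min}(Q)}\left(\frac{\alpha}{\mu}(1+\|B\|^2\|C\|^2)+\|R\|\|C\|^2\right)-1 .$$ Notation: $\|\cdot\|$ is the induced 2-norm, $\|\cdot\|_F$ the Frobenius norm, $\sigma_{\min}$ the minimal singular value (for $C\in\mathbb{R}^{d\times n}$ with independent rows, $\sigma_{\min}(C)=\sqrt{\lambda_{\min}(CC^\top)}>0$). *)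

theory Defs
  imports "HOL-Probability.Probability"
begin

text \<open>A matrix in \<open>\<real>\<^bsup>m \<times> n\<^esup>\<close> has type \<^typ>\<open>real^'n^'m\<close> (rows are indexed by the outer index).
  The induced 2-norm is \<^term>\<open>onorm ((*v) M)\<close>; the library norm \<^term>\<open>norm M\<close> of a matrix
  is its Frobenius norm, and \<^term>\<open>M \<bullet> N\<close> the corresponding trace inner product.\<close>

abbreviation norm2 :: "real^'n^'m \<Rightarrow> real"
  where "norm2 M \<equiv> onorm ((*v) M)"

abbreviation frob_norm :: "real^'n^'m \<Rightarrow> real"
  where "frob_norm M \<equiv> norm M"

definition sym_posdef :: "real^'n^'n \<Rightarrow> bool"
  where "sym_posdef M \<longleftrightarrow> transpose M = M \<and> (\<forall>x. x \<noteq> 0 \<longrightarrow> x \<bullet> (M *v x) > 0)"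

definition eigenvalues :: "'a::field^'n^'n \<Rightarrow> 'a set"
  where "eigenvalues M = {l. \<exists>v. v \<noteq> 0 \<and> M *v v = l *s v}"

definition spec_radius :: "real^'n^'n \<Rightarrow> real"
  where "spec_radius M = Max (cmod ` eigenvalues (map_matrix complex_of_real M))"

text \<open>This is the least singular value of a matrix with at most as many rows as columns;
  below it is only used for square matrices and for matrices with linearly independent rows.\<close>
definition sigma_min :: "real^'n^'m \<Rightarrow> real"
  where "sigma_min M = sqrt (Min (eigenvalues (M ** transpose M)))"

text \<open>A bare \<^term>\<open>rows M\<close> is a set, so repeated rows have to be excluded separately.\<close>
definition lin_indep_rows :: "real^'n^'m \<Rightarrow> bool"
  where "lin_indep_rows M \<longleftrightarrow> inj (\<lambda>i. row i M) \<and> independent (rows M)"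

definition outer :: "real^'n \<Rightarrow> real^'n \<Rightarrow> real^'n^'n"
  where "outer x y = (\<chi> i j. x $ i * y $ j)"

text \<open>The library's \<open>*\<close> and \<open>^\<close> act componentwise on vectors and matrices.\<close>
primrec mat_power :: "real^'n^'n \<Rightarrow> nat \<Rightarrow> real^'n^'n"
  where "mat_power M 0 = mat 1"
  | "mat_power M (Suc k) = M ** mat_power M k"

text \<open>The rank of the controllability matrix \<open>[B, A B, \<dots>, A\<^bsup>n-1\<^esup> B]\<close> is \<open>n\<close>, and dually
  the rank of the observability matrix with row blocks \<open>C, C A, \<dots>, C A\<^bsup>n-1\<^esup>\<close> is \<open>n\<close>.\<close>
definition controllable :: "real^'n^'n \<Rightarrow> real^'m^'n \<Rightarrow> bool"
  where "controllable A B \<longleftrightarrow>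
    dim (\<Union>k<CARD('n). columns (mat_power A k ** B)) = CARD('n)"

definition observable :: "real^'n^'d \<Rightarrow> real^'n^'n \<Rightarrow> bool"
  where "observable C A \<longleftrightarrow>
    dim (\<Union>k<CARD('n). rows (C ** mat_power A k)) = CARD('n)"

primrec trajectory :: "real^'n^'n \<Rightarrow> real^'n \<Rightarrow> nat \<Rightarrow> real^'n"
  where "trajectory M x0 0 = x0"
  | "trajectory M x0 (Suc t) = M *v trajectory M x0 t"

definition second_moment :: "(real^'n) measure \<Rightarrow> real^'n^'n"
  where "second_moment D = (LINT x0|D. outer x0 x0)"

definition closed_loop ::
    "real^'n^'n \<Rightarrow> real^'m^'n \<Rightarrow> real^'n^'d \<Rightarrow> real^'d^'m \<Rightarrow> real^'n^'n"
  where "closed_loop A B C K = A - B ** K ** C"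

definition stabilizing :: "real^'n^'n \<Rightarrow> real^'m^'n \<Rightarrow> real^'n^'d \<Rightarrow> (real^'d^'m) set"
  where "stabilizing A B C = {K. spec_radius (closed_loop A B C K) < 1}"

definition cost_weight ::
    "real^'n^'d \<Rightarrow> real^'n^'n \<Rightarrow> real^'m^'m \<Rightarrow> real^'d^'m \<Rightarrow> real^'n^'n"
  where "cost_weight C Q R K = Q + transpose C ** transpose K ** R ** K ** C"

definition sof_cost ::
    "real^'n^'n \<Rightarrow> real^'m^'n \<Rightarrow> real^'n^'d \<Rightarrow> real^'n^'n \<Rightarrow> real^'m^'m \<Rightarrow> (real^'n) measure
      \<Rightarrow> real^'d^'m \<Rightarrow> real"
  where "sof_cost A B C Q R D K =
    (LINT x0|D. (\<Sum>t. let x = trajectory (closed_loop A B C K) x0 t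
                        in x \<bullet> (cost_weight C Q R K *v x)))"

definition sublevel ::
    "real^'n^'n \<Rightarrow> real^'m^'n \<Rightarrow> real^'n^'d \<Rightarrow> real^'n^'n \<Rightarrow> real^'m^'m \<Rightarrow> (real^'n) measure
      \<Rightarrow> real \<Rightarrow> (real^'d^'m) set"
  where "sublevel A B C Q R D \<alpha> = {K \<in> stabilizing A B C. sof_cost A B C Q R D K \<le> \<alpha>}"

definition Sigma_mat ::
    "real^'n^'n \<Rightarrow> real^'m^'n \<Rightarrow> real^'n^'d \<Rightarrow> (real^'n) measure \<Rightarrow> real^'d^'m \<Rightarrow> real^'n^'n"
  where "Sigma_mat A B C D K =
    (LINT x0|D. (\<Sum>t. let x = trajectory (closed_loop A B C K) x0 t in outer x x))"

definition L_mat ::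
    "real^'n^'n \<Rightarrow> real^'m^'n \<Rightarrow> real^'n^'d \<Rightarrow> (real^'n) measure \<Rightarrow> real^'d^'m \<Rightarrow> real^'d^'d"
  where "L_mat A B C D K = C ** Sigma_mat A B C D K ** transpose C"

definition P_mat ::
    "real^'n^'n \<Rightarrow> real^'m^'n \<Rightarrow> real^'n^'d \<Rightarrow> real^'n^'n \<Rightarrow> real^'m^'m
      \<Rightarrow> real^'d^'m \<Rightarrow> real^'n^'n"
  where "P_mat A B C Q R K =
    (THE P. P = cost_weight C Q R K
                + transpose (closed_loop A B C K) ** P ** closed_loop A B C K)"

text \<open>Gradient with respect to the entries of \<open>K\<close>, i.e. with respect to the trace inner product.\<close>
definition grad_cost ::
    "real^'n^'n \<Rightarrow> real^'m^'n \<Rightarrow> real^'n^'d \<Rightarrow> real^'n^'n \<Rightarrow> real^'m^'m \<Rightarrow> (real^'n) measure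
      \<Rightarrow> real^'d^'m \<Rightarrow> real^'d^'m"
  where "grad_cost A B C Q R D K = (THE G. GDERIV (sof_cost A B C Q R D) K :> G)"

definition gn_grad ::
    "real^'n^'n \<Rightarrow> real^'m^'n \<Rightarrow> real^'n^'d \<Rightarrow> real^'n^'n \<Rightarrow> real^'m^'m \<Rightarrow> (real^'n) measure
      \<Rightarrow> real^'d^'m \<Rightarrow> real^'d^'m"
  where "gn_grad A B C Q R D K =
    matrix_inv (R + transpose B ** P_mat A B C Q R K ** B)
      ** grad_cost A B C Q R D K ** matrix_inv (L_mat A B C D K)"

definition state_cost ::
    "real^'n^'n \<Rightarrow> real^'m^'n \<Rightarrow> real^'n^'n \<Rightarrow> real^'m^'m \<Rightarrow> (real^'n) measure
      \<Rightarrow> real^'n^'m \<Rightarrow> real"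
  where "state_cost A B Q R D Ks =
    (LINT x0|D. (\<Sum>t. let x = trajectory (A - B ** Ks) x0 t; u = - (Ks *v x)
                        in x \<bullet> (Q *v x) + u \<bullet> (R *v u)))"

text \<open>A genuine minimum: it is attained when the pair is controllable and the data are
  positive definite.\<close>
definition opt_state_cost ::
    "real^'n^'n \<Rightarrow> real^'m^'n \<Rightarrow> real^'n^'n \<Rightarrow> real^'m^'m \<Rightarrow> (real^'n) measure \<Rightarrow> real"
  where "opt_state_cost A B Q R D =
    (LEAST c. \<exists>Ks. spec_radius (A - B ** Ks) < 1 \<and> c = state_cost A B Q R D Ks)"

definition zeta1 ::
    "real^'m^'n \<Rightarrow> real^'n^'d \<Rightarrow> real^'n^'n \<Rightarrow> real^'m^'m \<Rightarrow> real \<Rightarrow> real \<Rightarrow> real"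
  where "zeta1 B C Q R \<mu> \<alpha> =
    1 / sigma_min Q * (\<alpha> / \<mu> * (1 + (norm2 B)\<^sup>2 * (norm2 C)\<^sup>2) + norm2 R * (norm2 C)\<^sup>2) - 1"

definition smooth_const ::
    "real^'m^'n \<Rightarrow> real^'n^'d \<Rightarrow> real^'n^'n \<Rightarrow> real^'m^'m \<Rightarrow> real \<Rightarrow> real \<Rightarrow> real"
  where "smooth_const B C Q R \<mu> \<alpha> =
    2 * \<alpha> / sigma_min Q
      * (norm2 R + \<alpha> / \<mu> * (1 + 2 * zeta1 B C Q R \<mu> \<alpha> / (norm2 B * norm2 C)) * (norm2 B)\<^sup>2)
      * (norm2 C)\<^sup>2"

end

theory Submission
  imports Defs "HOL-Computational_Algebra.Fundamental_Theorem_Algebra"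
begin

text \<open>Everything reduces to the solution operator of the discrete Lyapunov equation: the cost is
  \<open>J(K) = X\<^sub>0 \<bullet> P\<^sub>K\<close>, and the operators for \<open>A\<^sub>K\<close> and its transpose are adjoint, which gives
  \<open>\<Sigma>\<^sub>K \<bullet> N\<close> for every matrix \<open>N\<close>. Differentiating the Lyapunov equation twice along a line and
  bounding the derivative of \<open>P\<^sub>K\<close> by a multiple of \<open>P\<^sub>K\<close> shows that the Hessian of \<open>J\<close> is at most
  \<open>L\<close> on the sublevel set. The slope of \<open>J\<close> along the Gauss-Newton direction is at least
  \<open>\<mu> \<sigma>\<^sub>m\<^sub>i\<^sub>n(R) \<sigma>\<^sub>m\<^sub>i\<^sub>n(C)\<^sup>2\<close> times the squared norm of the direction, so the step size bound gives
  descent, and summing the decrease gives the iteration count. If \<open>C\<close> is invertible, the problem is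
  full-state LQR, the exact cost difference formula applies, and completing the square bounds
  \<open>J(K) - J(K\<^sup>*)\<close> by the quantity that controls the decrease, which is linear convergence.\<close>

subsection \<open>Matrices\<close>

text \<open>The obstacle is that the set of stabilizing gains need not be convex or connected, so
  the Hessian bound is available only where the segment to the next iterate is already known to lie
  in the sublevel set. Membership is therefore followed continuously along the segment, using that
  stabilizing gains form an open set and sublevel sets are closed. Both facts come from quadratic
  Lyapunov functions \<open>x \<bullet> (P *v x)\<close>; the spectral radius enters only through
  its equivalence with the decay of all trajectories. The level \<alpha> enters the constants in two
  ways: \<open>P K\<close> is at most \<alpha>/\<mu> and the trace of \<open>Sig K\<close> at most
  \<open>\<alpha> / sigma_min Q\<close>. The factor \<open>zeta1\<close> is the ratio at which
  \<open>P\<close> dominates its own derivative in a direction of unit Frobenius norm. The step size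
  bound also forces \<open>\<eta> \<le> 1 / 2\<close>, which the linear rate relies on. The
  full-state optimum is not constructed: for left-invertible \<open>C\<close> every state gain has
  the form \<open>K ** C\<close>, so the given minimizer attains it.\<close>

lemma transpose_add: "transpose (A + B) = transpose A + transpose B"
  by (simp add: transpose_def vec_eq_iff)

lemma transpose_diff: "transpose (A - B) = transpose A - transpose B"
  by (simp add: transpose_def vec_eq_iff)

lemma transpose_uminus: "transpose (- A) = - transpose A"
  by (simp add: transpose_def vec_eq_iff)

lemma transpose_zero [simp]: "transpose 0 = 0"
  by (simp add: transpose_def vec_eq_iff)

lemma norm_transpose [simp]:
  fixes A :: "real^'n^'m"
  shows "norm (transpose A) = norm A"
  unfolding norm_eq_sqrt_inner inner_vec_def transpose_def
  by (simp, subst sum.swap, rule refl)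

lemma inner_transpose:
  fixes A B :: "real^'n^'m"
  shows "transpose A \<bullet> transpose B = A \<bullet> B"
  unfolding inner_vec_def transpose_def by (simp, subst sum.swap, rule refl)

lemma norm_matrix_vector_mult_le:
  fixes A :: "real^'n^'m"
  shows "norm (A *v x) \<le> norm A * norm x"
proof -
  have "norm (A *v x) = L2_set (\<lambda>i. norm ((A *v x) $ i)) UNIV"
    by (simp add: norm_vec_def)
  also have "\<dots> \<le> L2_set (\<lambda>i. norm (A $ i) * norm x) UNIV"
    by (intro L2_set_mono) (auto simp: matrix_vector_mul_component Cauchy_Schwarz_ineq2)
  also have "\<dots> = norm A * norm x"
    by (simp add: norm_vec_def flip: L2_set_left_distrib)
  finally show ?thesis .
qed

lemma norm_matrix_mult_le:
  fixes A :: "real^'n^'m" and B :: "real^'k^'n"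
  shows "norm (A ** B) \<le> norm A * norm B"
proof -
  have "norm ((A ** B) $ i) \<le> norm (A $ i) * norm B" for i
  proof -
    have "(A ** B) $ i = transpose B *v (A $ i)"
      by (simp add: vec_eq_iff matrix_matrix_mult_def vector_matrix_mult_def)
    then show ?thesis
      using norm_matrix_vector_mult_le[of "transpose B" "A $ i"] by (simp add: mult.commute)
  qed
  then have "L2_set (\<lambda>i. norm ((A ** B) $ i)) UNIV \<le> L2_set (\<lambda>i. norm (A $ i) * norm B) UNIV"
    by (intro L2_set_mono) auto
  also have "\<dots> = norm A * norm B"
    by (simp add: norm_vec_def flip: L2_set_left_distrib)
  finally show ?thesis by (simp add: norm_vec_def)
qed

text \<open>Provides limits, derivatives and infinite sums of matrix products; submultiplicativity
  of the Frobenius norm is the required bound with constant 1.\<close>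

interpretation matrix_mult: bounded_bilinear
  "(**) :: real^'n^'m \<Rightarrow> real^'k^'n \<Rightarrow> real^'k^'m"
proof
  show "\<exists>K. \<forall>(a::real^'n^'m) (b::real^'k^'n). norm (a ** b) \<le> norm a * norm b * K"
    using norm_matrix_mult_le by (intro exI[of _ 1]) auto
qed (simp_all add: matrix_add_ldistrib matrix_matrix_mult_def vec_eq_iff sum.distrib
    algebra_simps scaleR_sum_right sum_distrib_left)

lemma bounded_linear_transpose: "bounded_linear (transpose :: real^'n^'m \<Rightarrow> real^'m^'n)"
  by (rule bounded_linear_intro[of _ 1]) (auto simp: transpose_add transpose_scalar)

lemma inner_matrix_mult_left:
  fixes F :: "real^'n^'m" and N :: "real^'k^'n"
  shows "(F ** N) \<bullet> X = N \<bullet> (transpose F ** X)"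
proof -
  have "(F ** N) \<bullet> X = (\<Sum>i\<in>UNIV. \<Sum>j\<in>UNIV. \<Sum>k\<in>UNIV. F$i$k * N$k$j * X$i$j)"
    by (simp add: inner_vec_def matrix_matrix_mult_def sum_distrib_right)
  also have "\<dots> = (\<Sum>k\<in>UNIV. \<Sum>j\<in>UNIV. \<Sum>i\<in>UNIV. F$i$k * N$k$j * X$i$j)"
    by (subst sum.swap, subst (2) sum.swap, subst sum.swap) (rule refl)
  also have "\<dots> = N \<bullet> (transpose F ** X)"
    by (simp add: inner_vec_def matrix_matrix_mult_def sum_distrib_left transpose_def algebra_simps)
  finally show ?thesis .
qed

lemma inner_matrix_mult_right:
  fixes F :: "real^'k^'n" and N :: "real^'n^'m"
  shows "(N ** F) \<bullet> X = N \<bullet> (X ** transpose F)"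
  by (metis (no_types, lifting) inner_matrix_mult_left inner_transpose matrix_transpose_mul
      transpose_transpose)

lemma inner_matrix_vector_transpose:
  fixes A :: "real^'n^'m"
  shows "x \<bullet> (A *v y) = (transpose A *v x) \<bullet> y"
  by (simp add: dot_lmul_matrix)

lemma inner_outer: "N \<bullet> outer x y = x \<bullet> (N *v y)"
  by (simp add: outer_def inner_vec_def matrix_vector_mult_def sum_distrib_left algebra_simps)

lemmas matrix_simps =
  matrix_mult.add_left matrix_mult.add_right matrix_mult.diff_left matrix_mult.diff_right
  matrix_mult.minus_left matrix_mult.minus_right matrix_mult.scaleR_left matrix_mult.scaleR_right
  transpose_add transpose_diff transpose_uminus transpose_scalar matrix_transpose_mul

lemma norm2_bound: "norm (A *v x) \<le> norm2 A * norm (x :: real^'n)"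
  by (rule onorm) simp

lemma norm2_nonneg: "0 \<le> norm2 (A :: real^'n^'m)"
  by (rule onorm_pos_le) simp

subsection \<open>Spectral radius and decay of the powers\<close>

text \<open>Horner's scheme for the vector \<open>p(M) v\<close>. Acting on one vector at a time
  serves the real and the complex field alike, without a ring of matrix polynomials.\<close>

definition poly_act :: "'a::field^'n^'n \<Rightarrow> 'a poly \<Rightarrow> 'a^'n \<Rightarrow> 'a^'n"
  where "poly_act M p v = fold_coeffs (\<lambda>a w. a *s v + M *v w) p 0"

lemma poly_act_0 [simp]: "poly_act M 0 v = 0"
  by (simp add: poly_act_def)

lemma poly_act_pCons [simp]: "poly_act M (pCons a p) v = a *s v + M *v poly_act M p v"
  by (cases "p = 0 \<and> a = 0") (auto simp: poly_act_def)

lemma poly_act_add: "poly_act M (p + q) v = poly_act M p v + poly_act M q v"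
  by (induction p q rule: poly_induct2)
    (auto simp: algebra_simps vector_sadd_rdistrib matrix_vector_right_distrib)

lemma poly_act_smult: "poly_act M (smult c p) v = c *s poly_act M p v"
  by (induction p)
    (auto simp: vector_add_ldistrib vector_smult_assoc vector_scalar_commute)

lemma poly_act_vec_add: "poly_act M p (v + w) = poly_act M p v + poly_act M p w"
  by (induction p) (auto simp: algebra_simps vector_add_ldistrib matrix_vector_right_distrib)

lemma poly_act_vec_scale: "poly_act M p (c *s v) = c *s poly_act M p v"
  by (induction p)
    (auto simp: vector_add_ldistrib vector_smult_assoc vector_scalar_commute mult.commute)

lemma poly_act_commute: "poly_act M p (M *v v) = M *v poly_act M p v"
  by (induction p) (auto simp: matrix_vector_right_distrib vector_scalar_commute)

lemma poly_act_linear_factor: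
  "poly_act M ([:- l, 1:] * p) v = M *v poly_act M p v - l *s poly_act M p v"
proof -
  have "[:- l, 1:] * p = pCons 0 p + smult (- l) p" by simp
  then show ?thesis by (simp only: poly_act_add poly_act_smult) (simp add: vec_eq_iff)
qed

lemma poly_act_eigenvector: "M *v v = l *s v \<Longrightarrow> poly_act M p v = poly p l *s v"
  by (induction p) (auto simp: vector_sadd_rdistrib vector_scalar_commute vector_smult_assoc mult.commute)

text \<open>One more power of \<open>M\<close> than the dimension of the matrix space must be
  linearly dependent, and the coefficients of the dependence form the polynomial.\<close>

lemma exists_annihilating_poly:
  fixes M :: "real^'n^'n"
  shows "\<exists>p. p \<noteq> 0 \<and> (\<forall>v. poly_act M p v = 0)"
proof -
  define P where "P k = mat_power M k" for k
  let ?I = "{..DIM(real^'n^'n)}"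
  have act: "poly_act M (monom a k) v = a *s (P k *v v)" for a k v
    by (induction k) (auto simp: P_def monom_Suc monom_0 vector_scalar_commute matrix_vector_mul_assoc)
  have act_sum: "poly_act M (\<Sum>k\<in>I. monom (c k) k) v = (\<Sum>k\<in>I. c k *\<^sub>R P k) *v v"
    if "finite I" for c v I
    using that
    by (induction I rule: finite_induct)
      (auto simp: act poly_act_add matrix_vector_mult_add_rdistrib scalar_mult_eq_scaleR
        scaleR_matrix_vector_assoc)
  have co: "coeff (\<Sum>k\<in>I. monom (c k) k) j = c j" if "finite I" "j \<in> I" for c :: "nat \<Rightarrow> real" and j I
    using that by (simp add: coeff_sum if_distrib sum.delta cong: if_cong)
  show ?thesis
  \<comment> \<open>\<open>dependent\<close> speaks of sets, where equal powers collapse into one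
    element. A coincidence of two powers is therefore treated apart, by a difference of two
    monomials.\<close>
  proof (cases "inj_on P ?I")
    case False
    then obtain i j where ij: "i \<in> ?I" "j \<in> ?I" "i \<noteq> j" "P i = P j"
      by (auto simp: inj_on_def)
    let ?c = "\<lambda>k. if k = i then 1 else (-1::real)"
    have "poly_act M (\<Sum>k\<in>{i,j}. monom (?c k) k) v = 0" for v
      using ij by (subst act_sum) auto
    moreover have "(\<Sum>k\<in>{i,j}. monom (?c k) k) \<noteq> 0"
      using co[of "{i,j}" i ?c] by force
    ultimately show ?thesis by blast
  next
    case True
    have "card (P ` ?I) > DIM(real^'n^'n)"
      using True by (simp add: card_image)
    then have "dependent (P ` ?I)"
      by (intro dependent_biggerset) auto
    then obtain u where u: "\<exists>x\<in>P ` ?I. u x \<noteq> 0" "(\<Sum>x\<in>P ` ?I. u x *\<^sub>R x) = 0"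
      by (subst (asm) dependent_finite) auto
    have "(\<Sum>k\<in>?I. u (P k) *\<^sub>R P k) = 0"
      using u(2) True by (simp add: sum.reindex)
    then have "poly_act M (\<Sum>k\<in>?I. monom (u (P k)) k) v = 0" for v
      by (subst act_sum) auto
    moreover obtain i where "i \<in> ?I" "u (P i) \<noteq> 0"
      using u(1) by auto
    then have "(\<Sum>k\<in>?I. monom (u (P k)) k) \<noteq> 0"
      using co[of ?I i "\<lambda>k. u (P k)"] by (metis coeff_0 finite_atMost)
    ultimately show ?thesis by blast
  qed
qed

section \<open>Passage from real to complex vectors, and eigenvalues\<close>

definition cvec :: "real^'n \<Rightarrow> complex^'n"
  where "cvec x = (\<chi> i. complex_of_real (x $ i))"

lemma cvec_mult: "map_matrix complex_of_real M *v cvec x = cvec (M *v x)"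
  by (simp add: cvec_def matrix_vector_mult_def vec_eq_iff)

lemma norm_cvec: "norm (cvec x) = norm x"
  by (simp add: cvec_def norm_vec_def)

lemma poly_act_cvec:
  "poly_act (map_matrix complex_of_real M) (map_poly of_real p) (cvec x) = cvec (poly_act M p x)"
  by (induction p) (auto simp: map_poly_pCons cvec_mult cvec_def vec_eq_iff matrix_vector_mult_def)

lemma complex_vec_decompose: "\<exists>x y. v = cvec x + \<i> *s cvec y"
  by (intro exI[of _ "\<chi> i. Re (v $ i)"] exI[of _ "\<chi> i. Im (v $ i)"])
    (simp add: cvec_def vec_eq_iff complex_eq_iff)

lemma exists_annihilating_poly_complex:
  fixes M :: "real^'n^'n"
  shows "\<exists>p. p \<noteq> 0 \<and> (\<forall>v. poly_act (map_matrix complex_of_real M) p v = 0)"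
proof -
  obtain p where p: "p \<noteq> 0" "\<And>v. poly_act M p v = 0"
    using exists_annihilating_poly[of M] by blast
  have "poly_act (map_matrix complex_of_real M) (map_poly of_real p) v = 0" for v
  proof -
    obtain x y where v: "v = cvec x + \<i> *s cvec y"
      using complex_vec_decompose by blast
    have "cvec (0 :: real^'n) = 0" by (simp add: cvec_def vec_eq_iff)
    then show ?thesis
      unfolding v poly_act_vec_add poly_act_vec_scale poly_act_cvec p by (simp only: vector_smult_rzero add_0_left)
  qed
  moreover have "map_poly complex_of_real p \<noteq> 0"
    using p(1) by (simp add: map_poly_eq_0_iff)
  ultimately show ?thesis by blast
qed

lemma finite_eigenvalues_complex:
  "finite (eigenvalues (map_matrix complex_of_real M))" (is "finite (eigenvalues ?M)")
proof -
  obtain p where p: "p \<noteq> 0" "\<And>v. poly_act (map_matrix complex_of_real M) p v = 0"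
    using exists_annihilating_poly_complex[of M] by blast
  have "eigenvalues (map_matrix complex_of_real M) \<subseteq> {l. poly p l = 0}"
  proof
    fix l assume "l \<in> eigenvalues ?M"
    then obtain v where v: "v \<noteq> 0" "?M *v v = l *s v"
      by (auto simp: eigenvalues_def)
    then have "poly p l *s v = 0"
      using p(2) poly_act_eigenvector by metis
    with v(1) show "l \<in> {l. poly p l = 0}" by simp
  qed
  then show ?thesis
    using poly_roots_finite[OF p(1)] finite_subset by blast
qed

lemma finite_eigenvalues: "finite (eigenvalues (M :: real^'n^'n))" (is "finite (eigenvalues ?M)")
proof -
  obtain p where p: "p \<noteq> 0" "\<And>v. poly_act M p v = 0"
    using exists_annihilating_poly[of M] by blast
  have "eigenvalues M \<subseteq> {l. poly p l = 0}"
  proof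
    fix l assume "l \<in> eigenvalues ?M"
    then obtain v where v: "v \<noteq> 0" "?M *v v = l *s v"
      by (auto simp: eigenvalues_def)
    then have "poly p l *s v = 0"
      using p(2) poly_act_eigenvector by metis
    with v(1) show "l \<in> {l. poly p l = 0}" by simp
  qed
  then show ?thesis
    using poly_roots_finite[OF p(1)] finite_subset by blast
qed

text \<open>Without eigenvalues every factor \<open>M - l\<close> would be injective, so splitting
  the roots off an annihilating polynomial one by one would force every vector to be zero. This
  gives the \<open>Max\<close> in \<open>spec_radius\<close> its meaning.\<close>

lemma eigenvalues_nonempty: "eigenvalues (map_matrix complex_of_real M) \<noteq> {}"
proof
  let ?M = "map_matrix complex_of_real M"
  assume e: "eigenvalues ?M = {}"
  have *: "v = 0" if "p \<noteq> 0" "poly_act ?M p v = 0" for p v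
    using that
  proof (induction "degree p" arbitrary: p)
    case 0
    then obtain a where "p = [:a:]" by (metis degree_eq_zeroE)
    with 0 show ?case by simp
  next
    case (Suc n)
    then have "\<not> constant (poly p)" by (simp add: constant_degree)
    then obtain l where "poly p l = 0"
      using fundamental_theorem_of_algebra by blast
    then obtain q where q: "p = [:- l, 1:] * q"
      using poly_eq_0_iff_dvd by (metis dvdE)
    with Suc.prems have "q \<noteq> 0" by auto
    have "degree p = Suc (degree q)"
      unfolding q by (subst degree_mult_eq) (use \<open>q \<noteq> 0\<close> in auto)
    moreover have "?M *v poly_act ?M q v = l *s poly_act ?M q v"
      using Suc.prems unfolding q poly_act_linear_factor by simp
    then have "poly_act ?M q v = 0"
      using e by (auto simp: eigenvalues_def)
    ultimately show ?case
      using Suc.hyps \<open>q \<noteq> 0\<close> by auto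
  qed
  obtain p where "p \<noteq> 0" "\<And>v. poly_act ?M p v = 0"
    using exists_annihilating_poly_complex[of M] by blast
  then have "(axis undefined 1 :: complex^'a) = 0"
    using * by blast
  then show False by (metis axis_eq_0_iff zero_neq_one)
qed

lemma spec_radius_less_iff:
  "spec_radius M < r \<longleftrightarrow> (\<forall>l\<in>eigenvalues (map_matrix complex_of_real M). cmod l < r)"
  unfolding spec_radius_def
  using finite_eigenvalues_complex[of M] eigenvalues_nonempty[of M] by simp

text \<open>Induction on the degree of a polynomial annihilating the single vector \<open>v\<close>.
  For a factor \<open>X - l\<close> with cofactor \<open>s\<close>, either \<open>s\<close> already
  annihilates \<open>v\<close>, or \<open>s(M) v\<close> is an eigenvector and \<open>l\<close>
  obeys the bound \<open>r\<close>.\<close>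

lemma power_bound_complex:
  fixes M :: "complex^'n^'n"
  assumes ev: "\<And>l. l \<in> eigenvalues M \<Longrightarrow> cmod l \<le> r" and r: "0 \<le> r" "r < q"
    and p: "p \<noteq> 0" "poly_act M p v = 0"
  shows "\<exists>c. \<forall>t. norm (((*v) M ^^ t) v) \<le> c * q ^ t"
  using p
proof (induction "degree p" arbitrary: p v)
  case 0
  then obtain a where "p = [:a:]" by (metis degree_eq_zeroE)
  with 0 have "v = 0" by simp
  have "((*v) M ^^ t) 0 = 0" for t by (induction t) auto
  with \<open>v = 0\<close> show ?case by (intro exI[of _ 0]) auto
next
  case (Suc n)
  then have "\<not> constant (poly p)" by (simp add: constant_degree)
  then obtain l where "poly p l = 0"
    using fundamental_theorem_of_algebra by blast
  then obtain s where s: "p = [:- l, 1:] * s"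
    using poly_eq_0_iff_dvd by (metis dvdE)
  with Suc.prems have "s \<noteq> 0" by auto
  have "degree p = Suc (degree s)"
    unfolding s by (subst degree_mult_eq) (use \<open>s \<noteq> 0\<close> in auto)
  with Suc.hyps have ds: "n = degree s" by simp
  have el: "M *v poly_act M s v = l *s poly_act M s v"
    using Suc.prems unfolding s poly_act_linear_factor by simp
  show ?case
  proof (cases "poly_act M s v = 0")
    case True
    then show ?thesis using Suc.hyps(1)[OF ds \<open>s \<noteq> 0\<close>] by blast
  next
    case False
    then have "cmod l \<le> r" using el ev by (auto simp: eigenvalues_def)
    \<comment> \<open>\<open>y\<close> is annihilated by the shorter polynomial \<open>s\<close>,
      and \<open>M^(t+1) v = M^t y + l M^t v\<close> is a recurrence whose forcing term the
      induction hypothesis controls.\<close>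
    define y where "y = M *v v - l *s v"
    have "poly_act M s y = 0"
      using el poly_act_vec_add[of M s y "l *s v"]
      by (simp add: y_def poly_act_commute poly_act_vec_scale)
    then obtain c where c: "\<And>t. norm (((*v) M ^^ t) y) \<le> c * q ^ t"
      using Suc.hyps(1)[OF ds \<open>s \<noteq> 0\<close>] by blast
    \<comment> \<open>The second summand gives \<open>c + r * d \<le> q * d\<close>, which closes
      the recurrence; the first covers \<open>t = 0\<close>.\<close>
    define d where "d = norm v + c / (q - r)"
    have "c \<ge> 0" using order_trans[OF norm_ge_zero c[of 0]] by simp
    have lin: "((*v) M ^^ t) (a + b) = ((*v) M ^^ t) a + ((*v) M ^^ t) b"
        "((*v) M ^^ t) (k *s a) = k *s ((*v) M ^^ t) a" for t a b k
      by (induction t) (auto simp: matrix_vector_right_distrib vector_scalar_commute)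
    have "norm (((*v) M ^^ t) v) \<le> d * q ^ t" for t
    proof (induction t)
      case 0
      then show ?case using \<open>c \<ge> 0\<close> r by (simp add: d_def)
    next
      case (Suc t)
      have "((*v) M ^^ Suc t) v = ((*v) M ^^ t) (y + l *s v)"
        by (simp add: y_def funpow_swap1)
      also have "\<dots> = ((*v) M ^^ t) y + l *s ((*v) M ^^ t) v"
        by (simp only: lin)
      finally have "norm (((*v) M ^^ Suc t) v) \<le> c * q ^ t + cmod l * norm (((*v) M ^^ t) v)"
        using c[of t] norm_triangle_ineq[of "((*v) M ^^ t) y" "l *s ((*v) M ^^ t) v"]
        by (simp add: norm_vec_def norm_mult flip: L2_set_right_distrib)
      also have "\<dots> \<le> c * q ^ t + r * (d * q ^ t)"
        using Suc \<open>cmod l \<le> r\<close> r by (intro add_left_mono mult_mono) auto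
      also have "\<dots> = (c + r * d) * q ^ t" by (simp add: algebra_simps)
      also have "\<dots> \<le> (q * d) * q ^ t"
      proof (rule mult_right_mono)
        have "(q - r) * d \<ge> c"
          using r by (simp add: d_def distrib_left)
        then show "c + r * d \<le> q * d" by (simp add: algebra_simps)
      qed (use r in auto)
      finally show ?case by (simp add: mult_ac)
    qed
    then show ?thesis by blast
  qed
qed

lemma mat_power_mult_vec: "mat_power M t *v x = trajectory M x t"
  by (induction t) (auto simp flip: matrix_vector_mul_assoc)

lemma spec_radius_less_1_imp_power_bound:
  fixes M :: "real^'n^'n"
  assumes "spec_radius M < 1"
  shows "\<exists>c q. 0 \<le> q \<and> q < 1 \<and> (\<forall>t. norm (mat_power M t) \<le> c * q ^ t)"
proof -
  let ?M = "map_matrix complex_of_real M"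
  define r where "r = max 0 (spec_radius M)"
  have r: "0 \<le> r" "r < 1" using assms by (auto simp: r_def)
  have ev: "cmod l \<le> r" if "l \<in> eigenvalues ?M" for l
    using that finite_eigenvalues_complex[of M] by (simp add: r_def spec_radius_def le_max_iff_disj)
  \<comment> \<open>Any ratio strictly between \<open>r\<close> and 1 serves; the gap above
    \<open>r\<close> absorbs the polynomial growth of a matrix that is not diagonalizable.\<close>
  define q where "q = (r + 1) / 2"
  have q: "r < q" "q < 1" using r by (auto simp: q_def)
  obtain p where p: "p \<noteq> 0" "\<And>v. poly_act ?M p v = 0"
    using exists_annihilating_poly_complex[of M] by blast
  have "\<exists>c. \<forall>t. norm (((*v) ?M ^^ t) (cvec (axis j 1))) \<le> c * q ^ t" for j
    using power_bound_complex[OF ev r(1) q(1) p(1) p(2)] by blast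
  then obtain c where c: "\<And>j t. norm (((*v) ?M ^^ t) (cvec (axis j 1))) \<le> c j * q ^ t"
    by metis
  have pow: "((*v) ?M ^^ t) (cvec x) = cvec (mat_power M t *v x)" for t x
    by (induction t) (auto simp: cvec_mult matrix_vector_mul_assoc)
  have col: "norm (column j (mat_power M t)) \<le> c j * q ^ t" for j t
    using c[of t j] by (simp add: pow norm_cvec matrix_vector_mult_basis)
  have "norm (mat_power M t) \<le> (\<Sum>j\<in>UNIV. c j) * q ^ t" for t
  proof -
    have "norm (mat_power M t) = norm (transpose (mat_power M t))" by simp
    also have "\<dots> \<le> (\<Sum>j\<in>UNIV. norm (transpose (mat_power M t) $ j))"
      by (subst norm_vec_def) (rule L2_set_le_sum, simp)
    also have "\<dots> = (\<Sum>j\<in>UNIV. norm (column j (mat_power M t)))"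
      by (simp add: transpose_def column_def)
    also have "\<dots> \<le> (\<Sum>j\<in>UNIV. c j * q ^ t)"
      by (intro sum_mono col)
    finally show ?thesis by (simp add: sum_distrib_right)
  qed
  then show ?thesis using r q by (intro exI[of _ "\<Sum>j\<in>UNIV. c j"] exI[of _ q]) auto
qed

text \<open>Trajectories started in the real and imaginary parts of an eigenvector recombine to
  \<open>l ^ t *s v\<close>, so their decay forces \<open>cmod l < 1\<close>. Every later stability
  proof ends here.\<close>

lemma trajectory_tendsto_0_imp_spec_radius_less_1:
  fixes M :: "real^'n^'n"
  assumes "\<And>x. trajectory M x \<longlonglongrightarrow> 0"
  shows "spec_radius M < 1"
  unfolding spec_radius_less_iff
proof
  let ?M = "map_matrix complex_of_real M"
  fix l assume "l \<in> eigenvalues ?M"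
  then obtain v where v: "v \<noteq> 0" "?M *v v = l *s v"
    by (auto simp: eigenvalues_def)
  obtain x y where xy: "v = cvec x + \<i> *s cvec y"
    using complex_vec_decompose by blast
  define T where "T t = cvec (trajectory M x t) + \<i> *s cvec (trajectory M y t)" for t
  have T: "T t = l ^ t *s v" for t
  proof (induction t)
    case 0
    then show ?case by (simp add: T_def xy)
  next
    case (Suc t)
    have "T (Suc t) = ?M *v T t"
      by (simp add: T_def cvec_mult matrix_vector_right_distrib vector_scalar_commute)
    then show ?case
      by (simp add: Suc v vector_scalar_commute vector_smult_assoc mult.commute)
  qed
  obtain i where i: "v $ i \<noteq> 0" using v(1) by (auto simp: vec_eq_iff)
  have lim: "(\<lambda>t. trajectory M z t $ i) \<longlonglongrightarrow> 0" for z
    using tendsto_vec_nth[OF assms, of z i] by simp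
  have "(\<lambda>t. of_real (trajectory M x t $ i) + \<i> * of_real (trajectory M y t $ i)) \<longlonglongrightarrow> of_real 0 + \<i> * of_real 0"
    by (intro tendsto_intros lim)
  then have "(\<lambda>t. T t $ i) \<longlonglongrightarrow> 0"
    by (simp add: T_def cvec_def)
  then have "(\<lambda>t. l ^ t * v $ i) \<longlonglongrightarrow> 0"
    by (simp add: T)
  then have "(\<lambda>t. l ^ t * v $ i / v $ i) \<longlonglongrightarrow> 0 / v $ i"
    by (intro tendsto_divide tendsto_const) (use i in auto)
  then have "(\<lambda>t. l ^ t) \<longlonglongrightarrow> 0"
    using i by simp
  then have "(\<lambda>t. cmod (l ^ t)) \<longlonglongrightarrow> 0"
    by (simp add: tendsto_norm_zero_iff)
  then have "(\<lambda>t. cmod l ^ t) \<longlonglongrightarrow> 0"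
    by (simp add: norm_power)
  then show "cmod l < 1"
    using LIMSEQ_le_const[of "\<lambda>t. cmod l ^ t" 0 1] by (force simp: not_less one_le_power intro: leI)
qed

subsection \<open>Positive semidefinite matrices\<close>

text \<open>Symmetry is kept separate: in \<open>psd_inner_nonneg\<close> only one of the two paired
  matrices has to be symmetric.\<close>

definition psd :: "real^'n^'n \<Rightarrow> bool"
  where "psd M \<longleftrightarrow> (\<forall>x. 0 \<le> x \<bullet> (M *v x))"

lemma psdD: "psd M \<Longrightarrow> 0 \<le> x \<bullet> (M *v x)"
  by (simp add: psd_def)

lemma quad_congruence:
  fixes F :: "real^'n^'m"
  shows "x \<bullet> ((transpose F ** M ** F) *v x) = (F *v x) \<bullet> (M *v (F *v x))"
  by (simp add: inner_matrix_vector_transpose[of x "transpose F"] del: transpose_matrix_vector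
      flip: matrix_vector_mul_assoc)

lemma psd_congruence:
  fixes F :: "real^'n^'m"
  shows "psd M \<Longrightarrow> psd (transpose F ** M ** F)"
  by (simp add: psd_def quad_congruence)

lemma sym_inner_commute:
  fixes P :: "real^'n^'n"
  assumes "transpose P = P"
  shows "x \<bullet> (P *v y) = y \<bullet> (P *v x)"
  by (metis assms inner_commute inner_matrix_vector_transpose)

lemma psd_Cauchy_Schwarz:
  fixes P :: "real^'n^'n"
  assumes P: "transpose P = P" "psd P"
  shows "(x \<bullet> (P *v y))\<^sup>2 \<le> (x \<bullet> (P *v x)) * (y \<bullet> (P *v y))"
proof -
  define a b c where "a = x \<bullet> (P *v x)" and "b = x \<bullet> (P *v y)" and "c = y \<bullet> (P *v y)"
  have q: "0 \<le> a + 2 * b * t + c * t\<^sup>2" for t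
  proof -
    have "(x + t *\<^sub>R y) \<bullet> (P *v (x + t *\<^sub>R y)) = a + 2 * b * t + c * t\<^sup>2"
      using sym_inner_commute[OF P(1), of y x]
      by (simp add: a_def b_def c_def matrix_vector_right_distrib matrix_vector_mult_scaleR
          inner_simps power2_eq_square algebra_simps)
    then show ?thesis using psdD[OF P(2)] by metis
  qed
  have "c \<ge> 0" using psdD[OF P(2)] by (simp add: c_def)
  have "b\<^sup>2 \<le> a * c"
  proof (cases "c = 0")
    case True
    have "b = 0"
    proof (rule ccontr)
      assume "b \<noteq> 0"
      \<comment> \<open>For \<open>c = 0\<close> the polynomial is affine in \<open>t\<close>, and
        it takes the value -1 at this point.\<close>
      then show False using q[of "- (a + 1) / (2 * b)"] True by simp
    qed
    then show ?thesis using True by simp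
  next
    case False
    have "0 \<le> c * (a + 2 * b * (- b / c) + c * (- b / c)\<^sup>2)"
      using q[of "- b / c"] \<open>c \<ge> 0\<close> by simp
    also have "\<dots> = a * c - b\<^sup>2"
      using False by (simp add: field_simps power2_eq_square)
    finally show ?thesis by simp
  qed
  then show ?thesis by (simp add: a_def b_def c_def)
qed

lemma transpose_outer [simp]: "transpose (outer x x) = outer x x"
  by (simp add: outer_def transpose_def vec_eq_iff mult.commute)

lemma outer_mult_vec: "outer x y *v z = (y \<bullet> z) *\<^sub>R x"
  by (simp add: outer_def matrix_vector_mult_def inner_vec_def vec_eq_iff sum_distrib_left
      algebra_simps)

lemma matrix_axis: "(P *v axis i 1) $ j = (P $ j $ i :: real)"
  by (simp add: matrix_vector_mult_basis column_def)

lemma inner_axis_matrix: "axis j 1 \<bullet> (P *v axis i 1) = (P $ j $ i :: real)"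
  by (simp add: inner_axis' matrix_axis)

text \<open>Successive elimination of the coordinates writes a symmetric positive semidefinite matrix as
  a sum of matrices \<open>p p\<^sup>T\<close>.\<close>
lemma psd_inner_nonneg:
  fixes P Z :: "real^'n^'n"
  assumes P: "transpose P = P" "psd P" and Z: "psd Z"
  shows "0 \<le> Z \<bullet> P"
proof -
  have "finite I \<Longrightarrow> transpose P = P \<Longrightarrow> psd P \<Longrightarrow> (\<And>i j. i \<notin> I \<Longrightarrow> P $ i $ j = 0) \<Longrightarrow> 0 \<le> Z \<bullet> P"
    for I and P :: "real^'n^'n"
  proof (induction I arbitrary: P rule: finite_induct)
    case empty
    then have "P = 0" by (simp add: vec_eq_iff)
    then show ?case by simp
  next
    case (insert i I)
    have sym: "P $ j $ k = P $ k $ j" for j k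
      using insert.prems(1) by (metis transpose_def vec_lambda_beta)
    have CS: "(P $ j $ k)\<^sup>2 \<le> P $ j $ j * P $ k $ k" for j k
      using psd_Cauchy_Schwarz[OF insert.prems(1,2), of "axis j 1" "axis k 1"]
      by (simp add: inner_axis_matrix)
    have pos: "0 \<le> P $ i $ i"
      using psdD[OF insert.prems(2), of "axis i 1"] by (simp add: inner_axis_matrix)
    show ?case
    proof (cases "P $ i $ i = 0")
      case True
      have "P $ i $ j = 0" for j using CS[of i j] True by simp
      then show ?thesis using insert.IH insert.prems by (metis insert_iff)
    next
      case False
      define p where "p = P *v axis i 1"
      \<comment> \<open>Schur complement: subtracting the normalized outer product of column
        \<open>i\<close> clears row and column \<open>i\<close>, and Cauchy-Schwarz for the form
        \<open>P\<close> keeps the rest semidefinite.\<close>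
      define P1 where "P1 = P - (1 / P $ i $ i) *\<^sub>R outer p p"
      have "transpose P1 = P1"
        using insert.prems(1) by (simp add: P1_def transpose_diff transpose_scalar)
      moreover have "psd P1"
        unfolding psd_def
      proof
        fix x
        have "(x \<bullet> p)\<^sup>2 / P $ i $ i \<le> x \<bullet> (P *v x)"
          using psd_Cauchy_Schwarz[OF insert.prems(1,2), of x "axis i 1"] pos False
          by (simp add: p_def inner_axis_matrix divide_le_eq)
        then show "0 \<le> x \<bullet> (P1 *v x)"
          by (simp add: P1_def matrix_vector_mult_diff_rdistrib inner_diff_right outer_mult_vec
              power2_eq_square inner_commute flip: scaleR_matrix_vector_assoc)
      qed
      moreover have "P1 $ j $ k = 0" if "j \<notin> I" for j k
      proof -
        have "P1 $ j $ k = P $ j $ k - P $ j $ i * P $ k $ i / P $ i $ i"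
          by (simp add: P1_def p_def outer_def matrix_axis)
        then show ?thesis
          using that insert.prems(3)[of j] False sym[of k i] by (cases "j = i") auto
      qed
      ultimately have "0 \<le> Z \<bullet> P1"
        using insert.IH by blast
      moreover have "Z \<bullet> P = Z \<bullet> P1 + (1 / P $ i $ i) * (p \<bullet> (Z *v p))"
        by (simp add: P1_def inner_diff_right inner_outer)
      ultimately show ?thesis
        using psdD[OF Z, of p] pos by simp
    qed
  qed
  from this[of UNIV P] P show ?thesis by simp
qed

lemma psd_inner_mono:
  fixes P X Y :: "real^'n^'n"
  assumes "transpose P = P" "psd P" "\<And>x. x \<bullet> (X *v x) \<le> x \<bullet> (Y *v x)"
  shows "X \<bullet> P \<le> Y \<bullet> P"
  using psd_inner_nonneg[OF assms(1,2), of "Y - X"] assms(3)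
  by (simp add: psd_def matrix_vector_mult_diff_rdistrib inner_diff_left inner_diff_right)

lemma inner_scaled_id_quad: "x \<bullet> ((c *\<^sub>R mat 1) *v x) = c * (x \<bullet> (x :: real^'n))"
  by (simp flip: scaleR_matrix_vector_assoc)

text \<open>\<open>mat 1 \<bullet> P\<close> is the trace of \<open>P\<close>, here and in all later
  estimates.\<close>

lemma psd_inner_ge_trace:
  fixes P X :: "real^'n^'n"
  assumes "transpose P = P" "psd P" "\<And>x. c * (x \<bullet> x) \<le> x \<bullet> (X *v x)"
  shows "c * (mat 1 \<bullet> P) \<le> X \<bullet> P"
  using psd_inner_mono[OF assms(1,2), of "c *\<^sub>R mat 1" X] assms(3)
  by (simp add: inner_scaled_id_quad)

lemma psd_inner_le_trace:
  fixes P X :: "real^'n^'n"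
  assumes "transpose P = P" "psd P" "\<And>x. x \<bullet> (X *v x) \<le> c * (x \<bullet> x)"
  shows "X \<bullet> P \<le> c * (mat 1 \<bullet> P)"
  using psd_inner_mono[OF assms(1,2), of X "c *\<^sub>R mat 1"] assms(3)
  by (simp add: inner_scaled_id_quad)

text \<open>\<open>outer x x\<close> is dominated by \<open>x \<bullet> x\<close> times the
  identity, and pairing with \<open>P\<close> preserves this order.\<close>

lemma psd_quad_le_trace:
  fixes P :: "real^'n^'n"
  assumes "transpose P = P" "psd P"
  shows "x \<bullet> (P *v x) \<le> (mat 1 \<bullet> P) * (x \<bullet> x)"
proof -
  have "outer x x \<bullet> P \<le> (x \<bullet> x) * (mat 1 \<bullet> P)"
  proof (rule psd_inner_le_trace[OF assms])
    fix y
    show "y \<bullet> (outer x x *v y) \<le> (x \<bullet> x) * (y \<bullet> y)"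
      using Cauchy_Schwarz_ineq[of x y]
      by (simp add: outer_mult_vec power2_eq_square inner_commute[of y x])
  qed
  then show ?thesis by (metis inner_commute inner_outer mult.commute)
qed

lemma trace_gram: "mat 1 \<bullet> (transpose F ** F) = (norm (F :: real^'n^'m))\<^sup>2"
  by (simp add: inner_commute[of "mat 1"] inner_matrix_mult_right inner_transpose power2_norm_eq_inner)

subsection \<open>The least singular value\<close>

text \<open>A minimizer \<open>v\<close> of the quadratic form on the unit sphere makes
  \<open>T = S - l I\<close> semidefinite with \<open>v \<bullet> (T *v v) = 0\<close>.
  Cauchy-Schwarz for the form \<open>T\<close>, applied to \<open>T *v v\<close> and
  \<open>v\<close>, then gives \<open>T *v v = 0\<close>.\<close>

lemma min_rayleigh_eigenvector:
  fixes S :: "real^'n^'n"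
  assumes S: "transpose S = S"
  shows "\<exists>l v. v \<noteq> 0 \<and> S *v v = l *\<^sub>R v \<and> (\<forall>x. l * (x \<bullet> x) \<le> x \<bullet> (S *v x))"
proof -
  have "continuous_on (sphere 0 1) (\<lambda>x. x \<bullet> (S *v x))"
    by (intro continuous_intros)
  moreover have "sphere (0::real^'n) 1 \<noteq> {}" by simp
  ultimately obtain v where v: "v \<in> sphere 0 1" "\<And>y. y \<in> sphere 0 1 \<Longrightarrow> v \<bullet> (S *v v) \<le> y \<bullet> (S *v y)"
    using continuous_attains_inf[OF compact_sphere] by meson
  define l where "l = v \<bullet> (S *v v)"
  have nv: "norm v = 1" using v(1) by simp
  have min: "l * (x \<bullet> x) \<le> x \<bullet> (S *v x)" for x
  proof (cases "x = 0")
    case False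
    have "l \<le> (x /\<^sub>R norm x) \<bullet> (S *v (x /\<^sub>R norm x))"
      unfolding l_def by (rule v(2)) (use False in simp)
    also have "\<dots> = (x \<bullet> (S *v x)) / (norm x)\<^sup>2"
      by (simp add: matrix_vector_mult_scaleR power2_eq_square divide_inverse)
    finally show ?thesis
      using False by (simp add: field_simps flip: power2_norm_eq_inner)
  qed simp
  define T where "T = S - l *\<^sub>R mat 1"
  have T_mult: "T *v x = S *v x - l *\<^sub>R x" for x
    by (simp add: T_def matrix_vector_mult_diff_rdistrib flip: scaleR_matrix_vector_assoc)
  have "psd T"
    using min by (simp add: psd_def T_mult inner_diff_right)
  moreover have "transpose T = T"
    by (simp add: T_def transpose_diff transpose_scalar S)
  moreover have "v \<bullet> (T *v v) = 0"
    using nv by (simp add: T_mult inner_diff_right l_def flip: power2_norm_eq_inner)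
  ultimately have "((T *v v) \<bullet> (T *v v))\<^sup>2 \<le> 0"
    using psd_Cauchy_Schwarz[of T "T *v v" v] by simp
  then have "S *v v = l *\<^sub>R v"
    by (simp add: T_mult)
  moreover have "v \<noteq> 0" using nv by auto
  ultimately show ?thesis using min by blast
qed

lemma Min_eigenvalues:
  fixes S :: "real^'n^'n"
  assumes S: "transpose S = S"
  shows "Min (eigenvalues S) * (x \<bullet> x) \<le> x \<bullet> (S *v x)"
    and "Min (eigenvalues S) \<in> eigenvalues S"
proof -
  obtain l v where lv: "v \<noteq> 0" "S *v v = l *\<^sub>R v" "\<And>x. l * (x \<bullet> x) \<le> x \<bullet> (S *v x)"
    using min_rayleigh_eigenvector[OF S] by blast
  have l: "l \<in> eigenvalues S"
    using lv(1,2) by (auto simp: eigenvalues_def scalar_mult_eq_scaleR)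
  moreover have "l \<le> k" if k: "k \<in> eigenvalues S" for k
  proof -
    obtain w where w: "w \<noteq> 0" "S *v w = k *\<^sub>R w"
      using k by (auto simp: eigenvalues_def scalar_mult_eq_scaleR)
    have "l * (w \<bullet> w) \<le> k * (w \<bullet> w)" using lv(3)[of w] w(2) by simp
    then show ?thesis using w(1) by simp
  qed
  ultimately have "Min (eigenvalues S) = l"
    by (intro Min_eqI finite_eigenvalues)
  then show "Min (eigenvalues S) * (x \<bullet> x) \<le> x \<bullet> (S *v x)"
    and "Min (eigenvalues S) \<in> eigenvalues S"
    using lv(3) l by auto
qed

lemma gram_quad: "x \<bullet> ((M ** transpose M) *v x) = (norm (transpose M *v (x::real^'m)))\<^sup>2"
  using quad_congruence[of x "transpose M" "mat 1"]
  by (simp del: transpose_matrix_vector add: power2_norm_eq_inner)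

text \<open>The definition goes through \<open>M ** transpose M\<close>, so it is
  \<open>transpose M\<close> that is bounded below: the factor that can be injective when
  \<open>M\<close> is wide.\<close>

lemma sigma_min:
  fixes M :: "real^'n^'m"
  shows sigma_min_nonneg: "0 \<le> sigma_min M"
    and sigma_min_le: "sigma_min M * norm x \<le> norm (transpose M *v x)"
    and sigma_min_attained: "\<exists>v. v \<noteq> 0 \<and> norm (transpose M *v v) = sigma_min M * norm v"
proof -
  let ?S = "M ** transpose M"
  have S: "transpose ?S = ?S" by (simp add: matrix_transpose_mul)
  obtain v where v: "v \<noteq> 0" "?S *v v = Min (eigenvalues ?S) *\<^sub>R v"
    using Min_eigenvalues(2)[OF S] by (auto simp: eigenvalues_def scalar_mult_eq_scaleR)
  have att: "Min (eigenvalues ?S) * (v \<bullet> v) = (norm (transpose M *v v))\<^sup>2"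
    using v(2) gram_quad[of v M] by simp
  have "0 \<le> Min (eigenvalues ?S) * (v \<bullet> v)" unfolding att by simp
  then have nn: "0 \<le> Min (eigenvalues ?S)"
    using v(1) by (metis inner_gt_zero_iff mult_neg_pos not_le)
  then show "0 \<le> sigma_min M" by (simp add: sigma_min_def)
  have sq: "(sigma_min M)\<^sup>2 = Min (eigenvalues ?S)" using nn by (simp add: sigma_min_def)
  have "(sigma_min M * norm x)\<^sup>2 \<le> (norm (transpose M *v x))\<^sup>2"
    using Min_eigenvalues(1)[OF S, of x] sq gram_quad[of x M]
    by (simp add: power_mult_distrib power2_norm_eq_inner del: transpose_matrix_vector)
  then show "sigma_min M * norm x \<le> norm (transpose M *v x)"
    by (rule power2_le_imp_le) simp
  have "(norm (transpose M *v v))\<^sup>2 = (sigma_min M * norm v)\<^sup>2"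
    using att sq by (simp add: power_mult_distrib power2_norm_eq_inner)
  then have "norm (transpose M *v v) = sigma_min M * norm v"
    using \<open>0 \<le> sigma_min M\<close> by (simp only: power2_eq_iff_nonneg norm_ge_zero mult_nonneg_nonneg)
  then show "\<exists>v. v \<noteq> 0 \<and> norm (transpose M *v v) = sigma_min M * norm v"
    using v(1) by blast
qed

lemma sigma_min_pos_if_inj:
  fixes M :: "real^'n^'m"
  assumes "\<And>x. transpose M *v x = 0 \<Longrightarrow> x = 0"
  shows "0 < sigma_min M"
proof -
  obtain v where "v \<noteq> 0" "norm (transpose M *v v) = sigma_min M * norm v"
    using sigma_min_attained by blast
  then show ?thesis
    using assms[of v] sigma_min_nonneg[of M] by (cases "sigma_min M = 0") auto
qed

lemma sym_posdef_transpose: "sym_posdef Q \<Longrightarrow> transpose Q = Q"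
  by (simp add: sym_posdef_def)

lemma sym_posdef_psd: "sym_posdef Q \<Longrightarrow> psd Q"
  unfolding sym_posdef_def psd_def by (metis inner_zero_left less_eq_real_def)

lemma sym_posdef_inj: "sym_posdef Q \<Longrightarrow> Q *v x = 0 \<Longrightarrow> x = 0"
  unfolding sym_posdef_def by (metis inner_zero_right less_irrefl)

lemma sym_posdef_sigma_min_pos: "sym_posdef Q \<Longrightarrow> 0 < sigma_min Q"
  by (rule sigma_min_pos_if_inj) (metis sym_posdef_inj sym_posdef_transpose)

text \<open>\<open>sigma_min\<close> is read off from \<open>Q ** transpose Q\<close>, the quadratic
  form from \<open>Q\<close>. Testing the singular value bound on an eigenvector for the least
  eigenvalue \<open>l\<close> of \<open>Q\<close> yields \<open>sigma_min Q \<le> l\<close>.\<close>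

lemma sym_posdef_quad_ge:
  assumes Q: "sym_posdef Q"
  shows "sigma_min Q * (x \<bullet> x) \<le> x \<bullet> (Q *v x)"
proof -
  obtain l v where lv: "v \<noteq> 0" "Q *v v = l *\<^sub>R v" "\<And>x. l * (x \<bullet> x) \<le> x \<bullet> (Q *v x)"
    using min_rayleigh_eigenvector sym_posdef_transpose[OF Q] by blast
  have "0 < v \<bullet> (Q *v v)" using Q lv(1) by (simp add: sym_posdef_def)
  then have "0 < l" using inner_ge_zero[of v] by (auto simp: lv(2) zero_less_mult_iff)
  have "sigma_min Q * norm v \<le> l * norm v"
    using sigma_min_le[of Q v] sym_posdef_transpose[OF Q] lv(2) \<open>0 < l\<close>
    by (simp del: transpose_matrix_vector)
  then have "sigma_min Q \<le> l" using lv(1) by simp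
  then have "sigma_min Q * (x \<bullet> x) \<le> l * (x \<bullet> x)" by (intro mult_right_mono) auto
  then show ?thesis using lv(3)[of x] by linarith
qed

lemma sigma_min_le_norm2: "sigma_min M \<le> norm2 (transpose M)"
proof -
  obtain v where v: "v \<noteq> 0" "norm (transpose M *v v) = sigma_min M * norm v"
    using sigma_min_attained by blast
  then have "sigma_min M * norm v \<le> norm2 (transpose M) * norm v"
    using norm2_bound[of "transpose M" v] by simp
  then show ?thesis using v(1) by simp
qed

lemma norm2_transpose_le: "norm2 (transpose M) \<le> norm2 M"
proof (rule onorm_le)
  fix x
  have "(norm (transpose M *v x))\<^sup>2 = x \<bullet> (M *v (transpose M *v x))"
    by (simp add: power2_norm_eq_inner inner_matrix_vector_transpose[of x M] del: transpose_matrix_vector)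
  also have "\<dots> \<le> norm x * (norm2 M * norm (transpose M *v x))"
    by (intro order_trans[OF norm_cauchy_schwarz] mult_left_mono norm2_bound) auto
  finally show "norm (transpose M *v x) \<le> norm2 M * norm x"
    using norm2_nonneg[of M]
    by (cases "norm (transpose M *v x) = 0") (auto simp: power2_eq_square mult_ac simp del: transpose_matrix_vector)
qed

text \<open>Injectivity of the row map converts a sum over the set \<open>rows C\<close> into a sum
  over indices, which is \<open>transpose C *v y\<close>.\<close>

lemma sigma_min_lin_indep_rows_pos:
  fixes C :: "real^'n^'d"
  assumes "lin_indep_rows C"
  shows "0 < sigma_min C"
proof (rule sigma_min_pos_if_inj)
  fix y assume y: "transpose C *v y = 0"
  have inj: "inj (\<lambda>i. row i C)" and ind: "independent (rows C)"
    using assms by (auto simp: lin_indep_rows_def)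
  have rows: "rows C = range (\<lambda>i. row i C)" by (auto simp: rows_def)
  define u where "u = (\<lambda>r. y $ (inv (\<lambda>i. row i C) r))"
  have u: "u (row i C) = y $ i" for i using inv_f_f[OF inj, of i] by (simp add: u_def)
  have "(\<Sum>r\<in>rows C. u r *\<^sub>R r) = (\<Sum>i\<in>UNIV. y $ i *\<^sub>R row i C)"
    unfolding rows by (subst sum.reindex[OF inj]) (simp add: u)
  also have "\<dots> = transpose C *v y"
    by (simp add: matrix_mult_sum scalar_mult_eq_scaleR del: transpose_matrix_vector)
  finally have "(\<Sum>r\<in>rows C. u r *\<^sub>R r) = 0" using y by simp
  then have "u r = 0" if "r \<in> rows C" for r
    using ind that by (intro independentD[of "rows C" "rows C" u r]) (auto simp: rows)
  then have "y $ i = 0" for i using u[of i] by (auto simp: rows)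
  then show "y = 0" by (simp add: vec_eq_iff)
qed

subsection \<open>The discrete Lyapunov equation\<close>

text \<open>The series for the solution of \<open>V = N + transpose M ** V ** M\<close>, the
  convention for costs; covariances use it with \<open>transpose M\<close>.\<close>

definition lyap :: "real^'n^'n \<Rightarrow> real^'n^'n \<Rightarrow> real^'n^'n"
  where "lyap M N = (\<Sum>t. transpose (mat_power M t) ** N ** mat_power M t)"

lemma mat_power_Suc_right: "mat_power M (Suc t) = mat_power M t ** M"
  by (induction t) (simp_all add: matrix_mul_assoc)

lemma transpose_mat_power: "transpose (mat_power M t) = mat_power (transpose M) t"
proof (induction t)
  case (Suc t)
  then show ?case
    by (simp only: mat_power.simps(2)[of M] matrix_transpose_mul mat_power_Suc_right[of "transpose M"])
qed simp

lemma inner_congruence: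
  fixes F :: "real^'n^'m"
  shows "(transpose F ** N ** F) \<bullet> X = N \<bullet> (F ** X ** transpose F)"
  by (subst inner_matrix_mult_right, subst inner_matrix_mult_left) (simp add: matrix_mul_assoc)

lemma stable_mat_power_tendsto_0:
  fixes M :: "real^'n^'n"
  assumes "spec_radius M < 1"
  shows "mat_power M \<longlonglongrightarrow> 0"
proof -
  obtain c q where q: "0 \<le> q" "q < 1" and b: "\<And>t. norm (mat_power M t) \<le> c * q ^ t"
    using spec_radius_less_1_imp_power_bound[OF assms] by blast
  have "(\<lambda>t. c * q ^ t) \<longlonglongrightarrow> c * 0"
    by (intro tendsto_mult tendsto_const LIMSEQ_realpow_zero q)
  then have lim: "(\<lambda>t. c * q ^ t) \<longlonglongrightarrow> 0" by simp
  show ?thesis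
    by (rule Lim_null_comparison[OF _ lim]) (simp add: b)
qed

text \<open>Transposition preserves the Frobenius norm of every power, so the decay of powers
  carries over.\<close>

lemma spec_radius_transpose:
  fixes M :: "real^'n^'n"
  assumes "spec_radius M < 1"
  shows "spec_radius (transpose M) < 1"
proof (rule trajectory_tendsto_0_imp_spec_radius_less_1)
  fix x :: "real^'n"
  have "(\<lambda>t. norm (mat_power M t) * norm x) \<longlonglongrightarrow> 0 * norm x"
    by (intro tendsto_mult tendsto_const tendsto_norm_zero stable_mat_power_tendsto_0 assms)
  then have lim: "(\<lambda>t. norm (mat_power M t) * norm x) \<longlonglongrightarrow> 0" by simp
  have "norm (trajectory (transpose M) x t) \<le> norm (mat_power M t) * norm x" for t
    using norm_matrix_vector_mult_le[of "mat_power (transpose M) t" x]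
    by (metis mat_power_mult_vec norm_transpose transpose_mat_power)
  then show "trajectory (transpose M) x \<longlonglongrightarrow> 0"
    by (intro Lim_null_comparison[OF _ lim] always_eventually allI)
qed

lemma outer_congruence: "outer (F *v x) (F *v x) = F ** outer x x ** transpose F"
proof -
  have "outer (F *v x) (F *v x) *v y = (F ** outer x x ** transpose F) *v y" for y
  proof -
    have "(F ** outer x x ** transpose F) *v y = F *v (outer x x *v (transpose F *v y))"
      by (simp only: matrix_vector_mul_assoc matrix_mul_assoc)
    also have "\<dots> = (x \<bullet> (transpose F *v y)) *\<^sub>R (F *v x)"
      by (simp only: outer_mult_vec matrix_vector_mult_scaleR)
    also have "x \<bullet> (transpose F *v y) = (F *v x) \<bullet> y"
      by (simp only: inner_matrix_vector_transpose[of x "transpose F"] transpose_transpose)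
    finally show ?thesis by (simp only: outer_mult_vec)
  qed
  then show ?thesis by (simp add: matrix_eq)
qed

text \<open>The decrease of \<open>x \<bullet> (P *v x)\<close> telescopes along a trajectory.
  Semidefiniteness bounds the total, so the squared norms are summable and the trajectory tends to
  0.\<close>

lemma lyapunov_criterion:
  fixes M P :: "real^'n^'n"
  assumes P: "psd P" and c: "0 < c"
    and dec: "\<And>x. c * (x \<bullet> x) \<le> x \<bullet> (P *v x) - (M *v x) \<bullet> (P *v (M *v x))"
  shows "spec_radius M < 1"
proof (rule trajectory_tendsto_0_imp_spec_radius_less_1)
  fix x :: "real^'n"
  let ?x = "trajectory M x"
  have "(\<Sum>t<n. c * (?x t \<bullet> ?x t)) \<le> x \<bullet> (P *v x) - ?x n \<bullet> (P *v ?x n)" for n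
    by (induction n) (use dec in \<open>auto intro: order_trans[OF add_mono[OF _ dec]]\<close>)
  then have "(\<Sum>t<n. c * (?x t \<bullet> ?x t)) \<le> x \<bullet> (P *v x)" for n
    using psdD[OF P, of "?x n"] by (meson diff_le_eq le_add_same_cancel1 order_trans)
  then have "summable (\<lambda>t. c * (?x t \<bullet> ?x t))"
    using c by (intro summableI_nonneg_bounded) auto
  then have "(\<lambda>t. c * (?x t \<bullet> ?x t) / c) \<longlonglongrightarrow> 0 / c"
    by (intro tendsto_divide tendsto_const summable_LIMSEQ_zero) (use c in auto)
  then have "(\<lambda>t. (norm (?x t))\<^sup>2) \<longlonglongrightarrow> 0"
    using c by (simp add: power2_norm_eq_inner)
  then have "(\<lambda>t. norm (?x t)) \<longlonglongrightarrow> 0"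
    using tendsto_real_sqrt by fastforce
  then show "?x \<longlonglongrightarrow> 0" by (simp add: tendsto_norm_zero_iff)
qed

context
  fixes M :: "real^'n^'n"
  assumes stable: "spec_radius M < 1"
begin

lemma lyap_summable: "summable (\<lambda>t. transpose (mat_power M t) ** N ** mat_power M t)"
proof -
  obtain c q where q: "0 \<le> q" "q < 1" and b: "\<And>t. norm (mat_power M t) \<le> c * q ^ t"
    using spec_radius_less_1_imp_power_bound[OF stable] by blast
  have "norm (transpose (mat_power M t) ** N ** mat_power M t) \<le> c\<^sup>2 * norm N * (q\<^sup>2) ^ t" for t
  proof -
    have "norm (transpose (mat_power M t) ** N ** mat_power M t)
        \<le> norm (mat_power M t) * norm N * norm (mat_power M t)"
      using norm_matrix_mult_le[of "transpose (mat_power M t) ** N" "mat_power M t"]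
        mult_right_mono[OF norm_matrix_mult_le[of "transpose (mat_power M t)" N], of "norm (mat_power M t)"]
      by simp
    also have "\<dots> \<le> (c * q ^ t) * norm N * (c * q ^ t)"
      using order_trans[OF norm_ge_zero b[of t]]
      by (intro mult_mono mult_right_mono b) auto
    finally show ?thesis by (simp add: power2_eq_square power_mult_distrib mult_ac)
  qed
  moreover have "summable (\<lambda>t. c\<^sup>2 * norm N * (q\<^sup>2) ^ t)"
    using q by (intro summable_mult summable_geometric) (simp add: abs_square_less_1)
  ultimately show ?thesis
    by (metis (no_types, lifting) summable_comparison_test)
qed

lemma lyap_sums: "(\<lambda>t. transpose (mat_power M t) ** N ** mat_power M t) sums lyap M N"
  unfolding lyap_def by (rule summable_sums) (rule lyap_summable)

lemma lyap_eq: "lyap M N = N + transpose M ** lyap M N ** M"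
proof -
  have "(\<lambda>t. transpose M ** (transpose (mat_power M t) ** N ** mat_power M t) ** M)
      sums (transpose M ** lyap M N ** M)"
    by (intro bounded_linear.sums[OF matrix_mult.bounded_linear_left]
        bounded_linear.sums[OF matrix_mult.bounded_linear_right] lyap_sums)
  then have "(\<lambda>t. transpose (mat_power M (Suc t)) ** N ** mat_power M (Suc t))
      sums (transpose M ** lyap M N ** M)"
    by (simp add: mat_power_Suc_right matrix_transpose_mul matrix_mul_assoc del: mat_power.simps(2))
  from sums_Suc[where f = "\<lambda>t. transpose (mat_power M t) ** N ** mat_power M t", OF this]
  have "(\<lambda>t. transpose (mat_power M t) ** N ** mat_power M t) sums (transpose M ** lyap M N ** M + N)"
    by (simp only: mat_power.simps(1) transpose_mat matrix_mul_lid matrix_mul_rid)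
  from sums_unique2[OF lyap_sums this] show ?thesis by (simp only: add.commute)
qed

text \<open>The difference \<open>W\<close> of two solutions is a fixed point of the congruence by
  \<open>M\<close>, hence of its iterates, which tend to 0.\<close>

lemma lyap_unique:
  assumes V: "V = Y + transpose M ** V ** M"
  shows "V = lyap M Y"
proof -
  define W where "W = V - lyap M Y"
  have W: "W = transpose M ** W ** M"
  proof -
    have "V - lyap M Y = transpose M ** V ** M - transpose M ** lyap M Y ** M"
      using arg_cong2[where f = "(-)", OF V lyap_eq[of Y]] by simp
    also have "\<dots> = transpose M ** (V - lyap M Y) ** M"
      by (simp add: matrix_simps)
    finally show ?thesis unfolding W_def .
  qed
  have pow: "W = transpose (mat_power M t) ** W ** mat_power M t" for t
  proof (induction t)
    case (Suc t)
    have "transpose (mat_power M (Suc t)) ** W ** mat_power M (Suc t)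
        = transpose (mat_power M t) ** (transpose M ** W ** M) ** mat_power M t"
      by (simp add: matrix_transpose_mul matrix_mul_assoc)
    also have "\<dots> = W" by (simp only: W[symmetric] Suc.IH[symmetric])
    finally show ?case by (rule sym)
  qed simp
  have "(\<lambda>t. transpose (mat_power M t) ** W ** mat_power M t) \<longlonglongrightarrow> 0"
    using lyap_summable by (rule summable_LIMSEQ_zero)
  then have "(\<lambda>t::nat. W) \<longlonglongrightarrow> 0" by (simp only: pow[symmetric])
  then have "W = 0" by (simp add: LIMSEQ_const_iff)
  then show ?thesis by (simp add: W_def)
qed

lemma bounded_linear_lyap: "bounded_linear (lyap M)"
  unfolding linear_conv_bounded_linear[symmetric]
proof (rule linearI)
  show "lyap M (X + Y) = lyap M X + lyap M Y" for X Y
    unfolding lyap_def by (simp add: matrix_simps suminf_add lyap_summable)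
  show "lyap M (c *\<^sub>R X) = c *\<^sub>R lyap M X" for c X
    unfolding lyap_def by (simp add: matrix_simps suminf_scaleR_right lyap_summable)
qed

lemma lyap_quad_sums:
  "(\<lambda>t. trajectory M x t \<bullet> (N *v trajectory M x t)) sums (x \<bullet> (lyap M N *v x))"
  using bounded_linear.sums[OF bounded_linear_inner_left lyap_sums, of N "outer x x"]
  by (simp add: inner_outer quad_congruence mat_power_mult_vec)

lemma lyap_psd:
  assumes "psd N"
  shows "psd (lyap M N)"
  unfolding psd_def
proof
  fix x
  show "0 \<le> x \<bullet> (lyap M N *v x)"
    by (rule sums_le[OF _ sums_zero lyap_quad_sums]) (rule psdD[OF assms])
qed

lemma lyap_quad_ge:
  assumes "psd N"
  shows "x \<bullet> (N *v x) \<le> x \<bullet> (lyap M N *v x)"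
proof -
  have "x \<bullet> (lyap M N *v x) = x \<bullet> (N *v x) + x \<bullet> ((transpose M ** lyap M N ** M) *v x)"
    by (subst lyap_eq) (simp add: matrix_vector_mult_add_rdistrib inner_add_right)
  then show ?thesis
    using psdD[OF psd_congruence[OF lyap_psd[OF assms], of M], of x] by simp
qed

lemma lyap_transpose: "transpose (lyap M N) = lyap M (transpose N)"
proof (rule lyap_unique)
  have "transpose (lyap M N) = transpose (N + transpose M ** lyap M N ** M)"
    by (subst lyap_eq) simp
  then show "transpose (lyap M N) = transpose N + transpose M ** transpose (lyap M N) ** M"
    by (simp add: matrix_simps matrix_mul_assoc)
qed

end

lemma lyap_duality:
  assumes "spec_radius M < 1"
  shows "X \<bullet> lyap M N = lyap (transpose M) X \<bullet> N"
proof -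
  have eq: "(transpose (mat_power (transpose M) t) ** X ** mat_power (transpose M) t) \<bullet> N
      = X \<bullet> (transpose (mat_power M t) ** N ** mat_power M t)" for t
    using inner_congruence[of "mat_power (transpose M) t" X N]
    by (simp only: transpose_mat_power[symmetric] transpose_transpose)
  have "(\<lambda>t. X \<bullet> (transpose (mat_power M t) ** N ** mat_power M t)) sums (X \<bullet> lyap M N)"
    by (intro bounded_linear.sums[OF bounded_linear_inner_right] lyap_sums assms)
  moreover have "(\<lambda>t. (transpose (mat_power (transpose M) t) ** X ** mat_power (transpose M) t) \<bullet> N)
      sums (lyap (transpose M) X \<bullet> N)"
    by (intro bounded_linear.sums[OF bounded_linear_inner_left] lyap_sums spec_radius_transpose assms)
  ultimately show ?thesis
    unfolding eq by (rule sums_unique2)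
qed

lemma lyap_outer_sums:
  assumes "spec_radius M < 1"
  shows "(\<lambda>t. outer (trajectory M x t) (trajectory M x t)) sums lyap (transpose M) (outer x x)"
  using lyap_sums[OF spec_radius_transpose[OF assms], of "outer x x"]
  by (simp add: outer_congruence flip: transpose_mat_power mat_power_mult_vec)

subsection \<open>Differentiating solutions of Lyapunov equations\<close>

text \<open>A product rule in which the second factor need only be continuous, because the first one
  vanishes at \<open>x\<close>. It lets a Lyapunov solution be differentiated when only its
  continuity is known.\<close>

lemma (in bounded_bilinear) has_derivative_mult_zero:
  assumes f: "(f has_derivative f') (at x)" "f x = 0" and g: "isCont g x"
  shows "((\<lambda>y. prod (f y) (g y)) has_derivative (\<lambda>h. prod (f' h) (g x))) (at x)"
  unfolding has_derivative_at_alt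
proof (intro conjI allI impI)
  have bl: "bounded_linear f'" and
    fe: "\<And>e. e > 0 \<Longrightarrow> \<exists>d>0. \<forall>y. norm (y - x) < d \<longrightarrow> norm (f y - f x - f' (y - x)) \<le> e * norm (y - x)"
    using f(1) unfolding has_derivative_at_alt by auto
  show "bounded_linear (\<lambda>h. prod (f' h) (g x))"
    using bounded_linear_compose[OF bounded_linear_left bl] by simp
  obtain b where b: "0 < b" "\<And>h. norm (f' h) \<le> norm h * b"
    using bounded_linear.pos_bounded[OF bl] by blast
  obtain k where k: "0 < k" "\<And>u v. norm (prod u v) \<le> norm u * norm v * k"
    using pos_bounded by blast
  fix e :: real assume e: "0 < e"
  \<comment> \<open>Half of \<open>e\<close> pays for the linearization error of \<open>f\<close>,
    half for the variation of \<open>g\<close>; the added 1 keeps the denominator positive when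
    \<open>g x = 0\<close>.\<close>
  define e1 where "e1 = e / (2 * k * (norm (g x) + 1))"
  define e2 where "e2 = e / (2 * k * (1 + b))"
  have den: "0 < 2 * k * (norm (g x) + 1)" "0 < 2 * k * (1 + b)"
    using k(1) b(1) norm_ge_zero[of "g x"] by (auto intro!: mult_pos_pos add_nonneg_pos)
  have "e1 > 0" "e2 > 0"
    unfolding e1_def e2_def using e den by auto
  obtain d1 where d1: "d1 > 0" "\<And>y. norm (y - x) < d1 \<Longrightarrow> norm (f y - f' (y - x)) \<le> e1 * norm (y - x)"
    using fe[OF \<open>e1 > 0\<close>] f(2) by auto
  \<comment> \<open>Tolerance 1 suffices here: it only makes \<open>f y\<close> of order
    \<open>norm (y - x)\<close>.\<close>
  obtain d2 where d2: "d2 > 0" "\<And>y. norm (y - x) < d2 \<Longrightarrow> norm (f y - f' (y - x)) \<le> 1 * norm (y - x)"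
    using fe[OF zero_less_one] f(2) by auto
  obtain d3 where d3: "d3 > 0" "\<And>y. norm (y - x) < d3 \<Longrightarrow> norm (g y - g x) < e2"
    using g \<open>e2 > 0\<close> unfolding continuous_at_eps_delta dist_norm by blast
  show "\<exists>d>0. \<forall>y. norm (y - x) < d \<longrightarrow>
      norm (prod (f y) (g y) - prod (f x) (g x) - prod (f' (y - x)) (g x)) \<le> e * norm (y - x)"
  proof (intro exI[of _ "min d1 (min d2 d3)"] conjI allI impI)
    fix y assume y: "norm (y - x) < min d1 (min d2 d3)"
    have "norm (f y) \<le> norm (f y - f' (y - x)) + norm (f' (y - x))"
      by norm
    also have "\<dots> \<le> (1 + b) * norm (y - x)"
      using d2(2)[of y] y b(2)[of "y - x"] by (simp add: algebra_simps)
    finally have fy: "norm (f y) \<le> (1 + b) * norm (y - x)" .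
    have "prod (f y) (g y) - prod (f x) (g x) - prod (f' (y - x)) (g x)
        = prod (f y - f' (y - x)) (g x) + prod (f y) (g y - g x)"
      by (simp add: f(2) zero_left diff_left diff_right)
    also have "norm \<dots> \<le> norm (f y - f' (y - x)) * norm (g x) * k + norm (f y) * norm (g y - g x) * k"
      by (intro order_trans[OF norm_triangle_ineq] add_mono k(2))
    also have "\<dots> \<le> (e1 * norm (y - x)) * (norm (g x) + 1) * k + ((1 + b) * norm (y - x)) * e2 * k"
      using d1 d3(2)[of y] fy y k(1) b(1) \<open>e1 > 0\<close>
      by (intro add_mono mult_right_mono mult_mono) (auto intro: less_imp_le)
    also have "\<dots> = (e / 2 + e / 2) * norm (y - x)"
    proof -
      have "e1 * (norm (g x) + 1) * k = e / 2" "(1 + b) * e2 * k = e / 2"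
        unfolding e1_def e2_def using den by (simp_all add: field_simps)
      moreover have "(e1 * norm (y - x)) * (norm (g x) + 1) * k + ((1 + b) * norm (y - x)) * e2 * k
          = (e1 * (norm (g x) + 1) * k + (1 + b) * e2 * k) * norm (y - x)"
        by (simp add: algebra_simps)
      ultimately show ?thesis by simp
    qed
    finally show "norm (prod (f y) (g y) - prod (f x) (g x) - prod (f' (y - x)) (g x)) \<le> e * norm (y - x)"
      by simp
  qed (use d1(1) d2(1) d3(1) in auto)
qed

context
  fixes A Y V :: "'a::real_normed_vector \<Rightarrow> real^'n^'n" and x :: 'a
  assumes V: "\<forall>\<^sub>F y in nhds x. V y = Y y + transpose (A y) ** V y ** A y"
    and stable: "spec_radius (A x) < 1"
begin

text \<open>The difference of the equations at \<open>y\<close> and \<open>x\<close>, arranged so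
  that \<open>V y - V x\<close> is transported by the fixed matrix \<open>A x\<close>. Every summand
  left over has a factor that vanishes at \<open>x\<close>.\<close>

definition lyap_defect :: "'a \<Rightarrow> real^'n^'n"
  where "lyap_defect y = Y y - Y x + transpose (A y - A x) ** (V y ** A y)
    + transpose (A x) ** V y ** (A y - A x)"

lemma lyap_solution_diff: "\<forall>\<^sub>F y in nhds x. V y = V x + lyap (A x) (lyap_defect y)"
proof -
  have Vx: "V x = Y x + transpose (A x) ** V x ** A x"
    using eventually_nhds_x_imp_x[OF V] .
  show ?thesis
    using V
  proof eventually_elim
    case (elim y)
    have "V y - V x = lyap_defect y + transpose (A x) ** (V y - V x) ** A x"
      by (rule trans[OF arg_cong2[where f = "(-)", OF elim Vx]])
        (simp add: lyap_defect_def matrix_simps matrix_mul_assoc)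
    from lyap_unique[OF stable this] show ?case by (metis add.commute diff_add_cancel)
  qed
qed

text \<open>The defect contains \<open>V y\<close> itself, so the estimate has the form
  \<open>norm (V y - V x) \<le> a y + b y * norm (V y)\<close>. Since \<open>b\<close> tends to 0,
  the last term is absorbed on the left once \<open>b y < 1 / 2\<close>.\<close>

lemma lyap_solution_isCont:
  assumes A: "isCont A x" and Y: "isCont Y x"
  shows "isCont V x"
proof -
  obtain s where s: "0 < s" "\<And>N. norm (lyap (A x) N) \<le> norm N * s"
    using bounded_linear.pos_bounded[OF bounded_linear_lyap[OF stable]] by blast
  define a where "a y = s * norm (Y y - Y x)" for y
  define b where "b y = s * (norm (A y - A x) * (norm (A y) + norm (A x)))" for y
  have lim: "(\<lambda>y. Y y - Y x) \<midarrow>x\<rightarrow> 0" "(\<lambda>y. A y - A x) \<midarrow>x\<rightarrow> 0" "A \<midarrow>x\<rightarrow> A x"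
    using A Y by (auto simp: isCont_def LIM_zero_iff)
  have "a \<midarrow>x\<rightarrow> s * 0" "b \<midarrow>x\<rightarrow> s * (0 * (norm (A x) + norm (A x)))"
    unfolding a_def b_def
    by (intro tendsto_mult tendsto_add tendsto_const tendsto_norm_zero tendsto_norm lim)+
  then have ab: "a \<midarrow>x\<rightarrow> 0" "b \<midarrow>x\<rightarrow> 0" by auto
  have "\<forall>\<^sub>F y in at x. b y < 1 / 2"
    using order_tendstoD(2)[OF ab(2), of "1 / 2"] by simp
  moreover have "\<forall>\<^sub>F y in at x. V y = V x + lyap (A x) (lyap_defect y)"
    using lyap_solution_diff eventually_nhds_conv_at by blast
  ultimately have "\<forall>\<^sub>F y in at x. norm (V y - V x) \<le> 2 * (a y + b y * norm (V x))"
  proof eventually_elim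
    case (elim y)
    have 1: "norm (transpose (A y - A x) ** (V y ** A y)) \<le> norm (A y - A x) * (norm (V y) * norm (A y))"
      using norm_matrix_mult_le[of "transpose (A y - A x)" "V y ** A y"]
        mult_left_mono[OF norm_matrix_mult_le[of "V y" "A y"], of "norm (A y - A x)"]
      by simp
    have 2: "norm (transpose (A x) ** V y ** (A y - A x)) \<le> norm (A x) * norm (V y) * norm (A y - A x)"
      using norm_matrix_mult_le[of "transpose (A x) ** V y" "A y - A x"]
        mult_right_mono[OF norm_matrix_mult_le[of "transpose (A x)" "V y"], of "norm (A y - A x)"]
      by simp
    have "norm (lyap_defect y) \<le> norm (Y y - Y x) + norm (A y - A x) * (norm (V y) * norm (A y))
        + norm (A x) * norm (V y) * norm (A y - A x)"
      unfolding lyap_defect_def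
      by (intro order_trans[OF norm_triangle_ineq] add_mono 1 2 order_refl)
    then have "norm (lyap_defect y) * s \<le> (norm (Y y - Y x) + norm (A y - A x) * (norm (V y) * norm (A y))
        + norm (A x) * norm (V y) * norm (A y - A x)) * s"
      using s(1) by (intro mult_right_mono) auto
    then have "norm (V y - V x) \<le> a y + b y * norm (V y)"
      using elim(2) s(2)[of "lyap_defect y"] by (simp add: a_def b_def algebra_simps)
    moreover have "b y * norm (V y) \<le> b y * (norm (V x) + norm (V y - V x))"
    proof (rule mult_left_mono)
      show "norm (V y) \<le> norm (V x) + norm (V y - V x)" by norm
      show "0 \<le> b y" using s(1) by (simp add: b_def)
    qed
    moreover have "b y * norm (V y - V x) \<le> 1 / 2 * norm (V y - V x)"
      using elim(1) by (intro mult_right_mono) auto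
    ultimately show ?case by (simp add: algebra_simps)
  qed
  moreover have "(\<lambda>y. 2 * (a y + b y * norm (V x))) \<midarrow>x\<rightarrow> 2 * (0 + 0 * norm (V x))"
    by (intro tendsto_mult tendsto_add tendsto_const ab)
  ultimately have "(\<lambda>y. V y - V x) \<midarrow>x\<rightarrow> 0"
    using Lim_null_comparison by fastforce
  then show ?thesis by (simp add: isCont_def LIM_zero_iff)
qed

text \<open>In the defect \<open>V\<close> only multiplies factors vanishing at \<open>x\<close>, so
  its continuity is enough and its unknown derivative never appears.\<close>

lemma lyap_solution_has_derivative:
  assumes A: "(A has_derivative A') (at x)" and Y: "(Y has_derivative Y') (at x)"
  shows "(V has_derivative (\<lambda>h. lyap (A x) (Y' h + transpose (A' h) ** (V x ** A x)
    + transpose (A x) ** V x ** A' h))) (at x)"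
proof -
  have contA: "isCont A x" using has_derivative_continuous[OF A] by simp
  have contV: "isCont V x"
    using lyap_solution_isCont contA has_derivative_continuous[OF Y] by simp
  have A0: "((\<lambda>y. A y - A x) has_derivative A') (at x)"
    using has_derivative_diff[OF A has_derivative_const[of "A x"]] by simp
  have At0: "((\<lambda>y. transpose (A y - A x)) has_derivative (\<lambda>h. transpose (A' h))) (at x)"
    by (rule bounded_linear.has_derivative[OF bounded_linear_transpose A0])
  have contVA: "isCont (\<lambda>y. V y ** A y) x"
    using contV contA unfolding isCont_def by (intro matrix_mult.tendsto)
  have contAV: "isCont (\<lambda>y. transpose (A x) ** V y) x"
    using contV unfolding isCont_def by (intro matrix_mult.tendsto tendsto_const)
  have 1: "((\<lambda>y. transpose (A y - A x) ** (V y ** A y)) has_derivative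
      (\<lambda>h. transpose (A' h) ** (V x ** A x))) (at x)"
    using matrix_mult.has_derivative_mult_zero[OF At0 _ contVA] by simp
  have 2: "((\<lambda>y. transpose (A x) ** V y ** (A y - A x)) has_derivative
      (\<lambda>h. transpose (A x) ** V x ** A' h)) (at x)"
    using bounded_bilinear.has_derivative_mult_zero[OF matrix_mult.flip A0 _ contAV] by simp
  have "((\<lambda>y. Y y - Y x) has_derivative Y') (at x)"
    using has_derivative_diff[OF Y has_derivative_const[of "Y x"]] by simp
  then have "(lyap_defect has_derivative (\<lambda>h. Y' h + transpose (A' h) ** (V x ** A x)
      + transpose (A x) ** V x ** A' h)) (at x)"
    unfolding lyap_defect_def by (intro has_derivative_add 1 2)
  from has_derivative_add[OF has_derivative_const[of "V x"]
      bounded_linear.has_derivative[OF bounded_linear_lyap[OF stable] this]]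
  have "((\<lambda>y. V x + lyap (A x) (lyap_defect y)) has_derivative (\<lambda>h. lyap (A x)
      (Y' h + transpose (A' h) ** (V x ** A x) + transpose (A x) ** V x ** A' h))) (at x)"
    by simp
  moreover have "\<forall>\<^sub>F y in at x. V x + lyap (A x) (lyap_defect y) = V y"
    using lyap_solution_diff unfolding eventually_nhds_conv_at by (auto elim: eventually_mono)
  moreover have "V x + lyap (A x) (lyap_defect x) = V x"
    using eventually_nhds_x_imp_x[OF lyap_solution_diff] by simp
  ultimately show ?thesis
    by (rule has_derivative_transform_eventually) simp
qed

end

subsection \<open>The cost of a stabilizing gain\<close>

text \<open>\<open>k\<close> is a gain, \<open>f\<close> its change and \<open>a\<close> the old
  closed loop. At \<open>p = P K\<close> the linear part collects into \<open>E K\<close> and the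
  quadratic part into \<open>M K\<close>.\<close>

lemma quad_expand:
  fixes p a R :: "_" and B :: "real^'m^'n" and k f :: "real^'n^'m"
  assumes p: "transpose p = p" and R: "transpose R = R"
  shows "transpose (k + f) ** R ** (k + f) + transpose (a - B ** f) ** p ** (a - B ** f)
    = transpose k ** R ** k + transpose a ** p ** a
      + (transpose f ** (R ** k - transpose B ** p ** a) + transpose (R ** k - transpose B ** p ** a) ** f)
      + transpose f ** (R + transpose B ** p ** B) ** f"
  by (simp add: matrix_simps matrix_mul_assoc p R)

text \<open>The covariance \<open>X\<^sub>0\<close> is kept abstract: the distribution enters the argument only through it.\<close>
locale lqr =
  fixes A :: "real^'n^'n" and B :: "real^'m^'n" and C :: "real^'n^'d"
    and Q :: "real^'n^'n" and R :: "real^'m^'m" and X0 :: "real^'n^'n" and \<mu> :: real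
  assumes Q: "sym_posdef Q" and R: "sym_posdef R"
    and X0_sym: "transpose X0 = X0" and X0_ge: "\<And>x. \<mu> * (x \<bullet> x) \<le> x \<bullet> (X0 *v x)"
    and mu_pos: "0 < \<mu>"
begin

abbreviation "stab \<equiv> stabilizing A B C"
abbreviation "cl \<equiv> closed_loop A B C"
abbreviation "W \<equiv> cost_weight C Q R"

definition P :: "real^'d^'m \<Rightarrow> real^'n^'n"
  where "P K = lyap (cl K) (W K)"

definition Sig :: "real^'d^'m \<Rightarrow> real^'n^'n"
  where "Sig K = lyap (transpose (cl K)) X0"

definition J :: "real^'d^'m \<Rightarrow> real"
  where "J K = X0 \<bullet> P K"

text \<open>Up to a factor 2, the Hessian in the input of one stage cost followed by the cost-to-go
  \<open>P K\<close>; the Gauss-Newton direction inverts it on the left.\<close>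

definition M :: "real^'d^'m \<Rightarrow> real^'m^'m"
  where "M K = R + transpose B ** P K ** B"

text \<open>Multiplied on the right by \<open>Sig K ** transpose C\<close> and doubled, this is the
  gradient of \<open>J\<close>.\<close>

definition E :: "real^'d^'m \<Rightarrow> real^'n^'m"
  where "E K = R ** K ** C - transpose B ** P K ** cl K"

text \<open>The source term of the Lyapunov equation for the derivative of \<open>P\<close> in direction
  \<open>\<Delta>\<close>, where \<open>F = \<Delta> C\<close>.\<close>
definition Y1 :: "real^'d^'m \<Rightarrow> real^'n^'m \<Rightarrow> real^'n^'n"
  where "Y1 K F = transpose F ** E K + transpose (E K) ** F"

definition DP :: "real^'n^'m \<Rightarrow> real^'d^'m \<Rightarrow> real^'n^'n"
  where "DP F K = lyap (cl K) (Y1 K F)"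

lemma stab_iff: "K \<in> stab \<longleftrightarrow> spec_radius (cl K) < 1"
  by (simp add: stabilizing_def)

lemma Q_sym: "transpose Q = Q" and R_sym: "transpose R = R"
  using Q R by (auto simp: sym_posdef_def)

lemma sigma_Q_pos: "0 < sigma_min Q" and sigma_R_pos: "0 < sigma_min R"
  using Q R sym_posdef_sigma_min_pos by auto

lemma W_alt: "W K = Q + transpose (K ** C) ** R ** (K ** C)"
  by (simp add: cost_weight_def matrix_transpose_mul matrix_mul_assoc)

lemma W_sym: "transpose (W K) = W K"
  by (simp add: W_alt matrix_simps Q_sym R_sym matrix_mul_assoc)

lemma W_quad: "x \<bullet> (W K *v x) = x \<bullet> (Q *v x) + (K ** C *v x) \<bullet> (R *v (K ** C *v x))"
  by (simp only: W_alt matrix_vector_mult_add_rdistrib inner_add_right quad_congruence)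

lemma W_ge_Q: "x \<bullet> (Q *v x) \<le> x \<bullet> (W K *v x)"
  using psdD[OF sym_posdef_psd[OF R], of "K ** C *v x"] by (simp add: W_quad)

lemma W_ge: "sigma_min Q * (x \<bullet> x) \<le> x \<bullet> (W K *v x)"
  using sym_posdef_quad_ge[OF Q, of x] W_ge_Q[of x K] by linarith

lemma W_psd: "psd (W K)"
  unfolding psd_def using W_ge_Q psdD[OF sym_posdef_psd[OF Q]] order_trans by blast

lemma X0_psd: "psd X0"
  unfolding psd_def
proof
  fix x :: "real^'n"
  have "0 \<le> \<mu> * (x \<bullet> x)" using mu_pos by simp
  then show "0 \<le> x \<bullet> (X0 *v x)" using X0_ge[of x] by linarith
qed

lemma cl_add: "cl (K + D) = cl K - B ** (D ** C)"
  by (simp add: closed_loop_def matrix_simps matrix_mul_assoc)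

context
  fixes K :: "real^'d^'m"
  assumes K: "K \<in> stab"
begin

lemma P_eq: "P K = W K + transpose (cl K) ** P K ** cl K"
  unfolding P_def by (rule lyap_eq) (use K in \<open>simp add: stab_iff\<close>)

lemma P_sym: "transpose (P K) = P K"
  unfolding P_def using lyap_transpose K W_sym by (metis stab_iff)

lemma P_psd: "psd (P K)"
  unfolding P_def using lyap_psd K W_psd by (metis stab_iff)

lemma P_ge_W: "x \<bullet> (W K *v x) \<le> x \<bullet> (P K *v x)"
  unfolding P_def using lyap_quad_ge K W_psd by (metis stab_iff)

lemma P_dec: "x \<bullet> (P K *v x) - (cl K *v x) \<bullet> (P K *v (cl K *v x)) = x \<bullet> (W K *v x)"
proof -
  have "x \<bullet> (P K *v x) = x \<bullet> ((W K + transpose (cl K) ** P K ** cl K) *v x)"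
    using P_eq by simp
  then show ?thesis
    by (simp only: matrix_vector_mult_add_rdistrib inner_add_right quad_congruence)
qed

lemma Sig_inner: "Sig K \<bullet> N = X0 \<bullet> lyap (cl K) N"
  unfolding Sig_def using lyap_duality K by (metis stab_iff)

lemma stable_transpose: "spec_radius (transpose (cl K)) < 1"
  using K spec_radius_transpose by (auto simp: stab_iff)

lemma Sig_eq: "Sig K = X0 + cl K ** Sig K ** transpose (cl K)"
  unfolding Sig_def using lyap_eq[OF stable_transpose, of X0] by simp

lemma Sig_sym: "transpose (Sig K) = Sig K"
  unfolding Sig_def using lyap_transpose[OF stable_transpose, of X0] X0_sym by simp

lemma Sig_psd: "psd (Sig K)"
  unfolding Sig_def by (rule lyap_psd[OF stable_transpose X0_psd])

lemma Sig_ge: "\<mu> * (x \<bullet> x) \<le> x \<bullet> (Sig K *v x)"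
  unfolding Sig_def using lyap_quad_ge[OF stable_transpose X0_psd, of x] X0_ge[of x] by linarith

lemma J_eq: "J K = Sig K \<bullet> W K"
  by (simp add: J_def P_def Sig_inner)

lemma Sig_inner_transpose: "Sig K \<bullet> transpose N = Sig K \<bullet> N"
  using inner_transpose[of "Sig K" N] Sig_sym by simp

lemma Sig_mono:
  assumes "\<And>x. x \<bullet> (N *v x) \<le> x \<bullet> (N' *v x)"
  shows "Sig K \<bullet> N \<le> Sig K \<bullet> N'"
  using psd_inner_mono[OF Sig_sym Sig_psd, of N N'] assms by (simp add: inner_commute)

lemma M_sym: "transpose (M K) = M K"
  by (simp add: M_def matrix_simps R_sym P_sym matrix_mul_assoc)

lemma M_quad: "u \<bullet> (M K *v u) = u \<bullet> (R *v u) + (B *v u) \<bullet> (P K *v (B *v u))"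
  by (simp only: M_def matrix_vector_mult_add_rdistrib inner_add_right quad_congruence)

lemma M_ge: "sigma_min R * (u \<bullet> u) \<le> u \<bullet> (M K *v u)"
  using sym_posdef_quad_ge[OF R, of u] psdD[OF P_psd, of "B *v u"] by (simp add: M_quad)

lemma M_psd: "psd (M K)"
  unfolding psd_def M_quad using psdD[OF P_psd] psdD[OF sym_posdef_psd[OF R]] by (simp add: add_nonneg_nonneg)

lemma Y1_sym: "transpose (Y1 K F) = Y1 K F"
  by (simp add: Y1_def matrix_simps add.commute)

lemma DP_sym: "transpose (DP F K) = DP F K"
  unfolding DP_def using lyap_transpose K Y1_sym by (metis stab_iff)

lemma DP_eq: "DP F K = Y1 K F + transpose (cl K) ** DP F K ** cl K"
  unfolding DP_def by (rule lyap_eq) (use K in \<open>simp add: stab_iff\<close>)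

lemma X0_DP: "X0 \<bullet> DP F K = Sig K \<bullet> Y1 K F"
  by (simp add: DP_def Sig_inner)

lemma Sig_Y1: "Sig K \<bullet> Y1 K F = 2 * (Sig K \<bullet> (transpose (E K) ** F))"
proof -
  have "Sig K \<bullet> (transpose F ** E K) = Sig K \<bullet> (transpose (E K) ** F)"
    using Sig_inner_transpose[of "transpose (E K) ** F"] by (simp add: matrix_transpose_mul)
  then show ?thesis by (simp add: Y1_def inner_add_right)
qed

lemma Sig_Y1_inner: "Sig K \<bullet> Y1 K (D ** C) = D \<bullet> (2 *\<^sub>R (E K ** Sig K ** transpose C))"
proof -
  have "Sig K \<bullet> (transpose (E K) ** (D ** C)) = (transpose (E K) ** (D ** C)) \<bullet> Sig K"
    by (rule inner_commute)
  also have "\<dots> = (D ** C) \<bullet> (E K ** Sig K)"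
    by (simp add: inner_matrix_mult_left)
  also have "\<dots> = D \<bullet> (E K ** Sig K ** transpose C)"
    by (rule inner_matrix_mult_right)
  finally show ?thesis by (simp add: Sig_Y1)
qed

text \<open>Inserting the old \<open>P K\<close> into the Lyapunov equation of the new gain shows
  that \<open>P K' - P K\<close> solves an equation for \<open>cl K'\<close>, and duality moves its
  source onto \<open>Sig K'\<close>. The formula is exact, at the price of the covariance of the new
  gain.\<close>

lemma cost_diff:
  assumes K': "K' \<in> stab" and F: "F = (K' - K) ** C"
  shows "J K' - J K = Sig K' \<bullet> (Y1 K F + transpose F ** M K ** F)"
proof -
  have cl': "cl K' = cl K - B ** F"
    using cl_add[of K "K' - K"] by (simp add: F)
  have k': "K' ** C = K ** C + F"
    by (simp add: F matrix_simps)
  have eq: "W K' + transpose (cl K') ** P K ** cl K'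
      = W K + transpose (cl K) ** P K ** cl K + Y1 K F + transpose F ** M K ** F"
    unfolding W_alt cl' k' Y1_def E_def M_def
    using quad_expand[OF P_sym R_sym, of "K ** C" F "cl K" B]
    by (simp add: matrix_mul_assoc)
  have P': "P K' = W K' + transpose (cl K') ** P K' ** cl K'"
    unfolding P_def by (rule lyap_eq) (use K' in \<open>simp add: stab_iff\<close>)
  have "P K' - P K = (Y1 K F + transpose F ** M K ** F) + transpose (cl K') ** (P K' - P K) ** cl K'"
  proof (rule trans[OF arg_cong2[where f = "(-)", OF P' P_eq]])
    \<comment> \<open>A rearrangement in the additive group; \<open>s\<close> is the old
      \<open>P K\<close> propagated through the new closed loop.\<close>
    have "(w' + t') - (w + t) = (y + n) + (t' - s)" if "w' + s = w + t + y + n"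
      for w w' t t' s y n :: "real^'n^'n"
    proof -
      have "w' = w + t + y + n - s" using that by (simp add: eq_diff_eq)
      then show ?thesis by simp
    qed
    from this[OF eq]
    show "W K' + transpose (cl K') ** P K' ** cl K' - (W K + transpose (cl K) ** P K ** cl K)
        = (Y1 K F + transpose F ** M K ** F) + transpose (cl K') ** (P K' - P K) ** cl K'"
      by (simp only: matrix_mult.diff_left matrix_mult.diff_right)
  qed
  from lyap_unique[OF K'[unfolded stab_iff] this]
  have diff: "P K' - P K = lyap (cl K') (Y1 K F + transpose F ** M K ** F)" .
  have "J K' - J K = X0 \<bullet> lyap (cl K') (Y1 K F + transpose F ** M K ** F)"
    using arg_cong[OF diff, of "\<lambda>N. X0 \<bullet> N"] by (simp only: J_def inner_diff_right)
  also have "\<dots> = Sig K' \<bullet> (Y1 K F + transpose F ** M K ** F)"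
    unfolding Sig_def using lyap_duality K' by (metis stab_iff)
  finally show ?thesis .
qed

lemma P_le: "x \<bullet> (P K *v x) \<le> J K / \<mu> * (x \<bullet> x)"
proof -
  have "\<mu> * (mat 1 \<bullet> P K) \<le> J K"
    unfolding J_def by (rule psd_inner_ge_trace[OF P_sym P_psd X0_ge])
  then have "mat 1 \<bullet> P K \<le> J K / \<mu>" using mu_pos by (simp add: field_simps)
  then have "(mat 1 \<bullet> P K) * (x \<bullet> x) \<le> J K / \<mu> * (x \<bullet> x)" by (intro mult_right_mono) auto
  then show ?thesis using psd_quad_le_trace[OF P_sym P_psd, of x] by linarith
qed

text \<open>The Frobenius norm of a semidefinite matrix is at most its trace, and \<open>X0\<close>
  dominates \<mu> times the identity. This confines \<open>P\<close> to a compact ball on a sublevel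
  set.\<close>

lemma norm_P_le: "norm (P K) \<le> J K / \<mu>"
proof -
  have tr: "\<mu> * (mat 1 \<bullet> P K) \<le> J K"
    unfolding J_def by (rule psd_inner_ge_trace[OF P_sym P_psd X0_ge])
  have "(norm (P K))\<^sup>2 \<le> (mat 1 \<bullet> P K) * (mat 1 \<bullet> P K)"
    unfolding power2_norm_eq_inner
    by (rule psd_inner_le_trace[OF P_sym P_psd psd_quad_le_trace[OF P_sym P_psd]])
  then have "(norm (P K))\<^sup>2 \<le> (mat 1 \<bullet> P K)\<^sup>2"
    by (simp only: power2_eq_square)
  moreover have "0 \<le> mat 1 \<bullet> P K"
    by (rule psd_inner_nonneg[OF P_sym P_psd]) (simp add: psd_def)
  ultimately have "norm (P K) \<le> mat 1 \<bullet> P K"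
    by (rule power2_le_imp_le)
  then have "\<mu> * norm (P K) \<le> J K"
    by (rule order_trans[OF mult_left_mono[OF _ less_imp_le[OF mu_pos]] tr])
  then show ?thesis using mu_pos by (simp add: le_divide_eq mult.commute)
qed

lemma trace_Sig_le: "sigma_min Q * (mat 1 \<bullet> Sig K) \<le> J K"
  using psd_inner_ge_trace[OF Sig_sym Sig_psd W_ge] by (simp add: J_eq inner_commute)

text \<open>At a unit vector \<open>P K\<close> lies above \<open>W K\<close>, hence above
  \<open>sigma_min Q\<close>, and below \<open>J K / \<mu>\<close>.\<close>

lemma J_ge: "\<mu> * sigma_min Q \<le> J K"
proof -
  let ?x = "axis undefined 1 :: real^'n"
  have "sigma_min Q * (?x \<bullet> ?x) \<le> J K / \<mu> * (?x \<bullet> ?x)"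
    using W_ge[of ?x K] P_ge_W[of ?x] P_le[of ?x] by linarith
  then show ?thesis using mu_pos by (simp add: inner_axis_axis field_simps)
qed

lemma J_pos: "0 < J K"
  using J_ge mu_pos sigma_Q_pos by (meson less_le_trans mult_pos_pos)

end

section \<open>Stabilizing gains form an open set, sublevel sets are closed\<close>

lemma isCont_cl: "isCont cl K"
  unfolding closed_loop_def[abs_def] isCont_def
  by (intro tendsto_diff matrix_mult.tendsto tendsto_const tendsto_ident_at)

lemma isCont_W: "isCont W K"
  unfolding W_alt[abs_def] isCont_def
  by (intro tendsto_add matrix_mult.tendsto bounded_linear.tendsto[OF bounded_linear_transpose]
      tendsto_const tendsto_ident_at)

lemma inner_mult_vec_le: "\<bar>x \<bullet> (N *v x)\<bar> \<le> norm (N :: real^'k^'k) * (x \<bullet> x)"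
proof -
  have "\<bar>x \<bullet> (N *v x)\<bar> \<le> norm x * (norm N * norm x)"
    by (intro order_trans[OF Cauchy_Schwarz_ineq2] mult_left_mono norm_matrix_vector_mult_le) auto
  then show ?thesis by (simp add: power2_norm_eq_inner[symmetric] power2_eq_square mult_ac)
qed

text \<open>\<open>P K\<close> remains a Lyapunov function for nearby gains: a small perturbation
  costs at most half of the decrease rate \<open>sigma_min Q\<close>.\<close>

lemma eventually_stab:
  assumes K: "K \<in> stab"
  shows "\<forall>\<^sub>F K' in nhds K. K' \<in> stab"
proof -
  define D where "D K' = transpose (cl K') ** P K ** cl K' - transpose (cl K) ** P K ** cl K" for K'
  have "(cl \<longlongrightarrow> cl K) (nhds K)"
    using isCont_cl[of K] by (simp add: isCont_def tendsto_at_iff_tendsto_nhds)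
  then have "(D \<longlongrightarrow> transpose (cl K) ** P K ** cl K - transpose (cl K) ** P K ** cl K) (nhds K)"
    unfolding D_def
    by (intro tendsto_diff matrix_mult.tendsto bounded_linear.tendsto[OF bounded_linear_transpose]
        tendsto_const)
  then have "(D \<longlongrightarrow> 0) (nhds K)" by simp
  then have "\<forall>\<^sub>F K' in nhds K. norm (D K') < sigma_min Q / 2"
    using order_tendstoD(2)[OF tendsto_norm_zero, of D "nhds K" "sigma_min Q / 2"] sigma_Q_pos by simp
  then show ?thesis
  proof eventually_elim
    case (elim K')
    have "spec_radius (cl K') < 1"
    proof (rule lyapunov_criterion[OF P_psd[OF K]])
      show "0 < sigma_min Q / 2" using sigma_Q_pos by simp
      fix x
      have "(cl K' *v x) \<bullet> (P K *v (cl K' *v x))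
          = (cl K *v x) \<bullet> (P K *v (cl K *v x)) + x \<bullet> (D K' *v x)"
        by (simp only: D_def matrix_vector_mult_diff_rdistrib inner_diff_right quad_congruence)
      moreover have "x \<bullet> (D K' *v x) \<le> sigma_min Q / 2 * (x \<bullet> x)"
        using inner_mult_vec_le[of x "D K'"] mult_right_mono[OF less_imp_le[OF elim], of "x \<bullet> x"]
        by simp
      ultimately show "sigma_min Q / 2 * (x \<bullet> x)
          \<le> x \<bullet> (P K *v x) - (cl K' *v x) \<bullet> (P K *v (cl K' *v x))"
        using P_dec[OF K, of x] W_ge[of x K] by simp
    qed
    then show ?case by (simp add: stab_iff)
  qed
qed

text \<open>The matrices \<open>P (X n)\<close> stay in a compact ball, and a limit \<open>l\<close>
  of a subsequence solves the Lyapunov equation at \<open>K\<close>. So the bound on the cost keeps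
  the limit away from the stability boundary.\<close>

lemma sublevel_closed:
  assumes X: "\<And>n. X n \<in> stab" "\<And>n. J (X n) \<le> \<alpha>" and lim: "X \<longlonglongrightarrow> K"
  shows "K \<in> stab" "J K \<le> \<alpha>"
proof -
  have "P (X n) \<in> cball 0 (\<alpha> / \<mu>)" for n
    using norm_P_le[OF X(1)[of n]] X(2)[of n] mu_pos
    by (simp add: dist_norm) (meson divide_right_mono less_imp_le order_trans)
  then obtain l r where r: "strict_mono r" and l: "((\<lambda>n. P (X n)) \<circ> r) \<longlonglongrightarrow> l"
    using compact_cball[of "0 :: real^'n^'n" "\<alpha> / \<mu>", unfolded compact_def, THEN spec,
        of "\<lambda>n. P (X n)"]
    by blast
  have l: "(\<lambda>n. P (X (r n))) \<longlonglongrightarrow> l" using l by (simp add: o_def)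
  have Xr: "(\<lambda>n. X (r n)) \<longlonglongrightarrow> K"
    using LIMSEQ_subseq_LIMSEQ[OF lim r] by (simp add: o_def)
  have W: "(\<lambda>n. W (X (r n))) \<longlonglongrightarrow> W K" and cl: "(\<lambda>n. cl (X (r n))) \<longlonglongrightarrow> cl K"
    using isCont_tendsto_compose[OF isCont_W Xr] isCont_tendsto_compose[OF isCont_cl Xr] by auto
  have "(\<lambda>n. W (X (r n)) + transpose (cl (X (r n))) ** P (X (r n)) ** cl (X (r n)))
      \<longlonglongrightarrow> W K + transpose (cl K) ** l ** cl K"
    by (intro tendsto_add matrix_mult.tendsto bounded_linear.tendsto[OF bounded_linear_transpose] W cl l)
  then have "(\<lambda>n. P (X (r n))) \<longlonglongrightarrow> W K + transpose (cl K) ** l ** cl K"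
    by (simp only: P_eq[OF X(1), symmetric])
  then have l_eq: "l = W K + transpose (cl K) ** l ** cl K"
    using l LIMSEQ_unique by blast
  have l_psd: "psd l"
    unfolding psd_def
  proof
    fix x
    have "(\<lambda>n. P (X (r n)) \<bullet> outer x x) \<longlonglongrightarrow> l \<bullet> outer x x"
      by (intro tendsto_inner l tendsto_const)
    then have "(\<lambda>n. x \<bullet> (P (X (r n)) *v x)) \<longlonglongrightarrow> x \<bullet> (l *v x)"
      by (simp only: inner_outer)
    then show "0 \<le> x \<bullet> (l *v x)"
      by (rule LIMSEQ_le_const) (use psdD[OF P_psd[OF X(1)]] in blast)
  qed
  \<comment> \<open>Uniqueness of Lyapunov solutions needs stability at \<open>K\<close>, so
    \<open>l\<close> serves as a Lyapunov function first and is identified with \<open>P K\<close>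
    only afterwards.\<close>
  have "spec_radius (cl K) < 1"
  proof (rule lyapunov_criterion[OF l_psd sigma_Q_pos])
    fix x
    have "x \<bullet> (l *v x) = x \<bullet> ((W K + transpose (cl K) ** l ** cl K) *v x)"
      using l_eq by simp
    then show "sigma_min Q * (x \<bullet> x) \<le> x \<bullet> (l *v x) - (cl K *v x) \<bullet> (l *v (cl K *v x))"
      using W_ge[of x K]
      by (simp only: matrix_vector_mult_add_rdistrib inner_add_right quad_congruence)
  qed
  then show "K \<in> stab" by (simp add: stab_iff)
  have "l = P K"
    unfolding P_def by (rule lyap_unique[OF \<open>spec_radius (cl K) < 1\<close> l_eq])
  moreover have "(\<lambda>n. X0 \<bullet> P (X (r n))) \<longlonglongrightarrow> X0 \<bullet> l"
    by (intro tendsto_inner l tendsto_const)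
  ultimately have "(\<lambda>n. J (X (r n))) \<longlonglongrightarrow> J K"
    by (simp add: J_def)
  then show "J K \<le> \<alpha>"
    by (rule LIMSEQ_le_const2) (use X(2) in blast)
qed

end

subsection \<open>The Hessian of the cost\<close>

text \<open>Polarization and the parallelogram law for unit vectors, then scaling; no constant is
  lost in passing from the quadratic to the bilinear form.\<close>

lemma sym_bilinear_bound:
  fixes N :: "real^'n^'n"
  assumes N: "transpose N = N" and b: "\<And>x. \<bar>x \<bullet> (N *v x)\<bar> \<le> b * (x \<bullet> x)"
  shows "\<bar>y \<bullet> (N *v z)\<bar> \<le> b * norm y * norm z"
proof -
  have unit: "\<bar>u \<bullet> (N *v v)\<bar> \<le> b" if "norm u = 1" "norm v = 1" for u v
  proof -
    have "4 * (u \<bullet> (N *v v)) = (u + v) \<bullet> (N *v (u + v)) - (u - v) \<bullet> (N *v (u - v))"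
      using sym_inner_commute[OF N, of u v]
      by (simp add: matrix_vector_right_distrib matrix_vector_mult_diff_distrib inner_simps)
    then have "\<bar>4 * (u \<bullet> (N *v v))\<bar> \<le> b * ((u + v) \<bullet> (u + v)) + b * ((u - v) \<bullet> (u - v))"
      using b[of "u + v"] b[of "u - v"] by linarith
    also have "\<dots> = b * (2 * (norm u)\<^sup>2 + 2 * (norm v)\<^sup>2)"
      by (simp add: power2_norm_eq_inner inner_simps inner_commute[of v u] algebra_simps)
    finally show ?thesis using that by simp
  qed
  show ?thesis
  proof (cases "y = 0 \<or> z = 0")
    case False
    have "\<bar>(y /\<^sub>R norm y) \<bullet> (N *v (z /\<^sub>R norm z))\<bar> \<le> b"
      by (rule unit) (use False in auto)
    then have "\<bar>y \<bullet> (N *v z)\<bar> / (norm y * norm z) \<le> b"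
      by (simp add: matrix_vector_mult_scaleR abs_mult divide_inverse mult_ac)
    then show ?thesis using False by (simp add: divide_le_eq mult_ac)
  qed auto
qed

context lqr
begin

lemma has_derivative_cl: "(cl has_derivative (\<lambda>h. - (B ** (h ** C)))) (at K)"
proof -
  have "bounded_linear (\<lambda>h. B ** (h ** C))"
    by (intro bounded_linear_compose[OF matrix_mult.bounded_linear_right]
        matrix_mult.bounded_linear_left)
  from has_derivative_diff[OF has_derivative_const[of A] bounded_linear.has_derivative[OF this has_derivative_ident]]
  show ?thesis by (simp add: closed_loop_def[abs_def] matrix_mul_assoc)
qed

lemma has_derivative_gain: "((\<lambda>K. K ** C) has_derivative (\<lambda>h. h ** C)) (at K)"
  by (intro bounded_linear_imp_has_derivative matrix_mult.bounded_linear_left)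

lemma has_derivative_W: "(W has_derivative (\<lambda>h. transpose (K ** C) ** R ** (h ** C)
    + transpose (h ** C) ** R ** (K ** C))) (at K)"
proof -
  have "((\<lambda>K. transpose (K ** C)) has_derivative (\<lambda>h. transpose (h ** C))) (at K)"
    by (rule bounded_linear.has_derivative[OF bounded_linear_transpose has_derivative_gain])
  then have "((\<lambda>K. transpose (K ** C) ** R) has_derivative (\<lambda>h. transpose (h ** C) ** R)) (at K)"
    by (rule bounded_linear.has_derivative[OF matrix_mult.bounded_linear_left])
  from has_derivative_add[OF has_derivative_const[of Q] matrix_mult.FDERIV[OF this has_derivative_gain]]
  show ?thesis unfolding W_alt[abs_def] by simp
qed

lemma has_derivative_P:
  assumes K: "K \<in> stab"
  shows "(P has_derivative (\<lambda>h. DP (h ** C) K)) (at K)"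
proof -
  have ev: "\<forall>\<^sub>F y in nhds K. P y = W y + transpose (cl y) ** P y ** cl y"
    using eventually_stab[OF K] by (rule eventually_mono) (rule P_eq)
  have "transpose (K ** C) ** R ** F + transpose F ** R ** (K ** C)
      + transpose (- (B ** F)) ** (P K ** cl K) + transpose (cl K) ** P K ** - (B ** F) = Y1 K F" for F
    unfolding Y1_def E_def
    by (simp add: matrix_simps matrix_mul_assoc R_sym P_sym[OF K] algebra_simps)
  then show ?thesis
    using lyap_solution_has_derivative[OF ev K[unfolded stab_iff] has_derivative_cl has_derivative_W]
    unfolding DP_def by simp
qed

lemma GDERIV_J:
  assumes K: "K \<in> stab"
  shows "GDERIV J K :> 2 *\<^sub>R (E K ** Sig K ** transpose C)"
proof -
  have "((\<lambda>K. X0 \<bullet> P K) has_derivative (\<lambda>h. X0 \<bullet> DP (h ** C) K)) (at K)"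
    by (rule bounded_linear.has_derivative[OF bounded_linear_inner_right has_derivative_P[OF K]])
  then show ?thesis
    unfolding gderiv_def J_def[abs_def] X0_DP[OF K] Sig_Y1_inner[OF K] .
qed

definition DE :: "real^'n^'m \<Rightarrow> real^'d^'m \<Rightarrow> real^'n^'m"
  where "DE F K = M K ** F - transpose B ** DP F K ** cl K"

text \<open>The change of \<open>cl\<close> contributes \<open>transpose B ** P K ** B ** F\<close>,
  which joins \<open>R ** F\<close> to form \<open>M K ** F\<close>.\<close>

lemma has_derivative_E:
  assumes K: "K \<in> stab"
  shows "(E has_derivative (\<lambda>h. DE (h ** C) K)) (at K)"
proof -
  have 1: "((\<lambda>K. R ** (K ** C)) has_derivative (\<lambda>h. R ** (h ** C))) (at K)"
    by (rule bounded_linear.has_derivative[OF matrix_mult.bounded_linear_right has_derivative_gain])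
  have 2: "((\<lambda>K. transpose B ** P K) has_derivative (\<lambda>h. transpose B ** DP (h ** C) K)) (at K)"
    by (rule bounded_linear.has_derivative[OF matrix_mult.bounded_linear_right has_derivative_P[OF K]])
  have "((\<lambda>K. R ** (K ** C) - transpose B ** P K ** cl K) has_derivative
      (\<lambda>h. R ** (h ** C) - (transpose B ** P K ** - (B ** (h ** C))
        + transpose B ** DP (h ** C) K ** cl K))) (at K)"
    by (intro has_derivative_diff 1 matrix_mult.FDERIV 2 has_derivative_cl)
  moreover have "R ** F - (transpose B ** P K ** - (B ** F) + transpose B ** DP F K ** cl K)
      = DE F K" for F
    by (simp add: DE_def M_def matrix_simps matrix_mul_assoc)
  ultimately have "((\<lambda>K. R ** (K ** C) - transpose B ** P K ** cl K) has_derivative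
      (\<lambda>h. DE (h ** C) K)) (at K)"
    by (simp only:)
  then show ?thesis
    by (simp only: E_def[abs_def] matrix_mul_assoc)
qed

text \<open>The second derivative of \<open>J\<close> along a direction \<Delta> with
  \<open>F = \<Delta> ** C\<close>. Pairing with \<open>Sig K\<close> replaces a second Lyapunov
  solution.\<close>

definition hess :: "real^'n^'m \<Rightarrow> real^'d^'m \<Rightarrow> real"
  where "hess F K = Sig K \<bullet> (2 *\<^sub>R (transpose F ** M K ** F)
    - 2 *\<^sub>R (transpose F ** transpose B ** DP F K ** cl K)
    - 2 *\<^sub>R (transpose (cl K) ** DP F K ** B ** F))"

text \<open>\<open>F\<close> stays fixed while \<open>K\<close> varies. Only the diagonal value,
  where the direction of differentiation also induces \<open>F\<close>, matters for the second
  derivative along a line.\<close>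

lemma has_derivative_DP:
  assumes K: "K \<in> stab"
  shows "\<exists>D. ((\<lambda>K. X0 \<bullet> DP F K) has_derivative D) (at K) \<and> (\<forall>h. h ** C = F \<longrightarrow> D h = hess F K)"
proof -
  have ev: "\<forall>\<^sub>F y in nhds K. DP F y = Y1 y F + transpose (cl y) ** DP F y ** cl y"
    using eventually_stab[OF K] by (rule eventually_mono) (rule DP_eq)
  have 1: "((\<lambda>K. transpose F ** E K) has_derivative (\<lambda>h. transpose F ** DE (h ** C) K)) (at K)"
    by (rule bounded_linear.has_derivative[OF matrix_mult.bounded_linear_right has_derivative_E[OF K]])
  have 2: "((\<lambda>K. transpose (E K) ** F) has_derivative (\<lambda>h. transpose (DE (h ** C) K) ** F)) (at K)"
    by (intro bounded_linear.has_derivative[OF matrix_mult.bounded_linear_left]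
        bounded_linear.has_derivative[OF bounded_linear_transpose] has_derivative_E[OF K])
  have Y: "((\<lambda>K. Y1 K F) has_derivative
      (\<lambda>h. transpose F ** DE (h ** C) K + transpose (DE (h ** C) K) ** F)) (at K)"
    unfolding Y1_def by (intro has_derivative_add 1 2)
  let ?D = "\<lambda>h. X0 \<bullet> lyap (cl K) (transpose F ** DE (h ** C) K + transpose (DE (h ** C) K) ** F
      + transpose (- (B ** (h ** C))) ** (DP F K ** cl K)
      + transpose (cl K) ** DP F K ** - (B ** (h ** C)))"
  have "((\<lambda>K. X0 \<bullet> DP F K) has_derivative ?D) (at K)"
    by (intro bounded_linear.has_derivative[OF bounded_linear_inner_right]
        lyap_solution_has_derivative[OF ev K[unfolded stab_iff] has_derivative_cl Y])
  moreover have "?D h = hess F K" if h: "h ** C = F" for h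
  proof -
    have "transpose F ** DE F K + transpose (DE F K) ** F
      + transpose (- (B ** F)) ** (DP F K ** cl K) + transpose (cl K) ** DP F K ** - (B ** F)
      = 2 *\<^sub>R (transpose F ** M K ** F)
        - 2 *\<^sub>R (transpose F ** transpose B ** DP F K ** cl K)
        - 2 *\<^sub>R (transpose (cl K) ** DP F K ** B ** F)"
      unfolding DE_def
      by (simp add: matrix_simps matrix_mul_assoc M_sym[OF K] DP_sym[OF K] scaleR_2)
    then show ?thesis unfolding h hess_def Sig_inner[OF K] by simp
  qed
  ultimately show ?thesis by blast
qed

lemma line_derivatives:
  assumes K: "K + t *\<^sub>R D \<in> stab"
  shows "((\<lambda>t. J (K + t *\<^sub>R D)) has_real_derivative X0 \<bullet> DP (D ** C) (K + t *\<^sub>R D)) (at t)"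
    and "((\<lambda>t. X0 \<bullet> DP (D ** C) (K + t *\<^sub>R D)) has_real_derivative hess (D ** C) (K + t *\<^sub>R D)) (at t)"
proof -
  have line: "((\<lambda>t. K + t *\<^sub>R D) has_derivative (\<lambda>s. s *\<^sub>R D)) (at t)"
    by (auto intro!: derivative_eq_intros)
  have chain: "((\<lambda>t. f (K + t *\<^sub>R D)) has_real_derivative f' D) (at t)"
    if f: "(f has_derivative f') (at (K + t *\<^sub>R D))" for f :: "real^'d^'m \<Rightarrow> real" and f'
  proof -
    have "((\<lambda>t. f (K + t *\<^sub>R D)) has_derivative (\<lambda>s. f' (s *\<^sub>R D))) (at t)"
      by (rule has_derivative_compose[OF line f])
    moreover have "f' (s *\<^sub>R D) = f' D * s" for s
      using linear_scale[OF has_derivative_linear[OF f]] by (simp add: mult.commute)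
    ultimately show ?thesis by (simp add: has_field_derivative_def)
  qed
  show "((\<lambda>t. J (K + t *\<^sub>R D)) has_real_derivative X0 \<bullet> DP (D ** C) (K + t *\<^sub>R D)) (at t)"
    unfolding J_def
    by (rule chain[OF bounded_linear.has_derivative[OF bounded_linear_inner_right has_derivative_P[OF K]]])
  obtain f' where f': "((\<lambda>K. X0 \<bullet> DP (D ** C) K) has_derivative f') (at (K + t *\<^sub>R D))"
    "f' D = hess (D ** C) (K + t *\<^sub>R D)"
    using has_derivative_DP[OF K, of "D ** C"] by blast
  show "((\<lambda>t. X0 \<bullet> DP (D ** C) (K + t *\<^sub>R D)) has_real_derivative hess (D ** C) (K + t *\<^sub>R D)) (at t)"
    unfolding f'(2)[symmetric] by (rule chain[OF f'(1)])
qed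

section \<open>Explicit bounds on the sublevel set\<close>

abbreviation "\<zeta> \<equiv> zeta1 B C Q R \<mu>"
abbreviation "L \<equiv> smooth_const B C Q R \<mu>"

lemma sym_cross_le:
  fixes N :: "real^'k^'k"
  assumes "transpose N = N" "psd N"
  shows "2 * \<bar>u \<bullet> (N *v v)\<bar> \<le> u \<bullet> (N *v u) + v \<bullet> (N *v v)"
proof -
  have "0 \<le> (u + v) \<bullet> (N *v (u + v))" "0 \<le> (u - v) \<bullet> (N *v (u - v))"
    using psdD[OF assms(2)] by auto
  then show ?thesis
    using sym_inner_commute[OF assms(1), of v u]
    by (simp add: matrix_vector_right_distrib matrix_vector_mult_diff_distrib inner_simps)
qed

context
  fixes K :: "real^'d^'m" and \<alpha> :: real
  assumes K: "K \<in> stab" and J_le: "J K \<le> \<alpha>"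
begin

lemma alpha_pos: "0 < \<alpha>"
  using J_pos[OF K] J_le by simp

lemma P_le': "x \<bullet> (P K *v x) \<le> \<alpha> / \<mu> * (x \<bullet> x)"
proof -
  have "J K / \<mu> * (x \<bullet> x) \<le> \<alpha> / \<mu> * (x \<bullet> x)"
    using J_le mu_pos by (intro mult_right_mono divide_right_mono) auto
  then show ?thesis using P_le[OF K, of x] by linarith
qed

lemma M_le: "u \<bullet> (M K *v u) \<le> (norm2 R + \<alpha> / \<mu> * (norm2 B)\<^sup>2) * (norm u)\<^sup>2"
proof -
  have "u \<bullet> (R *v u) \<le> norm u * (norm2 R * norm u)"
    by (intro order_trans[OF norm_cauchy_schwarz] mult_left_mono norm2_bound) auto
  moreover have "(B *v u) \<bullet> (P K *v (B *v u)) \<le> \<alpha> / \<mu> * (norm2 B * norm u)\<^sup>2"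
  proof -
    have "(norm (B *v u))\<^sup>2 \<le> (norm2 B * norm u)\<^sup>2"
      by (intro power_mono norm2_bound) auto
    then have "\<alpha> / \<mu> * ((B *v u) \<bullet> (B *v u)) \<le> \<alpha> / \<mu> * (norm2 B * norm u)\<^sup>2"
      using alpha_pos mu_pos by (intro mult_left_mono) (auto simp: power2_norm_eq_inner)
    then show ?thesis using P_le'[of "B *v u"] by linarith
  qed
  ultimately show ?thesis
    by (simp add: M_quad[OF K] algebra_simps power2_eq_square)
qed

lemma gain_bound: "norm ((D ** C) *v x) \<le> norm D * norm2 C * norm x"
proof -
  have "norm (D *v (C *v x)) \<le> norm D * (norm2 C * norm x)"
    by (intro order_trans[OF norm_matrix_vector_mult_le] mult_left_mono norm2_bound) auto
  then show ?thesis by (simp add: matrix_vector_mul_assoc mult.assoc)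
qed

lemma Y1_quad: "x \<bullet> (Y1 K F *v x)
  = 2 * ((F *v x) \<bullet> (R *v (K ** C *v x))) - 2 * ((B ** F *v x) \<bullet> (P K *v (cl K *v x)))"
proof -
  have E: "E K *v x = R *v (K ** C *v x) - transpose B *v (P K *v (cl K *v x))"
    by (simp add: E_def matrix_vector_mult_diff_rdistrib matrix_vector_mul_assoc matrix_mul_assoc
        del: transpose_matrix_vector)
  have "x \<bullet> (Y1 K F *v x) = (F *v x) \<bullet> (E K *v x) + (E K *v x) \<bullet> (F *v x)"
    by (simp add: Y1_def matrix_vector_mult_add_rdistrib inner_add_right
        inner_matrix_vector_transpose[of x "transpose _"]
        del: transpose_matrix_vector flip: matrix_vector_mul_assoc)
  also have "\<dots> = 2 * ((F *v x) \<bullet> (E K *v x))"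
    by (simp add: inner_commute)
  also have "(F *v x) \<bullet> (E K *v x) = (F *v x) \<bullet> (R *v (K ** C *v x))
      - (F *v x) \<bullet> (transpose B *v (P K *v (cl K *v x)))"
    by (simp only: E inner_diff_right)
  also have "(F *v x) \<bullet> (transpose B *v (P K *v (cl K *v x))) = (B ** F *v x) \<bullet> (P K *v (cl K *v x))"
    using inner_matrix_vector_transpose[of "F *v x" "transpose B" "P K *v (cl K *v x)"]
    by (simp only: transpose_transpose matrix_vector_mul_assoc)
  finally show ?thesis by simp
qed

text \<open>The cross terms are split by AM-GM, and the squares without \<open>\<Delta>\<close> add up to \<open>P - Q\<close> by the
  Lyapunov equation.\<close>
lemma Y1_le_unit:
  assumes D: "norm D = 1"
  shows "\<bar>x \<bullet> (Y1 K (D ** C) *v x)\<bar> \<le> \<zeta> \<alpha> * (x \<bullet> (Q *v x))"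
proof -
  let ?F = "D ** C" and ?k = "K ** C *v x" and ?z = "cl K *v x"
  have "2 * \<bar>(?F *v x) \<bullet> (R *v ?k)\<bar> \<le> (?F *v x) \<bullet> (R *v (?F *v x)) + ?k \<bullet> (R *v ?k)"
    by (rule sym_cross_le[OF R_sym sym_posdef_psd[OF R]])
  moreover have "2 * \<bar>(B ** ?F *v x) \<bullet> (P K *v ?z)\<bar>
      \<le> (B ** ?F *v x) \<bullet> (P K *v (B ** ?F *v x)) + ?z \<bullet> (P K *v ?z)"
    by (rule sym_cross_le[OF P_sym[OF K] P_psd[OF K]])
  moreover have "\<bar>x \<bullet> (Y1 K ?F *v x)\<bar>
      \<le> 2 * \<bar>(?F *v x) \<bullet> (R *v ?k)\<bar> + 2 * \<bar>(B ** ?F *v x) \<bullet> (P K *v ?z)\<bar>"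
    unfolding Y1_quad by linarith
  moreover have "(?F *v x) \<bullet> (M K *v (?F *v x))
      = (?F *v x) \<bullet> (R *v (?F *v x)) + (B ** ?F *v x) \<bullet> (P K *v (B ** ?F *v x))"
    by (simp add: M_quad[OF K] flip: matrix_vector_mul_assoc)
  moreover have "?k \<bullet> (R *v ?k) + ?z \<bullet> (P K *v ?z) = x \<bullet> (P K *v x) - x \<bullet> (Q *v x)"
    using P_dec[OF K, of x] W_quad[of x K] by simp
  moreover have "(?F *v x) \<bullet> (M K *v (?F *v x))
      \<le> (norm2 R + \<alpha> / \<mu> * (norm2 B)\<^sup>2) * (norm2 C)\<^sup>2 * (x \<bullet> x)"
  proof -
    have "(norm (?F *v x))\<^sup>2 \<le> (norm2 C * norm x)\<^sup>2"
      using gain_bound[of D x] D by (intro power_mono) auto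
    then have "(norm2 R + \<alpha> / \<mu> * (norm2 B)\<^sup>2) * (norm (?F *v x))\<^sup>2
        \<le> (norm2 R + \<alpha> / \<mu> * (norm2 B)\<^sup>2) * (norm2 C * norm x)\<^sup>2"
      using norm2_nonneg[of R] alpha_pos mu_pos by (intro mult_left_mono) auto
    then show ?thesis
      using M_le[of "?F *v x"]
      by (simp add: power_mult_distrib mult.assoc flip: power2_norm_eq_inner)
  qed
  ultimately have "\<bar>x \<bullet> (Y1 K ?F *v x)\<bar> \<le> (\<alpha> / \<mu>) * (x \<bullet> x) - x \<bullet> (Q *v x)
      + (norm2 R + \<alpha> / \<mu> * (norm2 B)\<^sup>2) * (norm2 C)\<^sup>2 * (x \<bullet> x)"
    using P_le'[of x] by linarith
  \<comment> \<open>This is where \<open>zeta1\<close> comes from: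
    \<open>(\<zeta> \<alpha> + 1) * sigma_min Q\<close> is the coefficient collected in front of
    \<open>x \<bullet> x\<close>, and the subtracted form of \<open>Q\<close> accounts for its
    -1.\<close>
  also have "\<dots> = (\<zeta> \<alpha> + 1) * (sigma_min Q * (x \<bullet> x)) - x \<bullet> (Q *v x)"
    using sigma_Q_pos mu_pos unfolding zeta1_def by (simp add: field_simps)
  also have "\<dots> \<le> (\<zeta> \<alpha> + 1) * (x \<bullet> (Q *v x)) - x \<bullet> (Q *v x)"
  proof -
    have "0 \<le> \<zeta> \<alpha> + 1"
      unfolding zeta1_def using sigma_Q_pos alpha_pos mu_pos norm2_nonneg[of R] by simp
    then show ?thesis using sym_posdef_quad_ge[OF Q, of x] by (simp add: mult_left_mono)
  qed
  finally show ?thesis by (simp add: algebra_simps)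
qed

text \<open>\<open>Y1\<close> is linear in the direction, whereas the AM-GM estimate is not
  homogeneous, so the direction is normalized first.\<close>

lemma Y1_le: "\<bar>x \<bullet> (Y1 K (D ** C) *v x)\<bar> \<le> norm D * \<zeta> \<alpha> * (x \<bullet> (Q *v x))"
proof (cases "D = 0")
  case True
  then show ?thesis by (simp add: Y1_def)
next
  case False
  have "Y1 K (D ** C) = norm D *\<^sub>R Y1 K ((D /\<^sub>R norm D) ** C)"
    using False by (simp add: Y1_def matrix_simps scaleR_add_right)
  then have "x \<bullet> (Y1 K (D ** C) *v x) = norm D * (x \<bullet> (Y1 K ((D /\<^sub>R norm D) ** C) *v x))"
    by (simp flip: scaleR_matrix_vector_assoc)
  moreover have "\<bar>x \<bullet> (Y1 K ((D /\<^sub>R norm D) ** C) *v x)\<bar> \<le> \<zeta> \<alpha> * (x \<bullet> (Q *v x))"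
    by (rule Y1_le_unit) (use False in simp)
  ultimately show ?thesis by (simp add: abs_mult mult.assoc mult_left_mono)
qed

lemma zeta_nonneg: "0 \<le> \<zeta> \<alpha>"
proof -
  have "sigma_min Q \<le> \<alpha> / \<mu>"
    using J_ge[OF K] J_le mu_pos by (simp add: le_divide_eq mult.commute)
  also have "\<dots> \<le> \<alpha> / \<mu> * (1 + (norm2 B)\<^sup>2 * (norm2 C)\<^sup>2) + norm2 R * (norm2 C)\<^sup>2"
    using alpha_pos mu_pos norm2_nonneg[of R] by (simp add: algebra_simps)
  finally show ?thesis
    using sigma_Q_pos unfolding zeta1_def by simp
qed

text \<open>The Lyapunov operator preserves the semidefinite order. Hence domination of both signs
  of \<open>Y1\<close> by a multiple of \<open>W\<close> passes to \<open>DP\<close> with the same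
  multiple of \<open>P\<close>.\<close>

lemma DP_le: "\<bar>x \<bullet> (DP (D ** C) K *v x)\<bar> \<le> norm D * \<zeta> \<alpha> * (\<alpha> / \<mu>) * (x \<bullet> x)"
proof -
  let ?b = "norm D * \<zeta> \<alpha>"
  have b: "0 \<le> ?b" using zeta_nonneg by simp
  have lin: "lyap (cl K) (?b *\<^sub>R W K + s *\<^sub>R Y1 K (D ** C)) = ?b *\<^sub>R P K + s *\<^sub>R DP (D ** C) K" for s
    using bounded_linear_lyap[OF K[unfolded stab_iff]]
    by (simp add: P_def DP_def bounded_linear.linear linear_add linear_scale)
  have "0 \<le> x \<bullet> ((?b *\<^sub>R P K + s *\<^sub>R DP (D ** C) K) *v x)" if s: "s = 1 \<or> s = -1" for s
    unfolding lin[symmetric]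
  proof (intro psdD lyap_psd[OF K[unfolded stab_iff]])
    show "psd (?b *\<^sub>R W K + s *\<^sub>R Y1 K (D ** C))"
      unfolding psd_def
    proof
      fix x
      have "?b * (x \<bullet> (Q *v x)) \<le> ?b * (x \<bullet> (W K *v x))"
        by (intro mult_left_mono W_ge_Q b)
      then show "0 \<le> x \<bullet> ((?b *\<^sub>R W K + s *\<^sub>R Y1 K (D ** C)) *v x)"
        using Y1_le[of x D] s
        by (auto simp: matrix_vector_mult_add_rdistrib inner_add_right simp flip: scaleR_matrix_vector_assoc)
    qed
  qed
  from this[of 1] this[of "-1"]
  have "\<bar>x \<bullet> (DP (D ** C) K *v x)\<bar> \<le> ?b * (x \<bullet> (P K *v x))"
    by (auto simp: matrix_vector_mult_add_rdistrib matrix_vector_mult_diff_rdistrib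
        inner_add_right inner_diff_right abs_le_iff
        simp flip: scaleR_matrix_vector_assoc)
  also have "\<dots> \<le> ?b * (\<alpha> / \<mu> * (x \<bullet> x))"
    by (intro mult_left_mono P_le' b)
  finally show ?thesis by (simp add: mult.assoc)
qed

text \<open>The left side is the trace of the propagated covariance, which by the equation for
  \<open>Sig K\<close> is the trace of \<open>Sig K\<close> minus that of \<open>X0\<close>.\<close>

lemma Sig_cl_le: "Sig K \<bullet> (transpose (cl K) ** cl K) \<le> mat 1 \<bullet> Sig K"
proof -
  have "Sig K \<bullet> (transpose (cl K) ** cl K) = (cl K ** Sig K ** transpose (cl K)) \<bullet> mat 1"
    using inner_congruence[of "cl K" "mat 1" "Sig K"] by (simp add: inner_commute)
  also have "\<dots> = mat 1 \<bullet> Sig K - X0 \<bullet> mat 1"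
    using arg_cong[OF Sig_eq[OF K], of "\<lambda>N. N \<bullet> mat 1"]
    by (simp only: inner_add_left inner_commute[of "mat 1"])
  also have "\<dots> \<le> mat 1 \<bullet> Sig K"
    using psd_inner_nonneg[OF _ _ X0_psd, of "mat 1"] by (simp add: psd_def)
  finally show ?thesis .
qed

text \<open>The covariance is controlled only through its trace. The Hessian form is therefore
  dominated by a combination of the identity and \<open>transpose (cl K) ** cl K\<close>, both of
  which pair with \<open>Sig K\<close> to at most its trace.\<close>

lemma hess_le: "hess (D ** C) K \<le> L \<alpha> * (norm D)\<^sup>2"
proof -
  let ?F = "D ** C" and ?m = "norm2 R + \<alpha> / \<mu> * (norm2 B)\<^sup>2"
  \<comment> \<open>\<open>b\<close> bounds the form of \<open>DP\<close>, \<beta> the size of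
    \<open>B ** D ** C\<close>, and \<open>c\<close> carries the term with
    \<open>M K\<close>.\<close>
  define b where "b = norm D * \<zeta> \<alpha> * (\<alpha> / \<mu>)"
  define \<beta> where "\<beta> = norm2 B * (norm D * norm2 C)"
  define c where "c = 2 * ?m * (norm D * norm2 C)\<^sup>2"
  have b: "0 \<le> b" using zeta_nonneg alpha_pos mu_pos by (simp add: b_def)
  have \<beta>: "0 \<le> \<beta>" using norm2_nonneg[of B] norm2_nonneg[of C] by (simp add: \<beta>_def)
  have m: "0 \<le> ?m" using norm2_nonneg[of R] alpha_pos mu_pos by simp
  let ?H = "2 *\<^sub>R (transpose ?F ** M K ** ?F)
    - 2 *\<^sub>R (transpose ?F ** transpose B ** DP ?F K ** cl K)
    - 2 *\<^sub>R (transpose (cl K) ** DP ?F K ** B ** ?F)"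
  let ?N = "(c + 2 * b * \<beta>) *\<^sub>R mat 1 + (2 * b * \<beta>) *\<^sub>R (transpose (cl K) ** cl K)"
  have "x \<bullet> (?H *v x) \<le> x \<bullet> (?N *v x)" for x
  proof -
    let ?y = "B *v (?F *v x)" and ?z = "cl K *v x"
    have 1: "x \<bullet> ((transpose ?F ** transpose B ** DP ?F K ** cl K) *v x) = ?y \<bullet> (DP ?F K *v ?z)"
    proof -
      have "x \<bullet> ((transpose (B ** ?F) ** DP ?F K ** cl K) *v x) = (B ** ?F *v x) \<bullet> (DP ?F K *v ?z)"
        by (simp add: inner_matrix_vector_transpose[of x "transpose _"] del: transpose_matrix_vector
            flip: matrix_vector_mul_assoc)
      then show ?thesis by (simp add: matrix_transpose_mul matrix_vector_mul_assoc matrix_mul_assoc)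
    qed
    have 2: "x \<bullet> ((transpose (cl K) ** DP ?F K ** B ** ?F) *v x) = ?z \<bullet> (DP ?F K *v ?y)"
      by (simp add: inner_matrix_vector_transpose[of x "transpose _"] del: transpose_matrix_vector
          flip: matrix_vector_mul_assoc)
    \<comment> \<open>The two cross terms agree because \<open>DP\<close> is symmetric, hence the
      factor 4.\<close>
    have "x \<bullet> (?H *v x) = 2 * ((?F *v x) \<bullet> (M K *v (?F *v x))) - 4 * (?y \<bullet> (DP ?F K *v ?z))"
      unfolding matrix_vector_mult_diff_rdistrib inner_diff_right scaleR_matrix_vector_assoc[symmetric]
        inner_scaleR_right 1 2 quad_congruence sym_inner_commute[OF DP_sym[OF K], where x = "?z" and y = "?y"]
      by simp
    also have "\<dots> \<le> 2 * (?m * (norm D * norm2 C * norm x)\<^sup>2) + 4 * (b * (\<beta> * norm x) * norm ?z)"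
    proof -
      have "?m * (norm (?F *v x))\<^sup>2 \<le> ?m * (norm D * norm2 C * norm x)\<^sup>2"
        by (intro mult_left_mono power_mono gain_bound m) auto
      then have "(?F *v x) \<bullet> (M K *v (?F *v x)) \<le> ?m * (norm D * norm2 C * norm x)\<^sup>2"
        using M_le[of "?F *v x"] by linarith
      moreover have "\<bar>?y \<bullet> (DP ?F K *v ?z)\<bar> \<le> b * (\<beta> * norm x) * norm ?z"
      proof -
        have "norm ?y \<le> norm2 B * (norm D * norm2 C * norm x)"
          by (intro order_trans[OF norm2_bound] mult_left_mono gain_bound norm2_nonneg)
        then have "b * norm ?y * norm ?z \<le> b * (\<beta> * norm x) * norm ?z"
          using b by (intro mult_right_mono mult_left_mono) (auto simp: \<beta>_def mult_ac)
        moreover have "\<bar>?y \<bullet> (DP ?F K *v ?z)\<bar> \<le> b * norm ?y * norm ?z"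
          using DP_le[of _ D] by (intro sym_bilinear_bound DP_sym[OF K]) (simp add: b_def)
        ultimately show ?thesis by linarith
      qed
      ultimately show ?thesis by linarith
    qed
    also have "\<dots> \<le> c * (norm x)\<^sup>2 + 2 * b * \<beta> * ((norm x)\<^sup>2 + (norm ?z)\<^sup>2)"
    proof -
      have "2 * (norm x * norm ?z) \<le> (norm x)\<^sup>2 + (norm ?z)\<^sup>2"
        using sum_squares_bound[of "norm x" "norm ?z"] by simp
      then have "2 * b * \<beta> * (2 * (norm x * norm ?z)) \<le> 2 * b * \<beta> * ((norm x)\<^sup>2 + (norm ?z)\<^sup>2)"
        using b \<beta> by (intro mult_left_mono) auto
      moreover have "c * (norm x)\<^sup>2 = 2 * (?m * (norm D * norm2 C * norm x)\<^sup>2)"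
        by (simp add: c_def power_mult_distrib)
      moreover have "4 * (b * (\<beta> * norm x) * norm ?z) = 2 * b * \<beta> * (2 * (norm x * norm ?z))"
        by simp
      ultimately show ?thesis by linarith
    qed
    also have "\<dots> = x \<bullet> (?N *v x)"
    proof -
      have "x \<bullet> ((transpose (cl K) ** cl K) *v x) = (norm ?z)\<^sup>2"
        using quad_congruence[of x "cl K" "mat 1"] by (simp add: power2_norm_eq_inner)
      then show ?thesis
        by (simp add: matrix_vector_mult_add_rdistrib inner_add_right power2_norm_eq_inner
            algebra_simps flip: scaleR_matrix_vector_assoc)
    qed
    finally show ?thesis .
  qed
  then have "hess ?F K \<le> Sig K \<bullet> ?N"
    unfolding hess_def by (rule Sig_mono[OF K])
  also have "\<dots> \<le> (c + 4 * b * \<beta>) * (mat 1 \<bullet> Sig K)"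
  proof -
    have "2 * b * \<beta> * (Sig K \<bullet> (transpose (cl K) ** cl K)) \<le> 2 * b * \<beta> * (mat 1 \<bullet> Sig K)"
      using b \<beta> by (intro mult_left_mono Sig_cl_le) auto
    then show ?thesis
      by (simp add: inner_add_right inner_commute[of _ "mat 1"] algebra_simps)
  qed
  also have "\<dots> \<le> (c + 4 * b * \<beta>) * (\<alpha> / sigma_min Q)"
  proof (rule mult_left_mono)
    show "mat 1 \<bullet> Sig K \<le> \<alpha> / sigma_min Q"
      using trace_Sig_le[OF K] J_le sigma_Q_pos by (simp add: le_divide_eq mult.commute)
    show "0 \<le> c + 4 * b * \<beta>" using b \<beta> m by (simp add: c_def)
  qed
  also have "\<dots> = L \<alpha> * (norm D)\<^sup>2"
  proof -
    define X where "X = 2 * \<zeta> \<alpha> / (norm2 B * norm2 C)"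
    have "X * (norm2 B)\<^sup>2 * (norm2 C)\<^sup>2 = 2 * \<zeta> \<alpha> * (norm2 B * norm2 C)"
      \<comment> \<open>If \<open>B\<close> or \<open>C\<close> has norm 0, the quotient in
        \<open>X\<close> is 0 by convention, and both sides vanish.\<close>
      by (cases "norm2 B * norm2 C = 0") (auto simp: X_def power2_eq_square)
    moreover have "(norm2 R + \<alpha> / \<mu> * (1 + X) * (norm2 B)\<^sup>2) * (norm2 C)\<^sup>2
        = ?m * (norm2 C)\<^sup>2 + \<alpha> / \<mu> * (X * (norm2 B)\<^sup>2 * (norm2 C)\<^sup>2)"
      by (simp add: algebra_simps add_divide_distrib)
    ultimately have "(norm2 R + \<alpha> / \<mu> * (1 + 2 * \<zeta> \<alpha> / (norm2 B * norm2 C)) * (norm2 B)\<^sup>2) * (norm2 C)\<^sup>2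
        = ?m * (norm2 C)\<^sup>2 + \<alpha> / \<mu> * (2 * \<zeta> \<alpha> * (norm2 B * norm2 C))"
      by (simp only: X_def)
    then have "L \<alpha> = 2 * \<alpha> / sigma_min Q * (?m * (norm2 C)\<^sup>2 + \<alpha> / \<mu> * (2 * \<zeta> \<alpha> * (norm2 B * norm2 C)))"
      unfolding smooth_const_def by (simp only: mult.assoc)
    then show ?thesis
      by (simp add: c_def b_def \<beta>_def power2_eq_square algebra_simps)
  qed
  finally show ?thesis .
qed

end

end

subsection \<open>Gauss-Newton steps\<close>

text \<open>Each row of the product is \<open>transpose C\<close> applied to a row of
  \<open>N\<close>, and Frobenius norms add up over rows.\<close>

lemma sigma_min_mult_le:
  fixes C :: "real^'n^'d" and N :: "real^'d^'m"
  shows "sigma_min C * norm N \<le> norm (N ** C)"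
proof -
  have row: "(N ** C) $ i = transpose C *v (N $ i)" for i
    by (simp add: vec_eq_iff matrix_matrix_mult_def vector_matrix_mult_def)
  have "sigma_min C * norm N = L2_set (\<lambda>i. sigma_min C * norm (N $ i)) UNIV"
    using sigma_min_nonneg[of C] by (simp add: norm_vec_def L2_set_right_distrib)
  also have "\<dots> \<le> L2_set (\<lambda>i. norm ((N ** C) $ i)) UNIV"
    unfolding row using sigma_min_le[of C] sigma_min_nonneg[of C] by (intro L2_set_mono) auto
  finally show ?thesis by (simp add: norm_vec_def)
qed

lemma invertible_if_quad_ge:
  fixes X :: "real^'n^'n"
  assumes "0 < c" "\<And>x. c * (x \<bullet> x) \<le> x \<bullet> (X *v x)"
  shows "invertible X"
proof -
  have "x = 0" if "X *v x = 0" for x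
  proof -
    have "x \<bullet> x \<le> 0" using assms(2)[of x] assms(1) that by (simp add: mult_le_0_iff)
    then have "x \<bullet> x = 0" by (rule antisym) simp
    then show ?thesis by simp
  qed
  then show ?thesis
    by (simp add: invertible_left_inverse matrix_left_invertible_ker)
qed

lemma matrix_inv_cancel:
  fixes X :: "real^'n^'n"
  assumes "invertible X"
  shows "X ** matrix_inv X = mat 1" "matrix_inv X ** X = mat 1"
  using assms someI_ex[of "\<lambda>X'. X ** X' = mat 1 \<and> X' ** X = mat 1"]
  unfolding invertible_def matrix_inv_def by auto

context lqr
begin

text \<open>Taylor expansion of order two with Lagrange remainder. The intermediate point is
  unknown, so the whole segment is required to lie in the sublevel set.\<close>

lemma line_bound:
  assumes T: "0 < T" and S: "\<And>t. 0 \<le> t \<Longrightarrow> t \<le> T \<Longrightarrow> K + t *\<^sub>R D \<in> stab \<and> J (K + t *\<^sub>R D) \<le> \<alpha>"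
  shows "J (K + T *\<^sub>R D) \<le> J K + T * (X0 \<bullet> DP (D ** C) K) + L \<alpha> * (norm D)\<^sup>2 * T\<^sup>2 / 2"
proof -
  define d where "d m t = (if m = 0 then J (K + t *\<^sub>R D) else if m = 1 then X0 \<bullet> DP (D ** C) (K + t *\<^sub>R D)
    else hess (D ** C) (K + t *\<^sub>R D))" for m :: nat and t
  have "\<exists>t>0. t < T \<and> d 0 T = (\<Sum>m<2. d m 0 / fact m * T ^ m) + d 2 t / fact 2 * T ^ 2"
  proof (rule Maclaurin[OF T])
    show "\<forall>m t. m < 2 \<and> 0 \<le> t \<and> t \<le> T \<longrightarrow> DERIV (d m) t :> d (Suc m) t"
    proof (intro allI impI)
      fix m :: nat and t assume mt: "m < 2 \<and> 0 \<le> t \<and> t \<le> T"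
      then have K: "K + t *\<^sub>R D \<in> stab" using S by blast
      have "m = 0 \<or> m = 1" using mt by auto
      then show "DERIV (d m) t :> d (Suc m) t"
        using line_derivatives[OF K] by (auto simp: d_def[abs_def])
    qed
  qed auto
  then obtain t where t: "0 < t" "t < T"
    "d 0 T = (\<Sum>m<2. d m 0 / fact m * T ^ m) + d 2 t / fact 2 * T ^ 2" by blast
  have "hess (D ** C) (K + t *\<^sub>R D) \<le> L \<alpha> * (norm D)\<^sup>2"
    by (rule hess_le) (use S[of t] t in auto)
  then have "hess (D ** C) (K + t *\<^sub>R D) * T\<^sup>2 / 2 \<le> L \<alpha> * (norm D)\<^sup>2 * T\<^sup>2 / 2"
    by (intro divide_right_mono mult_right_mono) auto
  then show ?thesis
    using t(3) by (simp add: d_def numeral_2_eq_2)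
qed

text \<open>The equation defining the Gauss-Newton direction, with both inverses cleared.\<close>
definition gauss_newton :: "real^'d^'m \<Rightarrow> real^'d^'m \<Rightarrow> bool"
  where "gauss_newton K N \<longleftrightarrow>
    M K ** N ** (C ** Sig K ** transpose C) = 2 *\<^sub>R (E K ** Sig K ** transpose C)"

lemma M_congruence_sym: "K \<in> stab \<Longrightarrow> transpose (transpose F ** M K ** F) = transpose F ** M K ** F"
  by (simp add: matrix_simps M_sym matrix_mul_assoc)

lemma Sig_congruence_ge:
  assumes "K \<in> stab" "K' \<in> stab"
  shows "\<mu> * (mat 1 \<bullet> (transpose F ** M K ** F)) \<le> Sig K' \<bullet> (transpose F ** M K ** F)"
  by (rule psd_inner_ge_trace[OF M_congruence_sym[OF assms(1)] psd_congruence[OF M_psd[OF assms(1)]]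
        Sig_ge[OF assms(2)]])

lemma trace_M_congruence_ge:
  assumes K: "K \<in> stab"
  shows "sigma_min R * (norm F)\<^sup>2 \<le> mat 1 \<bullet> (transpose F ** M K ** F)"
proof -
  have "sigma_min R * (norm F)\<^sup>2 = (sigma_min R *\<^sub>R (transpose F ** mat 1 ** F)) \<bullet> mat 1"
    by (simp add: trace_gram inner_commute[of _ "mat 1"])
  also have "\<dots> \<le> (transpose F ** M K ** F) \<bullet> mat 1"
  proof (rule psd_inner_mono)
    fix x
    show "x \<bullet> ((sigma_min R *\<^sub>R (transpose F ** mat 1 ** F)) *v x) \<le> x \<bullet> ((transpose F ** M K ** F) *v x)"
      unfolding scaleR_matrix_vector_assoc[symmetric] inner_scaleR_right quad_congruence
      using M_ge[OF K, of "F *v x"] by simp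
  qed (simp_all add: psd_def)
  finally show ?thesis by (simp add: inner_commute)
qed

text \<open>With the inverses cleared, pairing the gradient with \<open>N\<close> becomes
  \<open>Sig K \<bullet> (transpose F ** M K ** F)\<close> for \<open>F = N ** C\<close>. The three
  factors of the bound come from \<open>Sig K\<close>, \<open>M K\<close> and
  \<open>C\<close>.\<close>

lemma gauss_newton_slope:
  assumes K: "K \<in> stab" and N: "gauss_newton K N"
  shows "\<mu> * sigma_min R * (sigma_min C)\<^sup>2 * (norm N)\<^sup>2 \<le> Sig K \<bullet> Y1 K (N ** C)"
proof -
  let ?F = "N ** C"
  have "Sig K \<bullet> Y1 K ?F = (M K ** N ** (C ** Sig K ** transpose C)) \<bullet> N"
    using N by (simp add: Sig_Y1_inner[OF K] gauss_newton_def inner_commute)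
  also have "M K ** N ** (C ** Sig K ** transpose C) = M K ** ?F ** Sig K ** transpose C"
    by (simp add: matrix_mul_assoc)
  also have "(M K ** ?F ** Sig K ** transpose C) \<bullet> N = (M K ** ?F) \<bullet> (?F ** Sig K)"
    by (simp add: inner_matrix_mult_right Sig_sym[OF K])
  also have "\<dots> = (transpose ?F ** (M K ** ?F)) \<bullet> Sig K"
    by (simp only: inner_matrix_mult_left[of "transpose ?F"] transpose_transpose)
  finally have eq: "Sig K \<bullet> Y1 K ?F = Sig K \<bullet> (transpose ?F ** M K ** ?F)"
    by (simp only: matrix_mul_assoc inner_commute[of "Sig K"])
  have "(sigma_min C)\<^sup>2 * (norm N)\<^sup>2 \<le> (norm ?F)\<^sup>2"
    using power_mono[OF sigma_min_mult_le[of C N], of 2] sigma_min_nonneg[of C]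
    by (simp add: power_mult_distrib)
  then have "sigma_min R * ((sigma_min C)\<^sup>2 * (norm N)\<^sup>2) \<le> sigma_min R * (norm ?F)\<^sup>2"
    using sigma_R_pos by (intro mult_left_mono) auto
  then have "\<mu> * (sigma_min R * ((sigma_min C)\<^sup>2 * (norm N)\<^sup>2)) \<le> \<mu> * (mat 1 \<bullet> (transpose ?F ** M K ** ?F))"
    using trace_M_congruence_ge[OF K, of ?F] mu_pos by (intro mult_left_mono) auto
  then show ?thesis
    using Sig_congruence_ge[OF K K, of ?F] eq by (simp add: mult.assoc)
qed

text \<open>Descent holds on the part of the segment inside the sublevel set, so the segment cannot
  leave it.\<close>
lemma gauss_newton_descent:
  assumes K: "K \<in> stab" "J K \<le> \<alpha>" and N: "gauss_newton K N"
    and \<eta>: "0 < \<eta>" "\<eta> * L \<alpha> \<le> \<mu> * sigma_min R * (sigma_min C)\<^sup>2"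
    and C: "0 < sigma_min C"
  shows "K - \<eta> *\<^sub>R N \<in> stab"
    and "J (K - \<eta> *\<^sub>R N) \<le> J K - \<eta> * (\<mu> * sigma_min R * (sigma_min C)\<^sup>2) / 2 * (norm N)\<^sup>2"
proof -
  define s where "s = \<mu> * sigma_min R * (sigma_min C)\<^sup>2"
  define D where "D = - \<eta> *\<^sub>R N"
  define S where "S t \<longleftrightarrow> K + t *\<^sub>R D \<in> stab \<and> J (K + t *\<^sub>R D) \<le> \<alpha>" for t
  have "0 < s" using mu_pos sigma_R_pos C by (simp add: s_def)
  have slope: "X0 \<bullet> DP (D ** C) K \<le> - \<eta> * s * (norm N)\<^sup>2"
  proof -
    have "Y1 K (D ** C) = - \<eta> *\<^sub>R Y1 K (N ** C)"
      by (simp add: Y1_def D_def matrix_simps scaleR_add_right)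
    then have "X0 \<bullet> DP (D ** C) K = - \<eta> * (Sig K \<bullet> Y1 K (N ** C))"
      by (simp add: X0_DP[OF K(1)])
    moreover have "\<eta> * (s * (norm N)\<^sup>2) \<le> \<eta> * (Sig K \<bullet> Y1 K (N ** C))"
      using gauss_newton_slope[OF K(1) N] \<eta>(1) unfolding s_def by (intro mult_left_mono) auto
    ultimately show ?thesis by simp
  qed
  \<comment> \<open>The step size makes the quadratic remainder at most half of the linear gain;
    \<open>T \<le> 1\<close> is used to replace the square of \<open>T\<close> by
    \<open>T\<close>.\<close>
  have bound: "J (K + T *\<^sub>R D) \<le> J K - T * (\<eta> * s / 2 * (norm N)\<^sup>2)"
    if T: "0 < T" "T \<le> 1" and ST: "\<And>t. 0 \<le> t \<Longrightarrow> t \<le> T \<Longrightarrow> S t" for T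
  proof -
    have "J (K + T *\<^sub>R D) \<le> J K + T * (X0 \<bullet> DP (D ** C) K) + L \<alpha> * (norm D)\<^sup>2 * T\<^sup>2 / 2"
      by (rule line_bound[OF T(1)]) (use ST in \<open>auto simp: S_def\<close>)
    also have "\<dots> \<le> J K + T * (- \<eta> * s * (norm N)\<^sup>2) + \<eta> * s * (norm N)\<^sup>2 * T / 2"
    proof (intro add_mono mult_left_mono divide_right_mono order_refl slope)
      have "L \<alpha> * (norm D)\<^sup>2 * T\<^sup>2 = (\<eta> * L \<alpha>) * (\<eta> * (norm N)\<^sup>2 * T\<^sup>2)"
        by (simp add: D_def power2_eq_square)
      also have "\<dots> \<le> s * (\<eta> * (norm N)\<^sup>2 * T\<^sup>2)"
        using \<eta> by (intro mult_right_mono) (auto simp: s_def)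
      also have "\<dots> \<le> s * (\<eta> * (norm N)\<^sup>2 * T)"
        using \<open>0 < s\<close> \<eta> T by (intro mult_left_mono) (auto simp: power2_eq_square mult_left_le)
      finally show "L \<alpha> * (norm D)\<^sup>2 * T\<^sup>2 \<le> \<eta> * s * (norm N)\<^sup>2 * T" by (simp add: mult_ac)
    qed (use T in auto)
    finally show ?thesis by (simp add: algebra_simps)
  qed
  have S0: "S 0" using K by (simp add: S_def)
  have "S t" if t: "0 \<le> t" "t \<le> 1" for t
  proof (cases "N = 0")
    case True
    then show ?thesis using K by (simp add: S_def D_def)
  next
    case False
    show ?thesis
    proof (rule ccontr)
      assume "\<not> S t"
      \<comment> \<open>\<open>Z\<close> holds the times at which the segment is outside the
        sublevel set; its infimum \<open>z\<close> still satisfies \<open>S\<close>, so leaving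
        would have to happen immediately after \<open>z\<close>.\<close>
      define Z where "Z = {t. 0 \<le> t \<and> t \<le> 1 \<and> \<not> S t}"
      define z where "z = Inf Z"
      have Z: "Z \<noteq> {}" "bdd_below Z"
        using t \<open>\<not> S t\<close> by (auto simp: Z_def intro: bdd_belowI[of _ 0])
      have z0: "0 \<le> z" unfolding z_def using Z by (intro cInf_greatest) (auto simp: Z_def)
      have z_le: "z \<le> u" if "u \<in> Z" for u unfolding z_def using that Z by (intro cInf_lower)
      have z1: "z \<le> 1" using z_le Z(1) by (force simp: Z_def)
      have below: "S u" if "0 \<le> u" "u < z" for u
        using that z_le[of u] z1 by (auto simp: Z_def)
      have Sz: "S z"
      proof (cases "z = 0")
        case False
        then have zpos: "0 < z" using z0 by simp
        \<comment> \<open>These times start at 0 and stay strictly below \<open>z\<close>, so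
          closedness of the sublevel set applies.\<close>
        define u where "u n = z - z / real (Suc n)" for n
        have u: "0 \<le> u n" "u n < z" for n
          using zpos by (auto simp: u_def field_simps)
        have "(\<lambda>n. z - z / real (Suc n)) \<longlonglongrightarrow> z - 0"
          by (intro tendsto_diff tendsto_const lim_const_over_n[THEN LIMSEQ_Suc])
        then have "(\<lambda>n. K + u n *\<^sub>R D) \<longlonglongrightarrow> K + z *\<^sub>R D"
          by (intro tendsto_intros) (simp add: u_def)
        then show ?thesis
          using sublevel_closed[of "\<lambda>n. K + u n *\<^sub>R D" \<alpha>] below[OF u] unfolding S_def by blast
      qed (use S0 in simp)
      then have zstab: "K + z *\<^sub>R D \<in> stab" by (simp add: S_def)
      have S_le: "S u" if "0 \<le> u" "u \<le> z" for u
        using that Sz below by (cases "u = z") auto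
      have "((\<lambda>t. K + t *\<^sub>R D) \<longlongrightarrow> K + z *\<^sub>R D) (nhds z)"
        by (intro tendsto_add tendsto_scaleR tendsto_const filterlim_ident)
      then have ev_stab: "\<forall>\<^sub>F u in nhds z. K + u *\<^sub>R D \<in> stab"
        using eventually_stab[OF zstab] by (auto simp: filterlim_iff)
      then obtain e1 where e1: "0 < e1" "\<And>u. dist u z < e1 \<Longrightarrow> K + u *\<^sub>R D \<in> stab"
        unfolding eventually_nhds_metric by blast
      note der = line_derivatives(1)[OF zstab]
      \<comment> \<open>At \<open>z = 0\<close> the cost may equal \<alpha>, and the strictly
        negative slope keeps it from rising. For \<open>z > 0\<close> descent has already pushed it
        strictly below \<alpha>, and continuity suffices.\<close>
      obtain e2 where e2: "0 < e2" "\<And>u. z < u \<Longrightarrow> u < z + e2 \<Longrightarrow> J (K + u *\<^sub>R D) \<le> \<alpha>"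
      proof (cases "z = 0")
        case True
        have "0 < \<eta> * s * (norm N)\<^sup>2" using False \<open>0 < s\<close> \<eta>(1) by simp
        then have "X0 \<bullet> DP (D ** C) K < 0" using slope by linarith
        then obtain d where d: "0 < d" "\<And>h. 0 < h \<Longrightarrow> h < d \<Longrightarrow> J (K + (z + h) *\<^sub>R D) < J (K + z *\<^sub>R D)"
          using DERIV_neg_dec_right[OF der] True by auto
        have "J (K + u *\<^sub>R D) \<le> \<alpha>" if "z < u" "u < z + d" for u
          using d(2)[of "u - z"] that K(2) True by auto
        then show ?thesis using that d(1) by blast
      next
        case False
        have "0 < z * (\<eta> * s / 2 * (norm N)\<^sup>2)"
          using False z0 \<open>N \<noteq> 0\<close> \<open>0 < s\<close> \<eta>(1) by simp
        then have "J (K + z *\<^sub>R D) < \<alpha>"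
          using bound[of z] False z0 z1 S_le K(2) by force
        moreover have "isCont (\<lambda>u. J (K + u *\<^sub>R D)) z"
          using der by (rule DERIV_isCont)
        ultimately have "\<forall>\<^sub>F u in at z. J (K + u *\<^sub>R D) < \<alpha>"
          unfolding isCont_def by (rule order_tendstoD(2)[rotated])
        then obtain d where "0 < d" "\<And>u. u \<noteq> z \<Longrightarrow> dist u z < d \<Longrightarrow> J (K + u *\<^sub>R D) < \<alpha>"
          unfolding eventually_at by blast
        then show ?thesis using that[of d] by (force simp: dist_real_def intro: less_imp_le)
      qed
      have "z + min e1 e2 \<le> u" if u: "u \<in> Z" for u
      proof (rule ccontr)
        assume "\<not> z + min e1 e2 \<le> u"
        then have "S u"
          using e1(2)[of u] e2(2)[of u] z_le[OF u] Sz
          by (cases "u = z") (auto simp: S_def dist_real_def)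
        then show False using u by (simp add: Z_def)
      qed
      then have "z + min e1 e2 \<le> z"
        unfolding z_def using Z by (intro cInf_greatest) auto
      then show False using e1(1) e2(1) by simp
    qed
  qed
  then have "S 1" and "J (K + 1 *\<^sub>R D) \<le> J K - 1 * (\<eta> * s / 2 * (norm N)\<^sup>2)"
    using bound[of 1] by auto
  then show "K - \<eta> *\<^sub>R N \<in> stab"
    and "J (K - \<eta> *\<^sub>R N) \<le> J K - \<eta> * (\<mu> * sigma_min R * (sigma_min C)\<^sup>2) / 2 * (norm N)\<^sup>2"
    by (simp_all add: S_def D_def s_def)
qed

section \<open>Linear rate for a left-invertible output matrix\<close>

lemma mu_le_norm2_Sig:
  assumes "K \<in> stab"
  shows "\<mu> \<le> norm2 (Sig K)"
proof -
  let ?x = "axis undefined 1 :: real^'n"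
  have "\<mu> * (?x \<bullet> ?x) \<le> ?x \<bullet> (Sig K *v ?x)" by (rule Sig_ge[OF assms])
  also have "\<dots> \<le> norm ?x * (norm2 (Sig K) * norm ?x)"
    by (intro order_trans[OF norm_cauchy_schwarz] mult_left_mono norm2_bound) auto
  finally show ?thesis by (simp add: inner_axis_axis norm_axis_1)
qed

text \<open>Both the decrease of one step and the gap to \<open>Ks\<close> are compared with the
  same trace \<open>T\<close>: the decrease is at least \<open>\<eta> * \<mu> * T / 2\<close>, the
  gap at most \<open>s * T / 4\<close>. Their ratio is the rate.\<close>

lemma gauss_newton_contraction:
  assumes K: "K \<in> stab" and N: "gauss_newton K N" and K': "K' \<in> stab" "K' = K - \<eta> *\<^sub>R N"
    and Ks: "Ks \<in> stab" and \<eta>: "0 < \<eta>" "\<eta> \<le> 1 / 2" and Cl: "Cl ** C = mat 1"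
    and opt: "J Ks \<le> J K"
  shows "J K' - J Ks \<le> (1 - 2 * \<eta> * \<mu> / norm2 (Sig Ks)) * (J K - J Ks)"
proof -
  define F where "F = N ** C"
  define H where "H = transpose F ** M K ** F"
  define T where "T = mat 1 \<bullet> H"
  define s where "s = norm2 (Sig Ks)"
  have CC: "mat 1 = transpose C ** transpose Cl"
    using arg_cong[OF Cl, of transpose] by (simp add: matrix_transpose_mul)
  \<comment> \<open>The left inverse removes \<open>transpose C\<close> on the right, and
    invertibility of \<open>Sig K\<close> then gives \<open>M K ** F = 2 *\<^sub>R E K\<close>:
    \<open>F\<close> is twice the minimizer of the quadratic model in the gain.\<close>
  have "(M K ** F - 2 *\<^sub>R E K) ** Sig K = (M K ** N ** (C ** Sig K ** transpose C)
      - 2 *\<^sub>R (E K ** Sig K ** transpose C)) ** transpose Cl"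
    by (simp add: matrix_mult.diff_left matrix_mult.scaleR_left F_def)
      (simp only: matrix_mul_assoc[symmetric] CC[symmetric] matrix_mul_rid)
  then have Z: "(M K ** F - 2 *\<^sub>R E K) ** Sig K = 0"
    using N by (simp add: gauss_newton_def)
  have inv: "invertible (Sig K)"
    by (rule invertible_if_quad_ge[OF mu_pos Sig_ge[OF K]])
  have "M K ** F - 2 *\<^sub>R E K = (M K ** F - 2 *\<^sub>R E K) ** Sig K ** matrix_inv (Sig K)"
    by (simp add: matrix_inv_cancel(1)[OF inv] flip: matrix_mul_assoc)
  then have "M K ** F = 2 *\<^sub>R E K"
    unfolding Z by simp
  then have E: "E K = (1 / 2) *\<^sub>R (M K ** F)" by simp
  have Y1: "Y1 K G = (1 / 2) *\<^sub>R (transpose G ** M K ** F + transpose F ** M K ** G)" for G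
    by (simp add: Y1_def E matrix_simps M_sym[OF K] matrix_mul_assoc scaleR_add_right)
  have psd_H: "psd H" and sym_H: "transpose H = H"
    unfolding H_def by (rule psd_congruence[OF M_psd[OF K]]) (rule M_congruence_sym[OF K])
  have T: "0 \<le> T"
    unfolding T_def by (rule psd_inner_nonneg[OF sym_H psd_H]) (simp add: psd_def)
  have Sig_le: "x \<bullet> (Sig Ks *v x) \<le> s * (x \<bullet> x)" for x
  proof -
    have "x \<bullet> (Sig Ks *v x) \<le> norm x * (s * norm x)"
      unfolding s_def by (intro order_trans[OF norm_cauchy_schwarz] mult_left_mono norm2_bound) auto
    then show ?thesis by (simp add: power2_norm_eq_inner[symmetric] power2_eq_square mult_ac)
  qed
  have s: "\<mu> \<le> s"
    unfolding s_def by (rule mu_le_norm2_Sig[OF Ks])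
  have "J K' - J K = Sig K' \<bullet> (- (\<eta> * (1 - \<eta>)) *\<^sub>R H)"
  proof -
    have "(K' - K) ** C = - \<eta> *\<^sub>R F"
      by (simp add: K'(2) F_def matrix_simps)
    then have "J K' - J K = Sig K' \<bullet> (Y1 K (- \<eta> *\<^sub>R F) + transpose (- \<eta> *\<^sub>R F) ** M K ** (- \<eta> *\<^sub>R F))"
      using cost_diff[OF K K'(1), of "- \<eta> *\<^sub>R F"] by simp
    \<comment> \<open>The linear part contributes \<open>- \<eta>\<close> and the quadratic part its
      square, so for \<open>\<eta> \<le> 1 / 2\<close> at least half of the linear gain
      remains.\<close>
    also have "Y1 K (- \<eta> *\<^sub>R F) + transpose (- \<eta> *\<^sub>R F) ** M K ** (- \<eta> *\<^sub>R F) = - (\<eta> * (1 - \<eta>)) *\<^sub>R H"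
    proof -
      have "Y1 K F = H"
        by (simp add: Y1 H_def flip: scaleR_2)
      moreover have "Y1 K (- \<eta> *\<^sub>R F) = - \<eta> *\<^sub>R Y1 K F"
        by (simp add: Y1_def matrix_simps scaleR_add_right)
      ultimately show ?thesis
        by (simp add: H_def matrix_simps algebra_simps)
    qed
    finally show ?thesis .
  qed
  then have "J K' - J K = - (\<eta> * (1 - \<eta>) * (Sig K' \<bullet> H))" by simp
  moreover have "\<eta> / 2 * (\<mu> * T) \<le> \<eta> * (1 - \<eta>) * (Sig K' \<bullet> H)"
  proof (rule mult_mono)
    show "\<mu> * T \<le> Sig K' \<bullet> H"
      unfolding T_def H_def by (rule Sig_congruence_ge[OF K K'(1)])
    show "\<eta> / 2 \<le> \<eta> * (1 - \<eta>)"
      using mult_left_mono[of "1 / 2" "1 - \<eta>" \<eta>] \<eta> by simp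
  qed (use \<eta> T mu_pos in auto)
  ultimately have step: "J K' \<le> J K - \<eta> / 2 * (\<mu> * T)" by linarith
  have "J K - J Ks \<le> s / 4 * T"
  proof -
    define G where "G = (Ks - K) ** C"
    have "0 \<le> Sig Ks \<bullet> ((Y1 K G + transpose G ** M K ** G) + (1 / 4) *\<^sub>R H)"
    proof -
      \<comment> \<open>Completing the square: the model in \<open>G\<close> is minimal at
        \<open>- F / 2\<close>, with value \<open>- H / 4\<close>. The gap is bounded without
        knowing \<open>G\<close>.\<close>
      have "(Y1 K G + transpose G ** M K ** G) + (1 / 4) *\<^sub>R H
          = transpose (G + (1 / 2) *\<^sub>R F) ** M K ** (G + (1 / 2) *\<^sub>R F)"
        by (simp add: Y1 H_def matrix_simps scaleR_add_right)
      then show ?thesis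
        using psd_inner_nonneg[OF M_congruence_sym[OF K] psd_congruence[OF M_psd[OF K]] Sig_psd[OF Ks]]
        by simp
    qed
    also have "\<dots> = J Ks - J K + (1 / 4) * (Sig Ks \<bullet> H)"
      using cost_diff[OF K Ks G_def] by (simp add: inner_add_right)
    finally have "J K - J Ks \<le> (1 / 4) * (Sig Ks \<bullet> H)" by simp
    moreover have "Sig Ks \<bullet> H \<le> s * T"
      unfolding T_def by (rule psd_inner_le_trace[OF sym_H psd_H Sig_le])
    ultimately show ?thesis by simp
  qed
  then have "2 * \<eta> * \<mu> / s * (J K - J Ks) \<le> 2 * \<eta> * \<mu> / s * (s / 4 * T)"
    using \<eta> s mu_pos by (intro mult_left_mono) auto
  also have "\<dots> = \<eta> / 2 * (\<mu> * T)" using s mu_pos by simp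
  finally have rate: "2 * \<eta> * \<mu> / s * (J K - J Ks) \<le> \<eta> / 2 * (\<mu> * T)" .
  define X where "X = 2 * \<eta> * \<mu> / s * (J K - J Ks)"
  have "J K' \<le> J K - X"
    unfolding X_def by (rule order_trans[OF step diff_left_mono[OF rate]])
  then have "J K' - J Ks \<le> 1 * (J K - J Ks) - X" by simp
  then show ?thesis unfolding s_def[symmetric] left_diff_distrib X_def .
qed

end

subsection \<open>Averaging over the initial state\<close>

context
  fixes D :: "(real^'n) measure"
  assumes int: "integrable D (\<lambda>x. outer x x)"
begin

text \<open>For each initial state the series is linear in \<open>outer x x\<close>, so the integral
  sees the distribution only through its second moment.\<close>

lemma quad_cost_integral:
  assumes "spec_radius N < 1"
  shows "(LINT x|D. (\<Sum>t. trajectory N x t \<bullet> (V *v trajectory N x t))) = second_moment D \<bullet> lyap N V"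
proof -
  have "(\<Sum>t. trajectory N x t \<bullet> (V *v trajectory N x t)) = lyap N V \<bullet> outer x x" for x
    using sums_unique[OF lyap_quad_sums[OF assms, of x V]] by (simp add: inner_outer)
  then show ?thesis
    using integral_inner_right[of "lyap N V" D "\<lambda>x. outer x x"] int
    by (simp add: second_moment_def inner_commute)
qed

lemma covariance_integral:
  assumes "spec_radius N < 1"
  shows "(LINT x|D. (\<Sum>t. outer (trajectory N x t) (trajectory N x t)))
    = lyap (transpose N) (second_moment D)"
proof -
  have "(\<Sum>t. outer (trajectory N x t) (trajectory N x t)) = lyap (transpose N) (outer x x)" for x
    using sums_unique[OF lyap_outer_sums[OF assms, of x]] by simp
  then show ?thesis
    using integral_bounded_linear[OF bounded_linear_lyap[OF spec_radius_transpose[OF assms]] int]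
    by (simp add: second_moment_def)
qed

end

locale lqr_dist = lqr A B C Q R "second_moment D" \<mu>
  for A :: "real^'n^'n" and B :: "real^'m^'n" and C :: "real^'n^'d"
    and Q :: "real^'n^'n" and R :: "real^'m^'m" and D :: "(real^'n) measure" and \<mu> :: real +
  assumes int: "integrable D (\<lambda>x. outer x x)" and rows: "lin_indep_rows C"
begin

lemma sof_cost_eq: "K \<in> stab \<Longrightarrow> sof_cost A B C Q R D K = J K"
  by (simp add: sof_cost_def Let_def J_def P_def stab_iff quad_cost_integral[OF int])

lemma Sigma_mat_eq: "K \<in> stab \<Longrightarrow> Sigma_mat A B C D K = Sig K"
  by (simp add: Sigma_mat_def Let_def Sig_def stab_iff covariance_integral[OF int])

lemma P_mat_eq:
  assumes "K \<in> stab"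
  shows "P_mat A B C Q R K = P K"
  unfolding P_mat_def
proof (rule the_equality)
  show "P K = W K + transpose (cl K) ** P K ** cl K" by (rule P_eq[OF assms])
  show "X = P K" if "X = W K + transpose (cl K) ** X ** cl K" for X
    unfolding P_def by (rule lyap_unique[OF _ that]) (use assms in \<open>simp add: stab_iff\<close>)
qed

text \<open>\<open>sof_cost\<close> agrees with \<open>J\<close> only on stabilizing gains; openness
  of that set makes this enough for the derivative.\<close>

lemma grad_cost_eq:
  assumes K: "K \<in> stab"
  shows "grad_cost A B C Q R D K = 2 *\<^sub>R (E K ** Sig K ** transpose C)" (is "_ = ?G")
proof -
  have "\<forall>\<^sub>F K' in at K. J K' = sof_cost A B C Q R D K'"
    using eventually_stab[OF K] unfolding eventually_nhds_conv_at
    by (auto elim: eventually_mono simp: sof_cost_eq)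
  then have G: "GDERIV (sof_cost A B C Q R D) K :> ?G"
    using GDERIV_J[OF K] sof_cost_eq[OF K] unfolding gderiv_def
    by (auto intro: has_derivative_transform_eventually)
  show ?thesis
    unfolding grad_cost_def
  proof (rule the_equality)
    show "GDERIV (sof_cost A B C Q R D) K :> ?G" by (rule G)
  next
    fix G' assume G': "GDERIV (sof_cost A B C Q R D) K :> G'"
    have "(\<lambda>h. h \<bullet> G') = (\<lambda>h. h \<bullet> ?G)"
      by (rule has_derivative_unique[OF G'[unfolded gderiv_def] G[unfolded gderiv_def]])
    then have "h \<bullet> G' = h \<bullet> ?G" for h by (rule fun_cong)
    then show "G' = ?G" using vector_eq_ldot[of G' ?G] by blast
  qed
qed

lemma sigma_C_pos: "0 < sigma_min C"
  by (rule sigma_min_lin_indep_rows_pos[OF rows])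

text \<open>\<open>M K\<close> is bounded below by \<open>sigma_min R\<close>, and
  \<open>C ** Sig K ** transpose C\<close> by \<mu> times the square of \<open>sigma_min C\<close>,
  so both inverses are genuine.\<close>

lemma gn_grad:
  assumes K: "K \<in> stab"
  shows "gauss_newton K (gn_grad A B C Q R D K)"
proof -
  have invM: "invertible (M K)"
    by (rule invertible_if_quad_ge[OF sigma_R_pos M_ge[OF K]])
  have "\<mu> * (sigma_min C)\<^sup>2 * (x \<bullet> x) \<le> x \<bullet> ((C ** Sig K ** transpose C) *v x)" for x
  proof -
    have "(sigma_min C * norm x)\<^sup>2 \<le> (norm (transpose C *v x))\<^sup>2"
      using sigma_min_le[of C x] sigma_C_pos by (intro power_mono) auto
    then have "\<mu> * ((sigma_min C)\<^sup>2 * (x \<bullet> x)) \<le> \<mu> * ((transpose C *v x) \<bullet> (transpose C *v x))"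
      using mu_pos by (intro mult_left_mono) (auto simp: power2_norm_eq_inner power_mult_distrib)
    also have "\<dots> \<le> (transpose C *v x) \<bullet> (Sig K *v (transpose C *v x))"
      by (rule Sig_ge[OF K])
    also have "\<dots> = x \<bullet> ((C ** Sig K ** transpose C) *v x)"
      using quad_congruence[of x "transpose C" "Sig K"] by (simp only: transpose_transpose)
    finally show ?thesis by (simp add: mult.assoc)
  qed
  moreover have "0 < \<mu> * (sigma_min C)\<^sup>2" using mu_pos sigma_C_pos by simp
  ultimately have invL: "invertible (C ** Sig K ** transpose C)"
    using invertible_if_quad_ge by blast
  let ?L = "C ** Sig K ** transpose C" and ?G = "2 *\<^sub>R (E K ** Sig K ** transpose C)"
  have "gn_grad A B C Q R D K = matrix_inv (M K) ** ?G ** matrix_inv ?L"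
    by (simp only: gn_grad_def L_mat_def P_mat_eq[OF K] Sigma_mat_eq[OF K] grad_cost_eq[OF K] M_def)
  then have "M K ** gn_grad A B C Q R D K ** ?L
      = (M K ** matrix_inv (M K)) ** ?G ** (matrix_inv ?L ** ?L)"
    by (simp only: matrix_mul_assoc)
  then show ?thesis
    unfolding gauss_newton_def matrix_inv_cancel(1)[OF invM] matrix_inv_cancel(2)[OF invL]
    by (simp only: matrix_mul_lid matrix_mul_rid)
qed

lemma state_cost_gain:
  shows "state_cost A B Q R D (K ** C) = sof_cost A B C Q R D K"
    and "A - B ** (K ** C) = cl K"
proof -
  show cl: "A - B ** (K ** C) = cl K"
    by (simp add: closed_loop_def matrix_mul_assoc)
  have "x \<bullet> (W K *v x) = x \<bullet> (Q *v x) + (- (K ** C *v x)) \<bullet> (R *v (- (K ** C *v x)))" for x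
    using matrix_vector_mult_scaleR[of R "-1" "K ** C *v x"] by (simp add: W_quad)
  then show "state_cost A B Q R D (K ** C) = sof_cost A B C Q R D K"
    by (simp only: state_cost_def sof_cost_def Let_def cl)
qed

text \<open>Every state gain factors as \<open>Ks' = (Ks' ** Cl) ** C\<close>, so the full-state
  problem ranges over the same closed loops and its minimum is attained by the minimizer
  \<open>Ks\<close>.\<close>

lemma opt_state_cost_eq:
  assumes Cl: "Cl ** C = mat 1" and Ks: "Ks \<in> stab" and min: "\<And>K. K \<in> stab \<Longrightarrow> J Ks \<le> J K"
  shows "opt_state_cost A B Q R D = J Ks"
  unfolding opt_state_cost_def
proof (rule Least_equality)
  show "\<exists>Ks'. spec_radius (A - B ** Ks') < 1 \<and> J Ks = state_cost A B Q R D Ks'"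
    using Ks by (intro exI[of _ "Ks ** C"]) (simp add: state_cost_gain stab_iff sof_cost_eq)
  fix c assume "\<exists>Ks'. spec_radius (A - B ** Ks') < 1 \<and> c = state_cost A B Q R D Ks'"
  then obtain Ks' where Ks': "spec_radius (A - B ** Ks') < 1" "c = state_cost A B Q R D Ks'"
    by blast
  have "Ks' = Ks' ** Cl ** C"
    using Cl by (simp flip: matrix_mul_assoc)
  then have "Ks' ** Cl \<in> stab" "c = J (Ks' ** Cl)"
    using Ks' state_cost_gain[of "Ks' ** Cl"] by (auto simp: stab_iff sof_cost_eq)
  then show "J Ks \<le> c" using min by simp
qed

section \<open>The iterates of the method\<close>

context
  fixes K :: "nat \<Rightarrow> real^'d^'m" and \<eta> \<alpha> :: real
  assumes K0: "K 0 \<in> stab" "J (K 0) = \<alpha>" and \<eta>_pos: "0 < \<eta>"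
    and \<eta>_le: "\<eta> \<le> \<mu> * sigma_min R * (sigma_min C)\<^sup>2 / L \<alpha>"
    and step: "\<And>i. K (Suc i) = K i - \<eta> *\<^sub>R gn_grad A B C Q R D (K i)"
begin

abbreviation "s \<equiv> \<mu> * sigma_min R * (sigma_min C)\<^sup>2"

lemma s_pos: "0 < s"
  using mu_pos sigma_R_pos sigma_C_pos by simp

text \<open>Otherwise the upper bound on the step size would be at most 0, division by zero
  included, against \<open>0 < \<eta>\<close>.\<close>

lemma L_pos: "0 < L \<alpha>"
  using \<eta>_pos \<eta>_le s_pos
  by (smt (verit) divide_nonneg_neg divide_eq_0_iff zero_less_divide_iff)

lemma step_bound: "\<eta> * L \<alpha> \<le> s"
  using \<eta>_le L_pos by (simp add: le_divide_eq)

lemma iterates: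
  shows "K i \<in> stab" and "J (K i) \<le> \<alpha>"
    and "J (K (Suc i)) \<le> J (K i) - \<eta> * s / 2 * (norm (gn_grad A B C Q R D (K i)))\<^sup>2"
proof -
  have desc: "K (Suc i) \<in> stab
      \<and> J (K (Suc i)) \<le> J (K i) - \<eta> * s / 2 * (norm (gn_grad A B C Q R D (K i)))\<^sup>2"
    if "K i \<in> stab" "J (K i) \<le> \<alpha>" for i
    using gauss_newton_descent[OF that gn_grad[OF that(1)] \<eta>_pos step_bound sigma_C_pos]
    by (simp add: step)
  have "K i \<in> stab \<and> J (K i) \<le> \<alpha>" for i
  proof (induction i)
    case (Suc i)
    have "0 \<le> \<eta> * s / 2 * (norm (gn_grad A B C Q R D (K i)))\<^sup>2"
      using s_pos \<eta>_pos by simp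
    then show ?case using desc[of i] Suc by linarith
  qed (use K0 in simp)
  then show "K i \<in> stab" "J (K i) \<le> \<alpha>"
    "J (K (Suc i)) \<le> J (K i) - \<eta> * s / 2 * (norm (gn_grad A B C Q R D (K i)))\<^sup>2"
    using desc by auto
qed

lemma J_decreasing: "J (K (Suc i)) \<le> J (K i)"
proof -
  have "0 \<le> \<eta> * s / 2 * (norm (gn_grad A B C Q R D (K i)))\<^sup>2"
    using s_pos \<eta>_pos by simp
  then show ?thesis using iterates(3)[of i] by linarith
qed

lemma stationary_iterate:
  assumes \<epsilon>: "0 < \<epsilon>"
  shows "\<exists>i. real i \<le> 2 * \<alpha> / (\<eta> * s * \<epsilon>\<^sup>2) \<and> norm (gn_grad A B C Q R D (K i)) \<le> \<epsilon>"
proof (rule ccontr)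
  let ?b = "2 * \<alpha> / (\<eta> * s * \<epsilon>\<^sup>2)"
  assume contra: "\<not> ?thesis"
  \<comment> \<open>The indices allowed are 0 to \<open>n\<close>, which makes \<open>n + 1\<close>
    steps. As \<open>n + 1\<close> strictly exceeds the bound, these steps would bring the cost
    below 0.\<close>
  define n where "n = nat \<lfloor>?b\<rfloor>"
  have "0 < \<alpha>" using J_pos[OF K0(1)] K0(2) by simp
  then have b: "0 \<le> ?b" using s_pos \<eta>_pos \<epsilon> by simp
  have "real n = real_of_int \<lfloor>?b\<rfloor>" using b by (simp add: n_def)
  then have n: "real n \<le> ?b" "?b < real (Suc n)"
    using of_int_floor_le[of ?b] real_of_int_floor_add_one_gt[of ?b] unfolding of_nat_Suc by linarith+
  have "J (K j) \<le> \<alpha> - real j * (\<eta> * s / 2 * \<epsilon>\<^sup>2)" if "j \<le> Suc n" for j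
    using that
  proof (induction j)
    case (Suc j)
    have "real j \<le> ?b" using Suc.prems n(1) by linarith
    then have "\<epsilon> < norm (gn_grad A B C Q R D (K j))"
      using contra by force
    then have "\<epsilon>\<^sup>2 \<le> (norm (gn_grad A B C Q R D (K j)))\<^sup>2"
      using \<epsilon> by (intro power_mono) auto
    then have "\<eta> * s / 2 * \<epsilon>\<^sup>2 \<le> \<eta> * s / 2 * (norm (gn_grad A B C Q R D (K j)))\<^sup>2"
      using s_pos \<eta>_pos by (intro mult_left_mono) auto
    then have "J (K (Suc j)) \<le> J (K j) - \<eta> * s / 2 * \<epsilon>\<^sup>2"
      using iterates(3)[of j] by linarith
    also have "J (K j) \<le> \<alpha> - real j * (\<eta> * s / 2 * \<epsilon>\<^sup>2)"
      using Suc by simp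
    finally show ?case by (simp add: algebra_simps add_divide_distrib)
  qed (use K0 in simp)
  from this[of "Suc n"] J_pos[OF iterates(1)[of "Suc n"]]
  have "real (Suc n) * (\<eta> * s / 2 * \<epsilon>\<^sup>2) < \<alpha>" by simp
  moreover have "0 < \<eta> * s * \<epsilon>\<^sup>2" using s_pos \<eta>_pos \<epsilon> by simp
  ultimately have "real (Suc n) < ?b"
    by (simp add: less_divide_eq mult_ac)
  then show False using n(2) by linarith
qed

text \<open>Dropping the nonnegative second summand of \<open>L\<close> and using
  \<open>\<mu> \<le> \<alpha> / sigma_min Q\<close> leaves
  \<open>2 * s \<le> L \<alpha>\<close>.\<close>

lemma step_le_half: "\<eta> \<le> 1 / 2"
proof -
  let ?x = "axis undefined 1 :: real^'m"
  have "sigma_min R * (?x \<bullet> ?x) \<le> norm ?x * (norm2 R * norm ?x)"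
    by (intro order_trans[OF sym_posdef_quad_ge[OF R]] order_trans[OF norm_cauchy_schwarz]
        mult_left_mono norm2_bound) auto
  then have R_le: "sigma_min R \<le> norm2 R"
    by (simp add: inner_axis_axis norm_axis_1)
  have C_le: "(sigma_min C)\<^sup>2 \<le> (norm2 C)\<^sup>2"
    using sigma_min_le_norm2[of C] norm2_transpose_le[of C] sigma_C_pos by (intro power_mono) auto
  have \<alpha>: "0 < \<alpha>" "\<mu> \<le> \<alpha> / sigma_min Q"
    using J_pos[OF K0(1)] J_ge[OF K0(1)] K0(2) sigma_Q_pos by (auto simp: le_divide_eq)
  have z: "0 \<le> zeta1 B C Q R \<mu> \<alpha>"
    using zeta_nonneg[OF K0(1)] K0(2) by simp
  have "2 * s = 2 * \<mu> * (sigma_min R * (sigma_min C)\<^sup>2)" by simp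
  also have "\<dots> \<le> 2 * (\<alpha> / sigma_min Q) * (norm2 R * (norm2 C)\<^sup>2)"
    using \<alpha> sigma_Q_pos sigma_R_pos R_le C_le mu_pos by (intro mult_mono) auto
  also have "\<dots> = 2 * \<alpha> / sigma_min Q * (norm2 R) * (norm2 C)\<^sup>2" by simp
  also have "\<dots> \<le> L \<alpha>"
    unfolding smooth_const_def
    using \<alpha> z sigma_Q_pos mu_pos norm2_nonneg[of B] norm2_nonneg[of C]
    by (intro mult_right_mono mult_left_mono) auto
  finally have "2 * s \<le> L \<alpha>" .
  then have "\<eta> * L \<alpha> \<le> 1 / 2 * L \<alpha>" using step_bound by linarith
  then show ?thesis using L_pos by simp
qed

lemma linear_convergence:
  assumes Cl: "Cl ** C = mat 1" and Ks: "Ks \<in> stab" and min: "\<And>K. K \<in> stab \<Longrightarrow> J Ks \<le> J K"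
    and \<epsilon>: "0 < \<epsilon>" and n: "norm2 (Sig Ks) / (2 * \<eta> * \<mu>) * ln ((J (K 0) - J Ks) / \<epsilon>) \<le> real n"
  shows "J (K n) - J Ks \<le> \<epsilon>"
proof -
  define c where "c = 2 * \<eta> * \<mu> / norm2 (Sig Ks)"
  define \<delta> where "\<delta> i = J (K i) - J Ks" for i
  have \<mu>: "\<mu> \<le> norm2 (Sig Ks)" by (rule mu_le_norm2_Sig[OF Ks])
  have c: "0 < c" using \<mu> mu_pos \<eta>_pos by (simp add: c_def)
  have "2 * \<eta> * \<mu> \<le> 1 * norm2 (Sig Ks)"
    using step_le_half \<mu> mu_pos \<eta>_pos by (intro mult_mono) auto
  then have c1: "c \<le> 1" using \<mu> mu_pos by (simp add: c_def divide_le_eq)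
  have nonneg: "0 \<le> \<delta> i" for i using min[OF iterates(1)] by (simp add: \<delta>_def)
  have "\<delta> i \<le> (1 - c) ^ i * \<delta> 0" for i
  proof (induction i)
    case (Suc i)
    have "\<delta> (Suc i) \<le> (1 - c) * \<delta> i"
      unfolding \<delta>_def c_def
      by (rule gauss_newton_contraction[OF iterates(1) gn_grad[OF iterates(1)] iterates(1) step Ks
            \<eta>_pos step_le_half Cl min[OF iterates(1)]])
    also have "\<dots> \<le> (1 - c) * ((1 - c) ^ i * \<delta> 0)"
      using Suc c1 by (intro mult_left_mono) auto
    finally show ?case by (simp add: mult.assoc)
  qed simp
  \<comment> \<open>Monotonicity of the power needs a nonnegative base, hence
    \<open>c \<le> 1\<close>, which rests on \<open>\<eta> \<le> 1 / 2\<close>.\<close>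
  moreover have "(1 - c) ^ n \<le> exp (- c) ^ n"
    using exp_ge_add_one_self[of "- c"] c1 by (intro power_mono) auto
  ultimately have "\<delta> n \<le> exp (- c) ^ n * \<delta> 0"
    using mult_right_mono[OF _ nonneg[of 0]] order_trans by blast
  also have "\<dots> = exp (- (c * real n)) * \<delta> 0"
    by (simp add: exp_of_nat_mult[symmetric] mult.commute)
  also have "\<dots> \<le> \<epsilon>"
  \<comment> \<open>A run starting at the optimum has \<open>ln 0\<close> in the iteration bound,
    which carries no information; the claim is then immediate.\<close>
  proof (cases "\<delta> 0 = 0")
    case False
    then have \<delta>0: "0 < \<delta> 0" using nonneg[of 0] by simp
    have "ln (\<delta> 0 / \<epsilon>) \<le> c * real n"
      using n c \<mu> mu_pos \<eta>_pos unfolding \<delta>_def[symmetric] by (simp add: c_def field_simps)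
    then have "\<delta> 0 / \<epsilon> \<le> exp (c * real n)"
      using \<delta>0 \<epsilon> by (metis divide_pos_pos exp_le_cancel_iff exp_ln)
    then show ?thesis
      using \<epsilon> by (simp add: exp_minus field_simps)
  qed (use \<epsilon> in simp)
  finally show ?thesis by (simp add: \<delta>_def)
qed

end

end

theorem theorem4:
  fixes A :: "real^'n^'n" and B :: "real^'m^'n" and C :: "real^'n^'d"
    and Q :: "real^'n^'n" and R :: "real^'m^'m" and D :: "(real^'n) measure"
    and K0 :: "real^'d^'m" and K :: "nat \<Rightarrow> real^'d^'m"
    and \<alpha> \<mu> \<eta> :: real
  assumes "controllable A B" and "observable C A" and "lin_indep_rows C"
    and "sym_posdef Q" and "sym_posdef R"
    and "prob_space D" and "sets D = sets borel"
    and "integrable D (\<lambda>x0. outer x0 x0)" and "sym_posdef (second_moment D)"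
    and "\<mu> = sigma_min (second_moment D)"
    and "K0 \<in> stabilizing A B C" and "sof_cost A B C Q R D K0 = \<alpha>"
    and "0 < \<eta>"
    and "\<eta> \<le> \<mu> * sigma_min R * (sigma_min C)\<^sup>2 / smooth_const B C Q R \<mu> \<alpha>"
    and "K 0 = K0"
    and "\<And>i. K (Suc i) = K i - \<eta> *\<^sub>R gn_grad A B C Q R D (K i)"
  shows "(\<forall>i. sof_cost A B C Q R D (K (Suc i)) \<le> sof_cost A B C Q R D (K i))
       \<and> (\<forall>i. K i \<in> sublevel A B C Q R D \<alpha>)
       \<and> sublevel A B C Q R D \<alpha> \<subseteq> stabilizing A B C
       \<and> (\<forall>\<epsilon>>0. \<exists>i. real i \<le> 2 * \<alpha> / (\<eta> * \<mu> * sigma_min R * (sigma_min C)\<^sup>2 * \<epsilon>\<^sup>2)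
                     \<and> frob_norm (gn_grad A B C Q R D (K i)) \<le> \<epsilon>)
       \<and> (CARD('d) = CARD('n) \<and> rank C = CARD('n) \<longrightarrow>
           (\<forall>Kstar. is_arg_min (sof_cost A B C Q R D) (\<lambda>K'. K' \<in> stabilizing A B C) Kstar \<longrightarrow>
             (\<forall>\<epsilon>J>0. \<forall>N::nat.
               real N \<ge> norm2 (Sigma_mat A B C D Kstar) / (2 * \<eta> * \<mu>)
                         * ln ((sof_cost A B C Q R D K0 - opt_state_cost A B Q R D) / \<epsilon>J)
               \<longrightarrow> sof_cost A B C Q R D (K N) - opt_state_cost A B Q R D \<le> \<epsilon>J)))"
proof -
  have X0: "sym_posdef (second_moment D)" by fact
  have K0: "K 0 \<in> stabilizing A B C" and J0: "sof_cost A B C Q R D (K 0) = \<alpha>"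
    using assms by auto
  have mu: "\<mu> = sigma_min (second_moment D)" by fact
  interpret lqr_dist A B C Q R D \<mu>
  proof
    show "\<mu> * (x \<bullet> x) \<le> x \<bullet> (second_moment D *v x)" for x
      unfolding mu by (rule sym_posdef_quad_ge[OF X0])
    show "0 < \<mu>"
      unfolding mu by (rule sym_posdef_sigma_min_pos[OF X0])
  qed (use assms in \<open>auto simp: sym_posdef_transpose\<close>)
  note run = K0 J0[unfolded sof_cost_eq[OF K0]] \<open>0 < \<eta>\<close>
    \<open>\<eta> \<le> \<mu> * sigma_min R * (sigma_min C)\<^sup>2 / smooth_const B C Q R \<mu> \<alpha>\<close> assms(16)
  have stab: "K i \<in> stab" for i
    by (rule iterates(1)[OF run])
  have dec: "sof_cost A B C Q R D (K (Suc i)) \<le> sof_cost A B C Q R D (K i)" for i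
    using J_decreasing[OF run] by (simp add: sof_cost_eq stab)
  have sub: "K i \<in> sublevel A B C Q R D \<alpha>" for i
    using iterates(2)[OF run] by (simp add: sublevel_def sof_cost_eq stab)
  have stationary: "\<exists>i. real i \<le> 2 * \<alpha> / (\<eta> * \<mu> * sigma_min R * (sigma_min C)\<^sup>2 * \<epsilon>\<^sup>2)
      \<and> frob_norm (gn_grad A B C Q R D (K i)) \<le> \<epsilon>" if "0 < \<epsilon>" for \<epsilon>
    using stationary_iterate[OF run that] by (simp only: mult.assoc)
  have linear: "sof_cost A B C Q R D (K N) - opt_state_cost A B Q R D \<le> \<epsilon>"
    if C: "rank C = CARD('n)"
      and min: "is_arg_min (sof_cost A B C Q R D) (\<lambda>K'. K' \<in> stabilizing A B C) Ks"
      and \<epsilon>: "0 < \<epsilon>"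
      and N: "norm2 (Sigma_mat A B C D Ks) / (2 * \<eta> * \<mu>)
        * ln ((sof_cost A B C Q R D K0 - opt_state_cost A B Q R D) / \<epsilon>) \<le> real N"
    for Ks \<epsilon> N
  proof -
    \<comment> \<open>Full column rank supplies the left inverse that identifies output gains with
      state gains.\<close>
    have "inj ((*v) C)" using C by (simp add: full_rank_injective)
    then obtain Cl where Cl: "Cl ** C = mat 1"
      using matrix_left_invertible_injective by blast
    have Ks: "Ks \<in> stab" and minJ: "J Ks \<le> J K'" if "K' \<in> stab" for K'
      using min that by (auto simp: is_arg_min_def sof_cost_eq not_less)
    have opt: "opt_state_cost A B Q R D = J Ks"
      by (rule opt_state_cost_eq[OF Cl]) (use Ks minJ K0 in auto)
    show ?thesis
      unfolding opt sof_cost_eq[OF stab]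
    proof (rule linear_convergence[OF run Cl _ _ \<epsilon>])
      show "norm2 (Sig Ks) / (2 * \<eta> * \<mu>) * ln ((J (K 0) - J Ks) / \<epsilon>) \<le> real N"
        using N Ks[OF K0] K0 assms(15) by (simp add: opt Sigma_mat_eq sof_cost_eq)
    qed (use Ks minJ K0 in auto)
  qed
  show ?thesis
    using dec sub stationary linear by (auto simp: sublevel_def)
qed

end
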